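(* Let $n \geq 2$ be an integer, let $\alpha, \gamma \in [0,n]$, and let $t$ be a real number such that $$0 < t < \gamma + \beta\left(\alpha, S^{n-1}\right) - n + 1 \leq 1.$$ Then there exists a constant $C$, depending only on $n$, $t$, $\alpha$ and $\gamma$, such that for any finite Borel measures $\mu$ and $\nu$ supported in the unit ball of $\mathbb{R}^n$: $$\int I_t\left(d_{\#}(\nu,\delta_x)\right) \, d\mu(x) \leq C\, c_{\alpha}(\mu)\, I_{\gamma}(\nu) \quad \text{if } \gamma \leq (n-1)/2,$$ and $$\int I_t\left(\Delta(\nu,\delta_x)\right) \, d\mu(x) \leq C\, c_{\alpha}(\mu)\, I_{\gamma}(\nu) \quad \text{if } \gamma > (n-1)/2.$$
   Context: All measures are non-negative. $\delta_x$ is the Dirac measure at $x \in \mathbb{R}^n$. Let $d: \mathbb{R}^n \times \mathbb{R}^n \to [0,\infty)$, $d(x,y) = |x-y|$, be the Euclidean distance function. For finite compactly supported Borel measures $\mu,\nu$ on $\mathbb{R}^n$, $d_{\#}(\mu,\nu)$ denotes the pushforward of the product measure $\mu \times \nu$ under $d$, viewed as a Borel measure on $\mathbb{R}$. In particular, $d_{\#}(\nu,\delta_x)$ is the pushforward of $\nu$ under $y \mapsto |x-y|$. The weighted distance measure $\Delta(\mu,\nu)$ is the Borel measure on $\mathbb{R}$ defined by $$\int \phi(s)\, d\Delta(\mu,\nu)(s) = \int\int |x-y|^{-(n-1)/2}\, \phi(|x-y|)\, d\mu(x)\, d\nu(y)$$ for all non-negative Borel measurable $\phi: \mathbb{R}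 \to [0,\infty]$. Equivalently, $\int \phi \, d\Delta(\mu,\nu) = \int s^{-(n-1)/2}\phi(s)\, d\left(d_{\#}(\mu,\nu)\right)(s)$. For a Borel measure $\lambda$ on a Euclidean space ($\mathbb{R}^n$ or $\mathbb{R}$) and $s \geq 0$, the $s$-energy is $I_s(\lambda) = \int\int |x-y|^{-s}\, d\lambda(x)\, d\lambda(y) \in [0,\infty]$. For a Borel measure $\mu$ on $\mathbb{R}^n$ and $\alpha \in [0,n]$, $c_\alpha(\mu) = \sup_{x \in \mathbb{R}^n,\, r>0} \mu(B(x,r))/r^{\alpha} \in [0,\infty]$, where $B(x,r)$ is the Euclidean ball with centre $x$ and radius $r$. The Fourier transform of a finite Borel measure $\mu$ on $\mathbb{R}^n$ is $\widehat{\mu}(\xi) = \int e^{-2\pi i \langle x,\xi\rangle}\, d\mu(x)$, and $\sigma$ is the surface measure on the unit sphere $S^{n-1} \subseteq \mathbb{R}^n$. For $\alpha \in [0,n]$, $\beta(\alpha, S^{n-1})$ is the supremum over all $\beta \geq 0$ for which there is a constant $C_\beta$ (which may depend on $\beta$, $\alpha$ and $n$, but not on $\mu$ or $r$) such that for all finite Borel measures $\mu$ with $\operatorname{supp}\mu \subseteq B(0,1)$, $$\int_{S^{n-1}} \left|\widehat{\mu}(r\xi)\right|^2 d\sigma(\xi) \leq C_\beta\, r^{-\beta} I_\alpha(\mu) \quad \text{for all } r > 0.$$ *)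

theory Defs
  imports "HOL-Probability.Probability"
begin

text \<open>
  The kernel \<open>r\<^sup>-\<^sup>s\<close> for \<open>r \<ge> 0\<close>, \<open>s \<ge> 0\<close>, with values in \<open>[0, \<infinity>]\<close>: it is \<open>\<infinity>\<close> at \<open>r = 0\<close> if \<open>s > 0\<close>,
  and identically \<open>1\<close> if \<open>s = 0\<close> (note that \<open>0 powr 0 = 0\<close> in the library).
\<close>

definition riesz_kernel :: "real \<Rightarrow> real \<Rightarrow> ennreal" where
  "riesz_kernel s r = (if s = 0 then 1 else inverse (ennreal (r powr s)))"

definition energy :: "real \<Rightarrow> 'a::euclidean_space measure \<Rightarrow> ennreal" where
  "energy s M = (\<integral>\<^sup>+ y. \<integral>\<^sup>+ x. riesz_kernel s (dist x y) \<partial>M \<partial>M)"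

definition frostman_const :: "real \<Rightarrow> 'a::euclidean_space measure \<Rightarrow> ennreal" where
  "frostman_const \<alpha> M = (SUP x. SUP r\<in>{0<..}. emeasure M (cball x r) / ennreal (r powr \<alpha>))"

definition dist_push :: "'a::euclidean_space measure \<Rightarrow> 'a measure \<Rightarrow> real measure" where
  "dist_push M N = distr (M \<Otimes>\<^sub>M N) borel (\<lambda>(x, y). dist x y)"

definition weighted_dist :: "'a::euclidean_space measure \<Rightarrow> 'a measure \<Rightarrow> real measure" where
  "weighted_dist M N =
     density (dist_push M N) (riesz_kernel ((real DIM('a) - 1) / 2))"

definition measure_support :: "'a::topological_space measure \<Rightarrow> 'a set" where
  "measure_support M = {x. \<forall>U. open U \<and> x \<in> U \<longrightarrow> emeasure M U > 0}"

definition unit_ball_measures :: "'a::euclidean_space measure set" where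
  "unit_ball_measures =
     {M. sets M = sets borel \<and> finite_measure M \<and> measure_support M \<subseteq> cball 0 1}"

definition fourier :: "'a::euclidean_space measure \<Rightarrow> 'a \<Rightarrow> complex" where
  "fourier M \<xi> = (LINT x|M. exp (- 2 * of_real pi * \<i> * of_real (x \<bullet> \<xi>)))"

text \<open>
  Surface measure on the unit sphere, in polar coordinates: \<open>\<sigma>(A)\<close> is \<open>n\<close> times the volume of the
  cone \<open>{r \<omega> | \<omega> \<in> A, 0 < r \<le> 1}\<close> over \<open>A\<close>; see \<open>emeasure_sphere_measure\<close> below.
\<close>

definition sphere_measure :: "'a::euclidean_space measure" where
  "sphere_measure =
     scale_measure (of_nat DIM('a))
       (distr (restrict_space lborel (cball 0 1 - {0})) (restrict_space borel (sphere 0 1)) sgn)"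

text \<open>
  The supremum is taken in the extended reals: it is \<open>\<infinity>\<close> for \<open>\<alpha> = n\<close>, since then every non-zero
  admissible measure has infinite energy.
\<close>

definition sphere_decay :: "'a::euclidean_space itself \<Rightarrow> real \<Rightarrow> ereal" where
  "sphere_decay _ \<alpha> =
     Sup {ereal \<beta> |\<beta>. 0 \<le> \<beta> \<and>
       (\<exists>C::real. 0 \<le> C \<and> (\<forall>M \<in> (unit_ball_measures :: 'a measure set). \<forall>r>0.
          (\<integral>\<^sup>+ \<xi>. ennreal ((cmod (fourier M (r *\<^sub>R \<xi>)))\<^sup>2) \<partial>sphere_measure)
            \<le> ennreal C * ennreal (r powr (- \<beta>)) * energy \<alpha> M))}"

lemma measurable_riesz_kernel [measurable]: "riesz_kernel s \<in> borel_measurable borel"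
  unfolding riesz_kernel_def by measurable

lemma measurable_dist_pair:
  assumes "sets (M :: 'a::euclidean_space measure) = sets borel" "sets N = sets borel"
  shows "(\<lambda>(x, y). dist x y) \<in> borel_measurable (M \<Otimes>\<^sub>M N)"
proof -
  have "sets (M \<Otimes>\<^sub>M N) = sets (borel \<Otimes>\<^sub>M borel)"
    by (rule sets_pair_measure_cong[OF assms])
  then show ?thesis
    by (simp cong: measurable_cong_sets)
qed

lemma nn_integral_weighted_dist:
  fixes M N :: "'a::euclidean_space measure"
  assumes M: "sets M = sets borel" "finite_measure M"
    and N: "sets N = sets borel" "finite_measure N"
    and \<phi>: "\<phi> \<in> borel_measurable borel"
  shows "(\<integral>\<^sup>+ s. \<phi> s \<partial>weighted_dist M N) =
    (\<integral>\<^sup>+ y. \<integral>\<^sup>+ x. riesz_kernel ((real DIM('a) - 1) / 2) (dist x y) * \<phi> (dist x y) \<partial>M \<partial>N)"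
proof -
  interpret M: finite_measure M by fact
  interpret N: finite_measure N by fact
  interpret P: pair_sigma_finite M N ..
  note [measurable] = \<phi> and m [measurable] = measurable_dist_pair[OF M(1) N(1)]
  let ?k = "riesz_kernel ((real DIM('a) - 1) / 2)"
  have "(\<integral>\<^sup>+ s. \<phi> s \<partial>weighted_dist M N) = (\<integral>\<^sup>+ s. ?k s * \<phi> s \<partial>dist_push M N)"
    unfolding weighted_dist_def
    by (rule nn_integral_density) (simp_all add: dist_push_def cong: measurable_cong_sets)
  also have "\<dots> = (\<integral>\<^sup>+ z. (\<lambda>s. ?k s * \<phi> s) ((\<lambda>(x, y). dist x y) z) \<partial>(M \<Otimes>\<^sub>M N))"
    unfolding dist_push_def by (rule nn_integral_distr) measurable
  also have "\<dots> = (\<integral>\<^sup>+ y. \<integral>\<^sup>+ x. (\<lambda>s. ?k s * \<phi> s) ((\<lambda>(x, y). dist x y) (x, y)) \<partial>M \<partial>N)"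
    by (rule P.nn_integral_snd[symmetric]) measurable
  finally show ?thesis by simp
qed

lemma emeasure_sphere_measure:
  fixes A :: "'a::euclidean_space set"
  assumes "A \<in> sets borel" "A \<subseteq> sphere 0 1"
  shows "emeasure sphere_measure A =
    of_nat DIM('a) * emeasure lborel {x \<in> cball 0 1 - {0}. x /\<^sub>R norm x \<in> A}"
proof -
  have m: "sgn \<in> measurable (restrict_space lborel (cball 0 1 - {0::'a}))
             (restrict_space borel (sphere 0 1))"
    by (rule measurable_restrict_space2)
      (auto simp: space_restrict_space norm_sgn sgn_div_norm intro!: measurable_restrict_space1)
  have A: "A \<in> sets (restrict_space borel (sphere 0 1))"
    using assms by (subst sets_restrict_space_iff) auto
  have eq: "sgn -` A \<inter> space (restrict_space lborel (cball 0 1 - {0::'a})) =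
      {x \<in> cball 0 1 - {0}. x /\<^sub>R norm x \<in> A}"
    by (auto simp: space_restrict_space sgn_div_norm)
  show ?thesis
    unfolding sphere_measure_def emeasure_scale_measure emeasure_distr[OF m A] eq
    by (subst emeasure_restrict_space) auto
qed

lemma measure_support_subset_closed_iff:
  fixes M :: "'a::second_countable_topology measure"
  assumes M: "sets M = sets borel" and K: "closed K"
  shows "measure_support M \<subseteq> K \<longleftrightarrow> emeasure M (- K) = 0"
proof
  assume sub: "measure_support M \<subseteq> K"
  define F where "F = {U. open U \<and> emeasure M U = 0}"
  obtain F' where F': "F' \<subseteq> F" "countable F'" "\<Union>F' = \<Union>F"
    using Lindelof[of F] by (auto simp: F_def)
  have "(\<Union>U\<in>F'. U) \<in> null_sets M"
    using F' M by (intro null_sets_UN') (auto simp: F_def null_sets_def)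
  moreover have "- K \<subseteq> \<Union>F"
    using sub by (auto simp: measure_support_def F_def zero_less_iff_neq_zero subset_eq)
  moreover have "- K \<in> sets M"
    using M K by simp
  ultimately have "- K \<in> null_sets M"
    using F'(3) null_sets_subset[of "\<Union>F'" M "- K"] by simp
  then show "emeasure M (- K) = 0"
    by (rule null_setsD1)
next
  assume "emeasure M (- K) = 0"
  then show "measure_support M \<subseteq> K"
    using K by (force simp: measure_support_def)
qed

end

theory Submission
  imports Defs "HOL-Real_Asymp.Real_Asymp"
begin

text \<open>
Write \<open>n\<close> for the dimension, \<open>e(\<theta>) = exp (2\<pi>i\<theta>)\<close>, \<open>\<sigma>\<close> for the surface measure and
\<open>w(y) = \<bar>y\<bar>\<^sup>-\<^sup>(\<^sup>n\<^sup>-\<^sup>1\<^sup>)\<^sup>/\<^sup>2\<close>.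
The energy of \<open>\<Delta>(\<nu>, \<delta>\<^sub>x)\<close> is the integral of
\<open>w(y - x) w(z - x)\<close> times the kernel of order \<open>t\<close> at \<open>\<bar>\<bar>z - x\<bar> - \<bar>y - x\<bar>\<bar>\<close> against \<open>\<nu> \<times> \<nu>\<close>.
Cutting this kernel into dyadic pieces reduces everything to one scale \<open>R = 2\<^sup>j\<close>: the part where the
two distances to the pin differ by at most \<open>2 / R\<close> has to be \<open>O((j + 1) R\<^sup>-\<^sup>\<kappa>)\<close> for some \<open>\<kappa> > t\<close>
(lemma \<open>single_scale_estimate\<close>).

If both points are within \<open>O(1 / R)\<close> of the pin, no oscillation is needed: a dyadic decomposition of
\<open>w\<close> and the bound of \<open>\<mu>\<close>-masses of balls by the Frostman constant give \<open>R\<^sup>-\<^sup>\<eta>\<close> with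
\<open>\<eta> = \<alpha> + \<gamma> - n + 1\<close> (\<open>near_part_estimate\<close>). This is good enough because a decay exponent \<open>\<beta>\<close> can
never exceed \<open>\<alpha>\<close>, as a point mass shows (\<open>decay_exponent_le_dimension\<close>).

Otherwise the weight is at most a constant times \<open>1 / R\<close> times the average over \<open>\<omega>\<close> in the sphere
of \<open>R\<^sup>n exp (-\<pi> R\<^sup>2 \<bar>(y - x) - \<bar>z - x\<bar>\<omega>\<bar>\<^sup>2)\<close>: the Gaussian is of size \<open>R\<^sup>n\<close> on a cap of radius about
\<open>1 / (R \<bar>z - x\<bar>)\<close> around the direction of \<open>y - x\<close> (\<open>spherical_gaussian_ge\<close>). This average is exactly
computable on the Fourier side. The transform of \<open>\<sigma>\<close> is radial, so
\<open>\<bar>\<xi>\<bar>(z - x)\<close> may be replaced by \<open>\<bar>z - x\<bar>\<xi>\<close> in it, and polar coordinates together with the Fourier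
transform of a Gaussian turn the average, integrated against \<open>\<nu> \<times> \<nu>\<close>, into
\<open>\<integral> r\<^sup>n\<^sup>-\<^sup>1 exp (-\<pi> r\<^sup>2 / R\<^sup>2) \<bar>F\<^sub>r(x)\<bar>\<^sup>2 dr\<close> over \<open>r > 0\<close>, where \<open>F\<^sub>r(x) = \<integral> e(r x \<bullet> \<omega>) \<nu>\<^sup>^(r\<omega>) d\<sigma>(\<omega>)\<close>
(\<open>nn_integral_gaussian_spherical_square\<close>). It is Plancherel's theorem for radial functions in
disguise, and it takes the place of any asymptotics of Bessel functions.

Now integrate over the pin \<open>x\<close>. The map from \<open>\<nu>\<^sup>^(r\<cdot>)\<close> to \<open>F\<^sub>r\<close> is dual to restricting the Fourier
transform of \<open>g \<mu>\<close> to the sphere of radius \<open>r\<close>, which the definition of \<open>\<beta>(\<alpha>, S\<^sup>n\<^sup>-\<^sup>1)\<close> controls by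
\<open>I\<^sub>\<alpha>(g \<mu>)\<close>. That energy can be infinite although \<open>c\<^sub>\<alpha>(\<mu>)\<close> is finite; but at frequency \<open>r\<close> the measure
may be smeared out at scale \<open>1 / r\<close>, which truncates the kernel there
(\<open>spherical_decay_bound_mollified\<close>). Schur's test with the Frostman condition then costs a factor
\<open>r\<^sup>\<epsilon>\<close> only, and one arrives at a bound \<open>C r\<^sup>-\<^sup>\<beta>\<^sup>' c\<^sub>\<alpha>(\<mu>) \<integral> \<bar>\<nu>\<^sup>^(r\<omega>)\<bar>\<^sup>2 d\<sigma>(\<omega>)\<close> for the integral of
\<open>\<bar>F\<^sub>r\<bar>\<^sup>2\<close> against \<open>\<mu>\<close>, with \<open>\<beta>'\<close> as close to \<open>\<beta>\<close> as needed (\<open>extension_estimate\<close>). What remains is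
the integral of \<open>max(\<bar>\<xi>\<bar>, 1)\<^sup>-\<^sup>\<beta>\<^sup>' exp (-\<pi> \<bar>\<xi>\<bar>\<^sup>2 / R\<^sup>2) \<bar>\<nu>\<^sup>^(\<xi>)\<bar>\<^sup>2\<close>, which is \<open>O((j + 1) R\<^sup>n\<^sup>-\<^sup>\<gamma>\<^sup>-\<^sup>\<beta>\<^sup>') I\<^sub>\<gamma>(\<nu>)\<close>
(\<open>weighted_gaussian_fourier_le_energy\<close>). The hypothesis that \<open>\<gamma> + \<beta> - n + 1\<close> is at most \<open>1\<close> enters
here, as \<open>n - \<gamma> - \<beta>' \<ge> 0\<close>. With the factor \<open>1 / R\<close> the exponent is \<open>\<kappa> = \<gamma> + \<beta>' - n + 1 > t\<close>.

Distances in the unit ball are at most \<open>2\<close>, where the weight is bounded below, so the weighted estimate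
implies the unweighted one. The case \<open>\<alpha> = n\<close>, excluded in the mollification, is incompatible with
the hypotheses: a nonzero finite measure has infinite \<open>n\<close>-energy, so the supremum defining \<open>\<beta>\<close> is
infinite (\<open>sphere_decay_dim\<close>).
\<close>

section \<open>Dyadic decomposition of Riesz kernels\<close>

lemma suminf_const_ennreal:
  assumes "0 < c"
  shows "(\<Sum>k::nat. c :: ennreal) = \<infinity>"
proof -
  have "(\<Sum>k::nat. c) = (\<integral>\<^sup>+k. c \<partial>count_space (UNIV :: nat set))"
    by (rule nn_integral_count_space_nat[symmetric])
  also have "\<dots> = \<infinity>"
    using assms by (simp add: ennreal_mult_eq_top_iff)
  finally show ?thesis .
qed

lemma term_le_suminf_ennreal: "f k \<le> (\<Sum>k::nat. f k :: ennreal)"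
  using sum_le_suminf[of f "{k}"] by simp

lemma riesz_kernel_pos: "0 < d \<Longrightarrow> riesz_kernel s d = ennreal (d powr - s)"
  by (auto simp: riesz_kernel_def powr_minus inverse_ennreal)

lemma riesz_kernel_zero: "0 < s \<Longrightarrow> riesz_kernel s 0 = \<infinity>"
  by (simp add: riesz_kernel_def)

lemma riesz_kernel_mono:
  assumes "0 \<le> s" "0 \<le> d" "d \<le> \<rho>"
  shows "riesz_kernel s \<rho> \<le> riesz_kernel s d"
proof (cases "s = 0 \<or> d = 0")
  case True
  then show ?thesis using assms by (auto simp: riesz_kernel_zero riesz_kernel_def)
next
  case False
  then have "0 < d" using assms by simp
  then show ?thesis using assms False
    by (simp add: riesz_kernel_pos powr_mono2' ennreal_leI)
qed

lemma dyadic_scale_exists: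
  fixes d \<rho> :: real
  assumes "0 < d" "d \<le> \<rho>"
  obtains k :: nat where "\<rho> / 2 ^ Suc k < d" "d \<le> \<rho> / 2 ^ k"
proof -
  have "\<exists>k::nat. \<rho> / 2 ^ Suc k < d"
  proof -
    obtain k :: nat where "(1/2 :: real) ^ k < d / \<rho>"
      using real_arch_pow_inv[of "d / \<rho>" "1/2"] assms by auto
    then have "\<rho> / 2 ^ k < d" using assms by (simp add: field_simps)
    moreover have "\<rho> / 2 ^ Suc k \<le> \<rho> / 2 ^ k" using assms by (simp add: field_simps)
    ultimately show ?thesis by (meson le_less_trans)
  qed
  then have 1: "\<rho> / 2 ^ Suc (LEAST k. \<rho> / 2 ^ Suc k < d) < d" by (rule LeastI_ex)
  have "d \<le> \<rho> / 2 ^ (LEAST k. \<rho> / 2 ^ Suc k < d)"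
  proof (cases "LEAST k. \<rho> / 2 ^ Suc k < d")
    case 0 then show ?thesis using assms by simp
  next
    case (Suc m)
    then have "\<not> \<rho> / 2 ^ Suc m < d" by (metis lessI not_less_Least)
    then show ?thesis using Suc by simp
  qed
  with 1 show thesis by (rule that)
qed

text \<open>
The dyadic shell that contains \<open>d\<close> contributes the value of the kernel at its inner radius, which is at
least the value at \<open>d\<close>. For \<open>d = 0\<close> all indicators are \<open>1\<close> and the series diverges, which accounts for the
infinite value of the kernel.
\<close>

lemma riesz_kernel_le_dyadic_sum:
  assumes "0 \<le> s" "0 \<le> d" "d \<le> \<rho>" "0 < \<rho>"
  shows "riesz_kernel s d \<le> (\<Sum>k. ennreal ((\<rho> / 2 ^ Suc k) powr - s) * indicator {..\<rho> / 2 ^ k} d)"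
proof (cases "d = 0")
  case True
  have "(\<infinity>::ennreal) = (\<Sum>k::nat. ennreal ((\<rho> / 2) powr - s))"
    using assms by (simp add: suminf_const_ennreal)
  also have "\<dots> \<le> (\<Sum>k. ennreal ((\<rho> / 2 ^ Suc k) powr - s) * indicator {..\<rho> / 2 ^ k} d)"
  proof (rule suminf_le)
    fix k :: nat
    have "(\<rho> / 2) powr - s \<le> (\<rho> / 2 ^ Suc k) powr - s"
      using assms by (intro powr_mono2') (auto simp: field_simps)
    then show "ennreal ((\<rho> / 2) powr - s) \<le> ennreal ((\<rho> / 2 ^ Suc k) powr - s) * indicator {..\<rho> / 2 ^ k} d"
      using assms True by (simp add: ennreal_leI)
  qed auto
  finally show ?thesis by (simp add: top_unique)
next
  case False
  then obtain k :: nat where k: "\<rho> / 2 ^ Suc k < d" "d \<le> \<rho> / 2 ^ k"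
    using dyadic_scale_exists[of d \<rho>] assms by auto
  have "riesz_kernel s d \<le> ennreal ((\<rho> / 2 ^ Suc k) powr - s) * indicator {..\<rho> / 2 ^ k} d"
    using False assms k by (auto simp: riesz_kernel_pos intro!: ennreal_leI powr_mono2')
  also have "\<dots> \<le> (\<Sum>k. ennreal ((\<rho> / 2 ^ Suc k) powr - s) * indicator {..\<rho> / 2 ^ k} d)"
    by (rule term_le_suminf_ennreal)
  finally show ?thesis .
qed

section \<open>Surface measure and polar coordinates\<close>

text \<open>
The surface measure carried over to the Borel sets of the whole space, so that functions on the
space can be integrated against it without restricting them first.
\<close>

definition surface :: "'a::euclidean_space measure" where
  "surface = distr sphere_measure borel (\<lambda>x. x)"

lemma sets_surface [simp, measurable_cong]: "sets surface = sets borel"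
  by (simp add: surface_def)

lemma space_surface [simp]: "space surface = UNIV"
  by (simp add: surface_def)

lemma measurable_sgn_sphere:
  "sgn \<in> measurable (restrict_space lborel (cball 0 1 - {0::'a::euclidean_space}))
     (restrict_space borel (sphere 0 1))"
  by (rule measurable_restrict_space2)
    (auto simp: space_restrict_space norm_sgn sgn_div_norm intro!: measurable_restrict_space1)

lemma sets_sphere_measure:
  "sets (sphere_measure :: 'a::euclidean_space measure) = sets (restrict_space borel (sphere 0 1))"
  by (simp add: sphere_measure_def)

lemma measurable_sphere_measure:
  assumes "f \<in> borel_measurable borel"
  shows "f \<in> borel_measurable (sphere_measure :: 'a::euclidean_space measure)"
  using measurable_restrict_space1[OF assms] by (simp cong: measurable_cong_sets add: sets_sphere_measure)

lemma nn_integral_sphere_measure: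
  fixes f :: "'a::euclidean_space \<Rightarrow> ennreal"
  assumes [measurable]: "f \<in> borel_measurable borel"
  shows "(\<integral>\<^sup>+\<omega>. f \<omega> \<partial>sphere_measure) = (\<integral>\<^sup>+\<omega>. f \<omega> \<partial>surface)"
  unfolding surface_def
  by (subst nn_integral_distr)
    (auto intro!: measurable_sphere_measure simp: measurable_cong_sets[OF sets_sphere_measure refl] measurable_restrict_space1)

lemma nn_integral_surface:
  fixes f :: "'a::euclidean_space \<Rightarrow> ennreal"
  assumes [measurable]: "f \<in> borel_measurable borel"
  shows "(\<integral>\<^sup>+\<omega>. f \<omega> \<partial>surface) =
    of_nat DIM('a) * (\<integral>\<^sup>+x. f (sgn x) * indicator (cball 0 1 - {0}) x \<partial>lborel)"
proof -
  have "(\<integral>\<^sup>+\<omega>. f \<omega> \<partial>surface) = (\<integral>\<^sup>+\<omega>. f \<omega> \<partial>sphere_measure)"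
    by (rule nn_integral_sphere_measure[symmetric]) measurable
  also have "\<dots> = of_nat DIM('a) * (\<integral>\<^sup>+x. f (sgn x) \<partial>restrict_space lborel (cball 0 1 - {0}))"
    unfolding sphere_measure_def
    by (subst nn_integral_scale_measure)
      (auto intro!: measurable_restrict_space1 nn_integral_distr[OF measurable_sgn_sphere]
        arg_cong2[where f="(*)"])
  also have "(\<integral>\<^sup>+x. f (sgn x) \<partial>restrict_space lborel (cball 0 1 - {0})) =
     (\<integral>\<^sup>+x. f (sgn x) * indicator (cball 0 1 - {0}) x \<partial>lborel)"
    by (rule nn_integral_restrict_space) auto
  finally show ?thesis .
qed

lemma emeasure_surface_UNIV_less_top: "emeasure (surface :: 'a::euclidean_space measure) UNIV < \<infinity>"
proof -
  have "emeasure (surface :: 'a measure) UNIV = (\<integral>\<^sup>+\<omega>. 1 \<partial>(surface :: 'a measure))"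
    by simp
  also have "\<dots> = of_nat DIM('a) * emeasure lborel (cball 0 1 - {0::'a})"
    by (subst nn_integral_surface) auto
  also have "\<dots> \<le> of_nat DIM('a) * emeasure lborel (cball (0::'a) 1)"
    by (intro mult_left_mono emeasure_mono) auto
  also have "\<dots> < \<infinity>"
    using emeasure_lborel_cball_finite[of "0::'a" 1] by (auto simp: ennreal_mult_less_top of_nat_less_top)
  finally show ?thesis .
qed

lemma finite_measure_surface: "finite_measure (surface :: 'a::euclidean_space measure)"
  using emeasure_surface_UNIV_less_top[where 'a='a] by (intro finite_measureI) auto

interpretation surface: finite_measure "surface :: 'a::euclidean_space measure"
  by (rule finite_measure_surface)

lemma AE_surface_norm: "AE \<omega> in (surface :: 'a::euclidean_space measure). norm \<omega> = 1"
proof -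
  have "(\<integral>\<^sup>+\<omega>. indicator {\<omega>. norm \<omega> \<noteq> 1} \<omega> \<partial>(surface :: 'a measure)) = 0"
    by (subst nn_integral_surface) (auto simp: norm_sgn nn_integral_0_iff_AE indicator_def)
  then have "emeasure (surface :: 'a measure) {\<omega>. norm \<omega> \<noteq> 1} = 0"
    by simp
  then show ?thesis by (intro AE_I[of _ _ "{\<omega>. norm \<omega> \<noteq> 1}"]) auto
qed

lemma nn_integral_lborel_scale:
  fixes f :: "'a::euclidean_space \<Rightarrow> ennreal"
  assumes [measurable]: "f \<in> borel_measurable borel" and c: "0 < c"
  shows "(\<integral>\<^sup>+x. f x \<partial>lborel) = ennreal (c ^ DIM('a)) * (\<integral>\<^sup>+x. f (a + c *\<^sub>R x) \<partial>lborel)"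
proof -
  have "(\<integral>\<^sup>+x. f x \<partial>lborel) = (\<integral>\<^sup>+x. f x \<partial>density (distr lborel borel (\<lambda>x. a + c *\<^sub>R x)) (\<lambda>_. ennreal (\<bar>c\<bar> ^ DIM('a))))"
    using lborel_affine[of c a] c by simp
  also have "\<dots> = (\<integral>\<^sup>+x. ennreal (c ^ DIM('a)) * f (a + c *\<^sub>R x) \<partial>lborel)"
    using c by (simp add: nn_integral_density nn_integral_distr)
  also have "\<dots> = ennreal (c ^ DIM('a)) * (\<integral>\<^sup>+x. f (a + c *\<^sub>R x) \<partial>lborel)"
    by (rule nn_integral_cmult) measurable
  finally show ?thesis .
qed

lemma nn_integral_power_tail:
  fixes a :: real and n :: nat
  assumes "0 < a" "0 < n"
  shows "(\<integral>\<^sup>+s. ennreal (1 / s ^ Suc n) * indicator {a..} s \<partial>lborel) = ennreal (1 / (real n * a ^ n))"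
proof -
  have "(\<integral>\<^sup>+s. ennreal (1 / s ^ Suc n) * indicator {a..} s \<partial>lborel) = ennreal (0 - (- 1 / (real n * a ^ n)))"
  proof (rule nn_integral_FTC_atLeast)
    fix s :: real assume "a \<le> s"
    then have s: "0 < s" using assms by simp
    have "((\<lambda>s. - 1 / (real n * s ^ n)) has_real_derivative (real n * (real n * s ^ (n - 1))) / (real n * s ^ n)\<^sup>2) (at s)"
      using s assms by (auto intro!: derivative_eq_intros simp: power2_eq_square)
    moreover have "(real n * (real n * s ^ (n - 1))) / (real n * s ^ n)\<^sup>2 = 1 / s ^ Suc n"
      using s assms by (cases n) (simp_all add: power2_eq_square divide_simps del: of_nat_Suc)
    ultimately show "((\<lambda>s. - 1 / (real n * s ^ n)) has_real_derivative 1 / s ^ Suc n) (at s)" by simp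
    show "0 \<le> 1 / s ^ Suc n" using s by simp
  next
    have "((\<lambda>s. - (1 / real n) * (inverse s) ^ n) \<longlongrightarrow> - (1 / real n) * 0 ^ n) at_top"
      by (intro tendsto_intros tendsto_inverse_0_at_top filterlim_ident)
    then show "((\<lambda>s. - 1 / (real n * s ^ n)) \<longlongrightarrow> 0) at_top"
      using assms by (simp add: field_simps power_0_left)
  qed auto
  then show ?thesis by simp
qed

text \<open>
The surface measure is given by volumes of cones, so the right-hand side is an integral over the unit
ball and a radius. The substitutions \<open>r = s \<bar>x\<bar>\<close> and \<open>y = s x\<close> turn it into
\<open>n \<integral> f(y) \<bar>y\<bar>\<^sup>n (\<integral> s\<^sup>-\<^sup>n\<^sup>-\<^sup>1 ds) dy\<close> with \<open>s\<close> ranging over \<open>s \<ge> \<bar>y\<bar>\<close>, and the inner integral is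
\<open>\<bar>y\<bar>\<^sup>-\<^sup>n / n\<close>.
\<close>

theorem nn_integral_polar:
  fixes f :: "'a::euclidean_space \<Rightarrow> ennreal"
  assumes [measurable]: "f \<in> borel_measurable borel"
  shows "(\<integral>\<^sup>+x. f x \<partial>lborel) =
    (\<integral>\<^sup>+r. indicator {0<..} r * ennreal (r ^ (DIM('a) - 1)) * (\<integral>\<^sup>+\<omega>. f (r *\<^sub>R \<omega>) \<partial>surface) \<partial>lborel)"
    (is "_ = ?R")
proof -
  define n where "n = DIM('a)"
  have n: "0 < n" by (simp add: n_def)
  let ?B = "indicator (cball 0 1 - {0::'a}) :: 'a \<Rightarrow> ennreal"
  let ?P = "indicator {0<..} :: real \<Rightarrow> ennreal"
  have [measurable]: "?B \<in> borel_measurable borel" by (intro borel_measurable_indicator) auto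
  let ?Z = "\<lambda>y::'a. if y = 0 then 0 else 1 :: ennreal"
  let ?J = "\<lambda>(y::'a) s. if norm y \<le> s then 1 else 0 :: ennreal"
  have "?R = (\<integral>\<^sup>+r. \<integral>\<^sup>+x. of_nat n * ?P r * ennreal (r ^ (n - 1)) * f (r *\<^sub>R sgn x) * ?B x \<partial>lborel \<partial>lborel)"
  proof (rule nn_integral_cong)
    fix r :: real
    have "(\<integral>\<^sup>+x. of_nat n * ?P r * ennreal (r ^ (n - 1)) * f (r *\<^sub>R sgn x) * ?B x \<partial>lborel) =
      (\<integral>\<^sup>+x. of_nat n * ?P r * ennreal (r ^ (n - 1)) * (f (r *\<^sub>R sgn x) * ?B x) \<partial>lborel)"
      by (simp only: mult.assoc)
    also have "\<dots> = of_nat n * ?P r * ennreal (r ^ (n - 1)) * (\<integral>\<^sup>+x. f (r *\<^sub>R sgn x) * ?B x \<partial>lborel)"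
      by (rule nn_integral_cmult) measurable
    finally show "?P r * ennreal (r ^ (DIM('a) - 1)) * (\<integral>\<^sup>+\<omega>. f (r *\<^sub>R \<omega>) \<partial>surface) =
      (\<integral>\<^sup>+x. of_nat n * ?P r * ennreal (r ^ (n - 1)) * f (r *\<^sub>R sgn x) * ?B x \<partial>lborel)"
      by (subst nn_integral_surface) (simp_all add: n_def mult_ac)
  qed
  also have "\<dots> = (\<integral>\<^sup>+x. \<integral>\<^sup>+r. of_nat n * ?P r * ennreal (r ^ (n - 1)) * f (r *\<^sub>R sgn x) * ?B x \<partial>lborel \<partial>lborel)"
    by (rule lborel_pair.Fubini') measurable
  also have "\<dots> = (\<integral>\<^sup>+x. \<integral>\<^sup>+s. of_nat n * ?P s * ennreal (norm x ^ n * s ^ (n - 1)) * f (s *\<^sub>R x) * ?B x \<partial>lborel \<partial>lborel)"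
  proof (rule nn_integral_cong)
    fix x :: 'a
    show "(\<integral>\<^sup>+r. of_nat n * ?P r * ennreal (r ^ (n - 1)) * f (r *\<^sub>R sgn x) * ?B x \<partial>lborel) =
      (\<integral>\<^sup>+s. of_nat n * ?P s * ennreal (norm x ^ n * s ^ (n - 1)) * f (s *\<^sub>R x) * ?B x \<partial>lborel)"
    proof (cases "x = 0")
      case False
      then have x: "0 < norm x" by simp
      have "(\<integral>\<^sup>+r. of_nat n * ?P r * ennreal (r ^ (n - 1)) * f (r *\<^sub>R sgn x) * ?B x \<partial>lborel) =
        ennreal (norm x ^ 1) * (\<integral>\<^sup>+s. of_nat n * ?P (0 + norm x *\<^sub>R s) * ennreal ((0 + norm x *\<^sub>R s) ^ (n - 1)) * f ((0 + norm x *\<^sub>R s) *\<^sub>R sgn x) * ?B x \<partial>lborel)"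
        using nn_integral_lborel_scale[OF _ x, of "\<lambda>r. of_nat n * ?P r * ennreal (r ^ (n - 1)) * f (r *\<^sub>R sgn x) * ?B x" 0]
        by simp
      also have "\<dots> = (\<integral>\<^sup>+s. ennreal (norm x) * (of_nat n * ?P (norm x * s) * ennreal ((norm x * s) ^ (n - 1)) * f ((norm x * s) *\<^sub>R sgn x) * ?B x) \<partial>lborel)"
        by (subst nn_integral_cmult) auto
      also have "\<dots> = (\<integral>\<^sup>+s. of_nat n * ?P s * ennreal (norm x ^ n * s ^ (n - 1)) * f (s *\<^sub>R x) * ?B x \<partial>lborel)"
      proof (rule nn_integral_cong)
        fix s :: real
        have 1: "(norm x * s) *\<^sub>R sgn x = s *\<^sub>R x" using x by (simp add: sgn_div_norm)
        have 2: "?P (norm x * s) = ?P s" using x by (auto simp: indicator_def zero_less_mult_iff)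
        have 3: "?P s * (ennreal (norm x) * ennreal ((norm x * s) ^ (n - 1))) = ?P s * ennreal (norm x ^ n * s ^ (n - 1))"
        proof (cases "0 < s")
          case True
          have "norm x * (norm x * s) ^ (n - 1) = norm x ^ n * s ^ (n - 1)"
            using n by (cases n) (auto simp: power_mult_distrib)
          then show ?thesis by (simp add: ennreal_mult[symmetric] True order_less_imp_le)
        qed simp
        have "ennreal (norm x) * (of_nat n * ?P (norm x * s) * ennreal ((norm x * s) ^ (n - 1)) * f ((norm x * s) *\<^sub>R sgn x) * ?B x)
          = of_nat n * (?P s * (ennreal (norm x) * ennreal ((norm x * s) ^ (n - 1)))) * f (s *\<^sub>R x) * ?B x"
          unfolding 1 2 by (simp add: mult_ac)
        also have "\<dots> = of_nat n * ?P s * ennreal (norm x ^ n * s ^ (n - 1)) * f (s *\<^sub>R x) * ?B x"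
          unfolding 3 by (simp add: mult_ac)
        finally show "ennreal (norm x) * (of_nat n * ?P (norm x * s) * ennreal ((norm x * s) ^ (n - 1)) * f ((norm x * s) *\<^sub>R sgn x) * ?B x)
          = of_nat n * ?P s * ennreal (norm x ^ n * s ^ (n - 1)) * f (s *\<^sub>R x) * ?B x" .
      qed
      finally show ?thesis .
    qed simp
  qed
  also have "\<dots> = (\<integral>\<^sup>+s. \<integral>\<^sup>+x. of_nat n * ?P s * ennreal (norm x ^ n * s ^ (n - 1)) * f (s *\<^sub>R x) * ?B x \<partial>lborel \<partial>lborel)"
    by (rule lborel_pair.Fubini') measurable
  also have "\<dots> = (\<integral>\<^sup>+s. \<integral>\<^sup>+y. of_nat n * f y * ennreal (norm y ^ n) * (ennreal (1 / s ^ Suc n) * ?J y s) * (?P s * ?Z y) \<partial>lborel \<partial>lborel)"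
  proof (rule nn_integral_cong)
    fix s :: real
    show "(\<integral>\<^sup>+x. of_nat n * ?P s * ennreal (norm x ^ n * s ^ (n - 1)) * f (s *\<^sub>R x) * ?B x \<partial>lborel) =
      (\<integral>\<^sup>+y. of_nat n * f y * ennreal (norm y ^ n) * (ennreal (1 / s ^ Suc n) * ?J y s) * (?P s * ?Z y) \<partial>lborel)"
      (is "?l = ?r")
    proof (cases "0 < s")
      case True
      have "?r = ennreal (s ^ n) * (\<integral>\<^sup>+x. of_nat n * f (s *\<^sub>R x) * ennreal (norm (s *\<^sub>R x) ^ n) * (ennreal (1 / s ^ Suc n) * ?J (s *\<^sub>R x) s) * (?P s * ?Z (s *\<^sub>R x)) \<partial>lborel)"
      proof -
        have 0: "?P s = 1" using True by simp
        have "(\<lambda>y. of_nat n * f y * ennreal (norm y ^ n) * (ennreal (1 / s ^ Suc n) * ?J y s) * ?Z y) \<in> borel_measurable borel"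
          by measurable
        from nn_integral_lborel_scale[OF this True, of 0]
        show ?thesis
          unfolding 0 mult_1_left n_def[symmetric] by simp
      qed
      also have "\<dots> = (\<integral>\<^sup>+x. ennreal (s ^ n) * (of_nat n * f (s *\<^sub>R x) * ennreal (norm (s *\<^sub>R x) ^ n) * (ennreal (1 / s ^ Suc n) * ?J (s *\<^sub>R x) s) * (?P s * ?Z (s *\<^sub>R x))) \<partial>lborel)"
        by (subst nn_integral_cmult) auto
      also have "\<dots> = ?l"
      proof (rule nn_integral_cong)
        fix x :: 'a
        have 1: "?J (s *\<^sub>R x) s * ?Z (s *\<^sub>R x) = ?B x"
          using True by (auto simp: indicator_def mult_le_cancel_left1)
        have "s ^ n * (norm (s *\<^sub>R x) ^ n * (1 / s ^ Suc n)) = norm x ^ n * s ^ (n - 1)"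
          using True n by (cases n) (auto simp: field_simps power_mult_distrib)
        then have 2: "ennreal (s ^ n) * (ennreal (norm (s *\<^sub>R x) ^ n) * ennreal (1 / s ^ Suc n)) = ennreal (norm x ^ n * s ^ (n - 1))"
          using True by (simp add: ennreal_mult[symmetric])
        have "ennreal (s ^ n) * (of_nat n * f (s *\<^sub>R x) * ennreal (norm (s *\<^sub>R x) ^ n) * (ennreal (1 / s ^ Suc n) * ?J (s *\<^sub>R x) s) * (?P s * ?Z (s *\<^sub>R x)))
         = of_nat n * ?P s * f (s *\<^sub>R x) * (ennreal (s ^ n) * (ennreal (norm (s *\<^sub>R x) ^ n) * ennreal (1 / s ^ Suc n))) * (?J (s *\<^sub>R x) s * ?Z (s *\<^sub>R x))"
          by (simp only: mult_ac)
        then show "ennreal (s ^ n) * (of_nat n * f (s *\<^sub>R x) * ennreal (norm (s *\<^sub>R x) ^ n) * (ennreal (1 / s ^ Suc n) * ?J (s *\<^sub>R x) s) * (?P s * ?Z (s *\<^sub>R x)))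
         = of_nat n * ?P s * ennreal (norm x ^ n * s ^ (n - 1)) * f (s *\<^sub>R x) * ?B x"
          unfolding 1 2 by (simp only: mult_ac)
      qed
      finally show ?thesis by simp
    qed simp
  qed
  also have "\<dots> = (\<integral>\<^sup>+y. \<integral>\<^sup>+s. of_nat n * f y * ennreal (norm y ^ n) * (ennreal (1 / s ^ Suc n) * ?J y s) * (?P s * ?Z y) \<partial>lborel \<partial>lborel)"
    by (rule lborel_pair.Fubini') measurable
  also have "\<dots> = (\<integral>\<^sup>+y. f y \<partial>lborel)"
  proof (rule nn_integral_cong_AE)
    have *: "(\<integral>\<^sup>+s. of_nat n * f y * ennreal (norm y ^ n) * (ennreal (1 / s ^ Suc n) * ?J y s) * (?P s * ?Z y) \<partial>lborel) = f y"
      if y: "y \<noteq> 0" for y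
    proof -
      have "(\<integral>\<^sup>+s. of_nat n * f y * ennreal (norm y ^ n) * (ennreal (1 / s ^ Suc n) * ?J y s) * (?P s * ?Z y) \<partial>lborel)
        = (\<integral>\<^sup>+s. of_nat n * f y * ennreal (norm y ^ n) * (ennreal (1 / s ^ Suc n) * ?J y s) \<partial>lborel)"
      proof (rule nn_integral_cong)
        fix s :: real
        have "0 < norm y" using y by simp
        then have "?J y s * ?P s = ?J y s"
          by (auto simp: indicator_def simp del: zero_less_norm_iff)
        then have "(ennreal (1 / s ^ Suc n) * ?J y s) * ?P s = ennreal (1 / s ^ Suc n) * ?J y s"
          by (simp add: mult.assoc)
        then show "of_nat n * f y * ennreal (norm y ^ n) * (ennreal (1 / s ^ Suc n) * ?J y s) * (?P s * ?Z y) =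
          of_nat n * f y * ennreal (norm y ^ n) * (ennreal (1 / s ^ Suc n) * ?J y s)"
          using y by (simp add: mult.assoc del: power_Suc)
      qed
      also have "\<dots> = of_nat n * f y * ennreal (norm y ^ n) * ennreal (1 / (real n * norm y ^ n))"
        using nn_integral_power_tail[of "norm y" n] y n by (subst nn_integral_cmult) (auto simp: indicator_def of_bool_def)
      also have "\<dots> = f y * (ennreal (real n) * ennreal (norm y ^ n) * ennreal (1 / (real n * norm y ^ n)))"
        by (simp add: mult_ac ennreal_of_nat_eq_real_of_nat)
      also have "ennreal (real n) * ennreal (norm y ^ n) * ennreal (1 / (real n * norm y ^ n)) = 1"
        using y n by (simp add: ennreal_mult[symmetric])
      finally show ?thesis by simp
    qed
    show "AE y in lborel. (\<integral>\<^sup>+s. of_nat n * f y * ennreal (norm y ^ n) * (ennreal (1 / s ^ Suc n) * ?J y s) * (?P s * ?Z y) \<partial>lborel) = f y"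
      using AE_lborel_singleton[of "0::'a"] by eventually_elim (use * in simp)
  qed
  finally show ?thesis by simp
qed

section \<open>Fourier transforms of finite measures\<close>

lemma cball_borel [measurable]: "cball (a :: 'a::euclidean_space) r \<in> sets borel"
  by simp

abbreviation cis2pi :: "real \<Rightarrow> complex" where
  "cis2pi t \<equiv> cis (2 * pi * t)"

lemma measurable_cis [measurable]: "cis \<in> borel_measurable borel"
  by (intro borel_measurable_continuous_onI continuous_intros)

lemma fourier_eq: "fourier M \<xi> = (LINT x|M. cis2pi (- (x \<bullet> \<xi>)))"
  unfolding fourier_def by (simp add: cis_conv_exp mult_ac)

lemma cmod_fourier_le:
  assumes "finite_measure M"
  shows "cmod (fourier M \<xi>) \<le> measure M (space M)"
proof -
  interpret finite_measure M by fact
  have "cmod (LINT x|M. cis2pi (- (x \<bullet> \<xi>))) \<le> (LINT x|M. cmod (cis2pi (- (x \<bullet> \<xi>))))"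
    by (rule integral_norm_bound)
  then show ?thesis by (simp add: fourier_eq)
qed

lemma (in finite_measure) integrable_bounded:
  fixes f :: "'a \<Rightarrow> 'b::{banach, second_countable_topology}"
  assumes "f \<in> borel_measurable M" "\<And>x. norm (f x) \<le> B"
  shows "integrable M f"
  using assms by (intro integrable_const_bound[of _ B]) auto

lemma borel_measurable_fourier [measurable]:
  fixes M :: "'a::euclidean_space measure"
  assumes [measurable_cong]: "sets M = sets borel" and "finite_measure M"
  shows "fourier M \<in> borel_measurable borel"
proof -
  interpret finite_measure M by fact
  have "(\<lambda>\<xi>. LINT x|M. cis2pi (- (x \<bullet> \<xi>))) \<in> borel_measurable borel" by measurable
  then show ?thesis by (simp add: fourier_eq[abs_def])
qed

section \<open>Rotation invariance of the surface measure\<close>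

text \<open>
Uniqueness of translation invariant measures, for which only Tonelli's theorem is needed. The image
measure \<open>m\<close> is invariant under translations and agrees with Lebesgue measure on the unit ball \<open>B\<close>.
Evaluating \<open>\<integral>\<integral> 1\<^sub>B(x) 1\<^sub>A(y)\<close> against Lebesgue measure times \<open>m\<close>, after shifting first \<open>x\<close> by \<open>y\<close> and
then \<open>y\<close> by \<open>-x\<close>, gives both \<open>\<lambda>(B) m(A)\<close> and \<open>m(B) \<lambda>(A)\<close>.
\<close>

lemma lborel_distr_isometric_involution:
  fixes f :: "'a::euclidean_space \<Rightarrow> 'a"
  assumes lin: "linear f" and inv: "\<And>x. f (f x) = x" and iso: "\<And>x. norm (f x) = norm x"
  shows "distr lborel borel f = lborel"
proof (rule measure_eqI)
  have [measurable]: "f \<in> borel_measurable borel"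
    using lin by (intro borel_measurable_continuous_onI linear_continuous_on linear_conv_bounded_linear[THEN iffD1])
  define m where "m = distr lborel borel f"
  have sm [simp, measurable_cong]: "sets m = sets borel" by (simp add: m_def)
  have nn_m: "(\<integral>\<^sup>+y. h y \<partial>m) = (\<integral>\<^sup>+x. h (f x) \<partial>lborel)" if [measurable]: "h \<in> borel_measurable borel" for h
    unfolding m_def by (rule nn_integral_distr) measurable
  have shift: "(\<integral>\<^sup>+x. h (a + x) \<partial>lborel) = (\<integral>\<^sup>+x. h x \<partial>lborel)" if [measurable]: "h \<in> borel_measurable borel"
    for h :: "'a \<Rightarrow> ennreal" and a
    using nn_integral_lborel_scale[OF that, of 1 a] by simp
  have refl: "(\<integral>\<^sup>+x. h (a - x) \<partial>lborel) = (\<integral>\<^sup>+x. h x \<partial>lborel)" if [measurable]: "h \<in> borel_measurable borel"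
    for h :: "'a \<Rightarrow> ennreal" and a
    by (subst (2) lborel_affine[of "-1" a]) (simp_all add: nn_integral_density nn_integral_distr)
  have shift_m: "(\<integral>\<^sup>+x. h (a + x) \<partial>m) = (\<integral>\<^sup>+x. h x \<partial>m)" if [measurable]: "h \<in> borel_measurable borel"
    for h :: "'a \<Rightarrow> ennreal" and a
  proof -
    have "(\<integral>\<^sup>+x. h (a + x) \<partial>m) = (\<integral>\<^sup>+x. h (f (f a + x)) \<partial>lborel)"
      by (simp add: nn_m linear_add[OF lin] inv)
    also have "\<dots> = (\<integral>\<^sup>+x. h (f x) \<partial>lborel)"
      by (rule shift) measurable
    finally show ?thesis by (simp add: nn_m)
  qed
  let ?B = "cball (0::'a) 1"
  have mB: "emeasure m ?B = emeasure lborel ?B"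
  proof -
    have "f -` ?B = ?B" using iso by auto
    then show ?thesis unfolding m_def by (subst emeasure_distr) auto
  qed
  have fin: "emeasure lborel ?B < \<infinity>" "emeasure lborel ?B > 0"
    using emeasure_lborel_cball_finite[of "0::'a" 1] by (auto simp: emeasure_cball)
  have sfm: "sigma_finite_measure m"
  proof (rule sigma_finite_measure.intro, intro exI conjI ballI)
    show "countable (range (\<lambda>k::nat. cball (0::'a) (real k)))" by simp
    show "range (\<lambda>k::nat. cball (0::'a) (real k)) \<subseteq> sets m" by auto
    show "\<Union> (range (\<lambda>k::nat. cball (0::'a) (real k))) = space m"
      using real_arch_simple by (auto simp: m_def)
    fix A assume "A \<in> range (\<lambda>k::nat. cball (0::'a) (real k))"
    then obtain k where A: "A = cball 0 (real k)" by auto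
    then have "f -` A = A" using iso by auto
    then show "emeasure m A \<noteq> \<infinity>"
      using emeasure_lborel_cball_finite[of "0::'a" "real k"] A unfolding m_def by (subst emeasure_distr) auto
  qed
  interpret m: sigma_finite_measure m by fact
  interpret P: pair_sigma_finite lborel m ..
  fix A assume "A \<in> sets (distr lborel borel f)"
  then have [measurable]: "A \<in> sets borel" by simp
  have inner: "(\<integral>\<^sup>+x. indicator C x * c \<partial>L) = emeasure L C * c" if "sets L = sets borel" "C \<in> sets borel"
    for L :: "'a measure" and c C
    using that by (subst nn_integral_multc) auto
  have "emeasure lborel ?B * emeasure m A = (\<integral>\<^sup>+y. \<integral>\<^sup>+x. indicator ?B x * indicator A y \<partial>lborel \<partial>m)"
    by (simp only: inner sets_lborel borel_closed[OF closed_cball]) (simp add: nn_integral_cmult)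
  also have "\<dots> = (\<integral>\<^sup>+y. \<integral>\<^sup>+x. indicator ?B (y + x) * indicator A y \<partial>lborel \<partial>m)"
  proof (rule nn_integral_cong)
    fix y :: 'a
    show "(\<integral>\<^sup>+x. indicator ?B x * indicator A y \<partial>lborel) = (\<integral>\<^sup>+x. indicator ?B (y + x) * indicator A y \<partial>lborel)"
      by (rule shift[of "\<lambda>x. indicator ?B x * indicator A y" y, symmetric]) measurable
  qed
  also have "\<dots> = (\<integral>\<^sup>+x. \<integral>\<^sup>+y. indicator ?B (y + x) * indicator A y \<partial>m \<partial>lborel)"
    by (rule P.Fubini') measurable
  also have "\<dots> = (\<integral>\<^sup>+x. \<integral>\<^sup>+y. indicator ?B y * indicator A (y - x) \<partial>m \<partial>lborel)"
  proof (rule nn_integral_cong)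
    fix x :: 'a
    show "(\<integral>\<^sup>+y. indicator ?B (y + x) * indicator A y \<partial>m) = (\<integral>\<^sup>+y. indicator ?B y * indicator A (y - x) \<partial>m)"
      using shift_m[of "\<lambda>y. indicator ?B y * indicator A (y - x)" x] by (simp add: add.commute)
  qed
  also have "\<dots> = (\<integral>\<^sup>+y. \<integral>\<^sup>+x. indicator ?B y * indicator A (y - x) \<partial>lborel \<partial>m)"
    by (rule P.Fubini'[symmetric]) measurable
  also have "\<dots> = (\<integral>\<^sup>+y. \<integral>\<^sup>+x. indicator ?B y * indicator A x \<partial>lborel \<partial>m)"
  proof (rule nn_integral_cong)
    fix y :: 'a
    show "(\<integral>\<^sup>+x. indicator ?B y * indicator A (y - x) \<partial>lborel) = (\<integral>\<^sup>+x. indicator ?B y * indicator A x \<partial>lborel)"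
      by (rule refl[of "\<lambda>x. indicator ?B y * indicator A x" y]) measurable
  qed
  also have "\<dots> = emeasure m ?B * emeasure lborel A"
    by (simp add: nn_integral_cmult inner)
  finally have "emeasure lborel ?B * emeasure m A = emeasure lborel ?B * emeasure lborel A"
    unfolding mB .
  then show "emeasure (distr lborel borel f) A = emeasure lborel A"
    using fin unfolding m_def[symmetric] by (subst (asm) ennreal_mult_cancel_left) auto
qed simp

lemma surface_distr_isometric_involution:
  fixes f :: "'a::euclidean_space \<Rightarrow> 'a"
  assumes lin: "linear f" and inv: "\<And>x. f (f x) = x" and iso: "\<And>x. norm (f x) = norm x"
  shows "distr surface borel f = surface"
proof (rule measure_eqI)
  have [measurable]: "f \<in> borel_measurable borel"
    using lin by (intro borel_measurable_continuous_onI linear_continuous_on linear_conv_bounded_linear[THEN iffD1])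
  fix A assume "A \<in> sets (distr surface borel f)"
  then have [measurable]: "A \<in> sets borel" by simp
  have [measurable]: "(indicator (cball 0 1 - {0}) :: 'a \<Rightarrow> ennreal) \<in> borel_measurable borel"
    by (intro borel_measurable_indicator) auto
  have sgn: "f (sgn x) = sgn (f x)" for x
    by (simp add: sgn_div_norm iso linear_scale[OF lin])
  have ind: "indicator (cball 0 1 - {0}) (f x) = (indicator (cball 0 1 - {0}) x :: ennreal)" for x
    using iso[of x] by (auto simp: indicator_def)
  have "emeasure (distr surface borel f) A = (\<integral>\<^sup>+\<omega>. indicator A (f \<omega>) \<partial>surface)"
    by (subst nn_integral_distr[symmetric, of _ _ borel]) auto
  also have "\<dots> = of_nat DIM('a) * (\<integral>\<^sup>+x. indicator A (sgn (f x)) * indicator (cball 0 1 - {0}) (f x) \<partial>lborel)"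
    by (subst nn_integral_surface) (auto simp: sgn ind)
  also have "(\<integral>\<^sup>+x. indicator A (sgn (f x)) * indicator (cball 0 1 - {0}) (f x) \<partial>lborel)
    = (\<integral>\<^sup>+x. indicator A (sgn x) * indicator (cball 0 1 - {0}) x \<partial>distr lborel borel f)"
    by (subst nn_integral_distr) auto
  also have "of_nat DIM('a) * \<dots> = (\<integral>\<^sup>+\<omega>. indicator A \<omega> \<partial>surface)"
    unfolding lborel_distr_isometric_involution[OF assms] by (subst nn_integral_surface) auto
  finally show "emeasure (distr surface borel f) A = emeasure surface A" by simp
qed simp

text \<open>
The reflection in the hyperplane orthogonal to \<open>v - w\<close> is an isometric involution that exchanges
\<open>v\<close> and \<open>w\<close>.
\<close>

lemma surface_exponential_radial:
  fixes v w :: "'a::euclidean_space"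
  assumes "norm v = norm w"
  shows "(LINT \<omega>|surface. cis2pi (v \<bullet> \<omega>)) = (LINT \<omega>|surface. cis2pi (w \<bullet> \<omega>))"
proof (cases "v = w")
  case False
  define u where "u = v - w"
  have u: "u \<bullet> u \<noteq> 0" using False by (simp add: u_def)
  define f where "f x = x - (2 * (x \<bullet> u) / (u \<bullet> u)) *\<^sub>R u" for x
  have lin: "linear f"
    by (rule linearI) (auto simp: f_def algebra_simps inner_simps add_divide_distrib)
  have adj: "f x \<bullet> y = x \<bullet> f y" for x y
    by (simp add: f_def inner_simps inner_commute)
  have inv: "f (f x) = x" for x
    using u by (simp add: f_def inner_simps algebra_simps scaleR_add_left[symmetric])
  have iso: "norm (f x) = norm x" for x
    by (simp add: norm_eq_sqrt_inner adj inv)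
  have "v \<bullet> v = w \<bullet> w" using assms by (simp add: norm_eq)
  then have "2 * (v \<bullet> u) = u \<bullet> u"
    by (simp add: u_def inner_simps inner_commute)
  then have fv: "f v = w" using u by (simp add: f_def) (simp add: u_def)
  have [measurable]: "f \<in> borel_measurable borel"
    using lin by (intro borel_measurable_continuous_onI linear_continuous_on linear_conv_bounded_linear[THEN iffD1])
  have "(LINT \<omega>|surface. cis2pi (w \<bullet> \<omega>)) = (LINT \<omega>|distr surface borel f. cis2pi (w \<bullet> \<omega>))"
    by (simp add: surface_distr_isometric_involution[OF lin inv iso])
  also have "\<dots> = (LINT \<omega>|surface. cis2pi (w \<bullet> f \<omega>))"
    by (rule integral_distr) measurable
  also have "\<dots> = (LINT \<omega>|surface. cis2pi (v \<bullet> \<omega>))"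
    using fv inv by (simp add: adj[symmetric]) (metis inv)
  finally show ?thesis by simp
qed simp

section \<open>Gaussian integrals\<close>

text \<open>
The characteristic function of the standard normal distribution, rescaled by
\<open>x = t \<surd>(2\<pi>) / R\<close>.
\<close>

lemma integral_gaussian_exponential_real:
  assumes R: "0 < R"
  shows "(LINT t|lborel. of_real (exp (- pi * t\<^sup>2 / R\<^sup>2)) * cis2pi (a * t)) = of_real (R * exp (- pi * R\<^sup>2 * a\<^sup>2))"
proof -
  define c where "c = sqrt (2 * pi) / R"
  have c: "c > 0" "c \<noteq> 0" using R by (auto simp: c_def)
  define b where "b = sqrt (2 * pi) * R * a"
  have "complex_of_real (exp (- (b^2) / 2)) = char std_normal_distribution b"
    by (simp add: char_std_normal_distribution)
  also have "\<dots> = (LINT x|lborel. std_normal_density x *\<^sub>R iexp (b * x))"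
    unfolding char_def by (subst integral_density) (auto simp: std_normal_density_def)
  also have "\<dots> = \<bar>c\<bar> *\<^sub>R (LINT t|lborel. std_normal_density (0 + c * t) *\<^sub>R iexp (b * (0 + c * t)))"
    by (rule lborel_integral_real_affine[OF c(2)])
  also have "(LINT t|lborel. std_normal_density (0 + c * t) *\<^sub>R iexp (b * (0 + c * t))) =
     (LINT t|lborel. (1 / sqrt (2 * pi)) *\<^sub>R (of_real (exp (- pi * t\<^sup>2 / R\<^sup>2)) * cis2pi (a * t)))"
  proof (rule Bochner_Integration.integral_cong[OF HOL.refl])
    fix t :: real
    have 1: "(c * t)\<^sup>2 / 2 = pi * t\<^sup>2 / R\<^sup>2"
      by (simp add: c_def power_mult_distrib power_divide)
    have "sqrt (2 * pi) * sqrt (2 * pi) = 2 * pi" by simp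
    then have 2: "b * (c * t) = 2 * pi * (a * t)"
      using R by (simp add: b_def c_def field_simps)
    have "exp (- ((c * t)\<^sup>2 / 2)) = exp (- pi * t\<^sup>2 / R\<^sup>2)" unfolding 1 by simp
    moreover have "iexp (b * (c * t)) = cis2pi (a * t)"
      unfolding 2 by (simp add: cis_conv_exp mult_ac)
    ultimately show "std_normal_density (0 + c * t) *\<^sub>R iexp (b * (0 + c * t)) =
      (1 / sqrt (2 * pi)) *\<^sub>R (of_real (exp (- pi * t\<^sup>2 / R\<^sup>2)) * cis2pi (a * t))"
      by (simp add: std_normal_density_def scaleR_conv_of_real)
  qed
  also have "\<bar>c\<bar> *\<^sub>R (LINT t|lborel. (1 / sqrt (2 * pi)) *\<^sub>R (of_real (exp (- pi * t\<^sup>2 / R\<^sup>2)) * cis2pi (a * t)))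
    = (1 / R) *\<^sub>R (LINT t|lborel. of_real (exp (- pi * t\<^sup>2 / R\<^sup>2)) * cis2pi (a * t))"
    using c R by (simp add: c_def)
  finally have "(LINT t|lborel. of_real (exp (- pi * t\<^sup>2 / R\<^sup>2)) * cis2pi (a * t)) = R *\<^sub>R complex_of_real (exp (- (b^2) / 2))"
    using R by simp
  also have "b^2 / 2 = pi * R\<^sup>2 * a\<^sup>2" by (simp add: b_def power_mult_distrib)
  then have "exp (- (b^2) / 2) = exp (- pi * R\<^sup>2 * a\<^sup>2)" by simp
  finally show ?thesis by (simp add: scaleR_conv_of_real)
qed

lemma integrable_gaussian_real:
  assumes R: "0 < (R::real)"
  shows "integrable lborel (\<lambda>t. exp (- pi * t\<^sup>2 / R\<^sup>2))"
proof (rule ccontr)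
  assume "\<not> ?thesis"
  then have "\<not> integrable lborel (\<lambda>t. complex_of_real (exp (- pi * t\<^sup>2 / R\<^sup>2)))"
    by (subst complex_of_real_integrable_eq)
  then have "(LINT t|lborel. complex_of_real (exp (- pi * t\<^sup>2 / R\<^sup>2))) = 0"
    by (rule not_integrable_integral_eq)
  with integral_gaussian_exponential_real[OF R, of 0] R show False by simp
qed

lemma integral_lborel_prod:
  fixes g :: "'a::euclidean_space \<Rightarrow> real \<Rightarrow> complex"
  assumes "\<And>b. b \<in> Basis \<Longrightarrow> integrable lborel (g b)"
  shows "integrable lborel (\<lambda>x::'a. \<Prod>b\<in>Basis. g b (x \<bullet> b))"
    and "(LINT x|lborel. (\<Prod>b\<in>Basis. g b (x \<bullet> b))) = (\<Prod>b\<in>Basis. LINT t|lborel. g b t)"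
proof -
  interpret product_sigma_finite "\<lambda>_::'a. lborel :: real measure" ..
  have [measurable]: "g b \<in> borel_measurable borel" if "b \<in> Basis" for b
    using borel_measurable_integrable[OF assms[OF that]] by simp
  have m: "(\<lambda>x::'a. \<Prod>b\<in>Basis. g b (x \<bullet> b)) \<in> borel_measurable borel"
    by (intro borel_measurable_prod) measurable
  have mt: "(\<lambda>f. \<Sum>b\<in>Basis. f b *\<^sub>R b) \<in> measurable (\<Pi>\<^sub>M b\<in>Basis. lborel) (borel :: 'a measure)"
    by measurable
  have eq: "(\<Prod>b\<in>Basis. g b ((\<Sum>b'\<in>Basis. f b' *\<^sub>R b') \<bullet> b)) = (\<Prod>b\<in>Basis. g b (f b))" for f :: "'a \<Rightarrow> real"
    by (intro prod.cong HOL.refl arg_cong2[where f=g]) (simp add: inner_sum_left inner_Basis if_distrib cong: if_cong)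
  have "integrable (\<Pi>\<^sub>M b\<in>Basis. lborel) (\<lambda>f. \<Prod>b\<in>Basis. g b (f b))"
    by (rule product_integrable_prod) (auto intro: assms)
  then show "integrable lborel (\<lambda>x::'a. \<Prod>b\<in>Basis. g b (x \<bullet> b))"
    unfolding lborel_eq[where 'a='a] by (subst integrable_distr_eq[OF mt m]) (simp add: eq)
  show "(LINT x|lborel. (\<Prod>b\<in>Basis. g b (x \<bullet> b))) = (\<Prod>b\<in>Basis. LINT t|lborel. g b t)"
    by (subst lborel_eq[where 'a='a], subst integral_distr[OF mt m]) (simp add: eq product_integral_prod assms)
qed

lemma norm_square_eq_sum_Basis: "(norm (x::'a::euclidean_space))\<^sup>2 = (\<Sum>b\<in>Basis. (x \<bullet> b)\<^sup>2)"
  by (subst power2_norm_eq_inner, simp only: power2_eq_square, rule euclidean_inner)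

lemma cis_sum: "finite A \<Longrightarrow> cis (\<Sum>a\<in>A. f a) = (\<Prod>a\<in>A. cis (f a))"
  by (induction A rule: finite_induct) (auto simp: cis_mult[symmetric])

lemma gaussian_exponential_prod:
  fixes u x :: "'a::euclidean_space"
  shows "of_real (exp (- pi * (norm x)\<^sup>2 / R\<^sup>2)) * cis2pi (u \<bullet> x) =
    (\<Prod>b\<in>Basis. of_real (exp (- pi * (x \<bullet> b)\<^sup>2 / R\<^sup>2)) * cis2pi ((u \<bullet> b) * (x \<bullet> b)))"
proof -
  have "exp (- pi * (norm x)\<^sup>2 / R\<^sup>2) = (\<Prod>b\<in>Basis. exp (- pi * (x \<bullet> b)\<^sup>2 / R\<^sup>2))"
    unfolding norm_square_eq_sum_Basis exp_sum[OF finite_Basis, symmetric]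
    by (simp add: sum_distrib_left sum_divide_distrib sum_negf)
  moreover have "cis2pi (u \<bullet> x) = (\<Prod>b\<in>Basis. cis2pi ((u \<bullet> b) * (x \<bullet> b)))"
    unfolding cis_sum[OF finite_Basis, symmetric] by (simp add: euclidean_inner[of u x] sum_distrib_left)
  ultimately show ?thesis by (simp add: prod.distrib)
qed

lemma
  fixes u :: "'a::euclidean_space"
  assumes R: "0 < (R::real)"
  shows integrable_gaussian_exponential: "integrable lborel (\<lambda>x::'a. of_real (exp (- pi * (norm x)\<^sup>2 / R\<^sup>2)) * cis2pi (u \<bullet> x))"
    and integral_gaussian_exponential: "(LINT x|lborel. of_real (exp (- pi * (norm x)\<^sup>2 / R\<^sup>2)) * cis2pi (u \<bullet> x)) =
      of_real (R ^ DIM('a) * exp (- pi * R\<^sup>2 * (norm u)\<^sup>2))"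
proof -
  let ?g = "\<lambda>b t. of_real (exp (- pi * t\<^sup>2 / R\<^sup>2)) * cis2pi ((u \<bullet> b) * t)"
  have int: "integrable lborel (?g b)" for b
    by (rule Bochner_Integration.integrable_bound[OF integrable_gaussian_real[OF R]]) (auto simp: norm_mult)
  show "integrable lborel (\<lambda>x::'a. of_real (exp (- pi * (norm x)\<^sup>2 / R\<^sup>2)) * cis2pi (u \<bullet> x))"
    unfolding gaussian_exponential_prod by (rule integral_lborel_prod(1)) (rule int)
  have "(LINT x|lborel. of_real (exp (- pi * (norm x)\<^sup>2 / R\<^sup>2)) * cis2pi (u \<bullet> x)) = (\<Prod>b\<in>Basis. of_real (R * exp (- pi * R\<^sup>2 * (u \<bullet> b)\<^sup>2)))"
    unfolding gaussian_exponential_prod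
    by (subst integral_lborel_prod(2)[OF int]) (simp only: integral_gaussian_exponential_real[OF R])
  also have "\<dots> = of_real (R ^ DIM('a) * exp (- pi * R\<^sup>2 * (norm u)\<^sup>2))"
    unfolding norm_square_eq_sum_Basis
    by (simp add: prod.distrib exp_sum[OF finite_Basis, symmetric] sum_distrib_left sum_negf flip: of_real_prod)
  finally show "(LINT x|lborel. of_real (exp (- pi * (norm x)\<^sup>2 / R\<^sup>2)) * cis2pi (u \<bullet> x)) =
      of_real (R ^ DIM('a) * exp (- pi * R\<^sup>2 * (norm u)\<^sup>2))" .
qed

lemma integrable_gaussian:
  assumes "0 < (R::real)"
  shows "integrable lborel (\<lambda>x::'a::euclidean_space. exp (- pi * (norm x)\<^sup>2 / R\<^sup>2))"
proof -
  have "integrable lborel (\<lambda>x::'a. complex_of_real (exp (- pi * (norm x)\<^sup>2 / R\<^sup>2)))"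
    using integrable_gaussian_exponential[OF assms, of "0::'a"] by simp
  then show ?thesis by (simp only: complex_of_real_integrable_eq)
qed

text \<open>
Fubini's theorem and the transform of the Gaussian. With \<open>P = M \<times> M\<close> and \<open>u(x, y) = x - y\<close> it expresses
Gaussian averages of \<open>\<bar>M\<^sup>^\<bar>\<^sup>2\<close>; with \<open>P = \<nu> \<times> \<nu> \<times> \<sigma>\<close> it yields the spherical identity below.
\<close>

lemma gaussian_average:
  fixes u :: "'p \<Rightarrow> 'a::euclidean_space"
  assumes P: "finite_measure P" and [measurable]: "u \<in> borel_measurable P" and R: "0 < (R::real)"
  shows "(LINT x|lborel. of_real (exp (- pi * (norm x)\<^sup>2 / R\<^sup>2)) * (LINT p|P. cis2pi (u p \<bullet> x))) =
    of_real (LINT p|P. R ^ DIM('a) * exp (- pi * R\<^sup>2 * (norm (u p))\<^sup>2))"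
proof -
  interpret P: finite_measure P by fact
  interpret PP: pair_sigma_finite P "lborel :: 'a measure" ..
  let ?f = "\<lambda>(p, x). of_real (exp (- pi * (norm x)\<^sup>2 / R\<^sup>2)) * cis2pi (u p \<bullet> x)"
  have int: "integrable (P \<Otimes>\<^sub>M lborel) ?f"
  proof (rule PP.Fubini_integrable)
    show "integrable P (\<lambda>p. LINT x|lborel. norm (?f (p, x)))"
      by (simp add: norm_mult)
    show "AE p in P. integrable lborel (\<lambda>x. ?f (p, x))"
      unfolding split_conv by (intro AE_I2 integrable_gaussian_exponential[OF R])
  qed measurable
  have "(LINT x|lborel. of_real (exp (- pi * (norm x)\<^sup>2 / R\<^sup>2)) * (LINT p|P. cis2pi (u p \<bullet> x)))
     = (LINT x|lborel. LINT p|P. of_real (exp (- pi * (norm x)\<^sup>2 / R\<^sup>2)) * cis2pi (u p \<bullet> x))"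
    by simp
  also have "\<dots> = (LINT p|P. LINT x|lborel. of_real (exp (- pi * (norm x)\<^sup>2 / R\<^sup>2)) * cis2pi (u p \<bullet> x))"
    by (rule PP.Fubini_integral[OF int])
  also have "\<dots> = (LINT p|P. of_real (R ^ DIM('a) * exp (- pi * R\<^sup>2 * (norm (u p))\<^sup>2)))"
    by (simp only: integral_gaussian_exponential[OF R])
  also have "\<dots> = of_real (LINT p|P. R ^ DIM('a) * exp (- pi * R\<^sup>2 * (norm (u p))\<^sup>2))"
    by (rule integral_complex_of_real)
  finally show ?thesis .
qed

section \<open>Plancherel's identity for spherical averages\<close>

lemma measurable_cnj [measurable]: "cnj \<in> borel_measurable borel"
  by (intro borel_measurable_continuous_onI continuous_intros)

lemma lborel_eq_distr_polar:
  "(lborel :: 'a::euclidean_space measure) =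
    distr (density (lborel \<Otimes>\<^sub>M surface) (\<lambda>(r, \<omega>). ennreal (indicator {0<..} r * r ^ (DIM('a) - 1))))
      borel (\<lambda>(r, \<omega>). r *\<^sub>R \<omega>)" (is "_ = distr (density _ ?w) _ ?p")
proof (rule measure_eqI)
  fix A :: "'a set" assume "A \<in> sets lborel"
  then have [measurable]: "A \<in> sets borel" by simp
  have w: "ennreal (indicator {0<..} r * r ^ (DIM('a) - 1)) = indicator {0<..} r * ennreal (r ^ (DIM('a) - 1))" for r
    by (simp split: split_indicator)
  have "emeasure lborel A = (\<integral>\<^sup>+x. indicator A x \<partial>lborel)" by simp
  also have "\<dots> = (\<integral>\<^sup>+r. indicator {0<..} r * ennreal (r ^ (DIM('a) - 1)) * (\<integral>\<^sup>+\<omega>. indicator A (r *\<^sub>R \<omega>) \<partial>surface) \<partial>lborel)"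
    by (rule nn_integral_polar) measurable
  also have "\<dots> = (\<integral>\<^sup>+r. \<integral>\<^sup>+\<omega>. ?w (r, \<omega>) * indicator A (?p (r, \<omega>)) \<partial>surface \<partial>lborel)"
    by (simp add: nn_integral_cmult w[simplified])
  also have "\<dots> = (\<integral>\<^sup>+q. ?w q * indicator A (?p q) \<partial>(lborel \<Otimes>\<^sub>M surface))"
    by (rule surface.nn_integral_fst) measurable
  also have "\<dots> = (\<integral>\<^sup>+q. indicator A (?p q) \<partial>density (lborel \<Otimes>\<^sub>M surface) ?w)"
    by (rule nn_integral_density[symmetric]) measurable
  also have "\<dots> = (\<integral>\<^sup>+x. indicator A x \<partial>distr (density (lborel \<Otimes>\<^sub>M surface) ?w) borel ?p)"
    by (rule nn_integral_distr[symmetric]) measurable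
  finally show "emeasure lborel A = emeasure (distr (density (lborel \<Otimes>\<^sub>M surface) ?w) borel ?p) A"
    by simp
qed simp

lemma
  fixes f :: "'a::euclidean_space \<Rightarrow> complex"
  assumes f: "integrable lborel f"
  shows integrable_polar: "integrable lborel (\<lambda>r. (indicator {0<..} r * r ^ (DIM('a) - 1)) *\<^sub>R (LINT \<omega>|surface. f (r *\<^sub>R \<omega>)))"
    and integral_polar: "(LINT x|lborel. f x) = (LINT r|lborel. (indicator {0<..} r * r ^ (DIM('a) - 1)) *\<^sub>R (LINT \<omega>|surface. f (r *\<^sub>R \<omega>)))"
proof -
  interpret P: pair_sigma_finite lborel "surface :: 'a measure" ..
  let ?w = "\<lambda>(r, \<omega>::'a). indicator {0<..} r * r ^ (DIM('a) - 1) :: real"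
  let ?p = "\<lambda>(r, \<omega>::'a). r *\<^sub>R \<omega>"
  have [measurable]: "f \<in> borel_measurable borel" using f by auto
  have w: "(\<lambda>(r, \<omega>::'a). ennreal (indicator {0<..} r * r ^ (DIM('a) - 1))) = (\<lambda>q. ennreal (?w q))"
    by (auto simp: fun_eq_iff)
  have w0: "AE q in lborel \<Otimes>\<^sub>M (surface :: 'a measure). 0 \<le> ?w q"
    by (auto split: split_indicator)
  have mp: "?p \<in> measurable (density (lborel \<Otimes>\<^sub>M surface) (\<lambda>q. ennreal (?w q))) borel"
    by simp
  have "integrable (density (lborel \<Otimes>\<^sub>M surface) (\<lambda>q. ennreal (?w q))) (\<lambda>q. f (?p q))"
    using f unfolding lborel_eq_distr_polar[where 'a='a] w
    by (subst (asm) integrable_distr_eq[OF mp]) auto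
  then have int: "integrable (lborel \<Otimes>\<^sub>M surface) (\<lambda>q. ?w q *\<^sub>R f (?p q))"
    by (subst (asm) integrable_density[OF _ _ w0]) auto
  from P.integrable_fst'[OF this]
  show "integrable lborel (\<lambda>r. (indicator {0<..} r * r ^ (DIM('a) - 1)) *\<^sub>R (LINT \<omega>|surface. f (r *\<^sub>R \<omega>)))"
    by simp
  have "(LINT x|lborel. f x) = (LINT q|density (lborel \<Otimes>\<^sub>M surface) (\<lambda>q. ennreal (?w q)). f (?p q))"
    unfolding lborel_eq_distr_polar[where 'a='a] w by (rule integral_distr[OF mp]) auto
  also have "\<dots> = (LINT q|(lborel \<Otimes>\<^sub>M surface). ?w q *\<^sub>R f (?p q))"
    by (rule integral_density[OF _ _ w0]) auto
  also have "\<dots> = (LINT r|lborel. LINT \<omega>|surface. ?w (r, \<omega>) *\<^sub>R f (?p (r, \<omega>)))"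
    by (rule P.integral_fst'[OF int, symmetric])
  finally show "(LINT x|lborel. f x) = (LINT r|lborel. (indicator {0<..} r * r ^ (DIM('a) - 1)) *\<^sub>R (LINT \<omega>|surface. f (r *\<^sub>R \<omega>)))"
    by simp
qed

lemma integral_mult_pair:
  fixes f :: "'p \<Rightarrow> complex" and g :: "'q \<Rightarrow> complex"
  assumes "finite_measure M" "finite_measure N"
    and [measurable]: "f \<in> borel_measurable M" "g \<in> borel_measurable N"
    and f: "\<And>x. cmod (f x) \<le> A" and g: "\<And>x. cmod (g x) \<le> B"
  shows "(LINT x|M. f x) * (LINT y|N. g y) = (LINT q|(M \<Otimes>\<^sub>M N). f (fst q) * g (snd q))"
proof -
  interpret M: finite_measure M by fact
  interpret N: finite_measure N by fact
  interpret P: pair_sigma_finite M N ..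
  interpret PF: finite_measure "M \<Otimes>\<^sub>M N" by (rule finite_measure_pair_measure) fact+
  have "integrable (M \<Otimes>\<^sub>M N) (\<lambda>q. f (fst q) * g (snd q))"
  proof (rule PF.integrable_bounded)
    fix q
    show "norm (f (fst q) * g (snd q)) \<le> A * B"
      unfolding norm_mult by (intro mult_mono f g norm_ge_zero order_trans[OF norm_ge_zero f])
  qed measurable
  from P.integral_fst'[OF this] show ?thesis by simp
qed

lemma Fubini_integral_bounded:
  fixes f :: "'p \<Rightarrow> 'q \<Rightarrow> complex"
  assumes "finite_measure M" "finite_measure N"
    and [measurable]: "(\<lambda>(x, y). f x y) \<in> borel_measurable (M \<Otimes>\<^sub>M N)"
    and f: "\<And>x y. cmod (f x y) \<le> A"
  shows "(LINT y|N. LINT x|M. f x y) = (LINT x|M. LINT y|N. f x y)"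
proof -
  interpret M: finite_measure M by fact
  interpret N: finite_measure N by fact
  interpret P: pair_sigma_finite M N ..
  interpret PF: finite_measure "M \<Otimes>\<^sub>M N" by (rule finite_measure_pair_measure) fact+
  have "integrable (M \<Otimes>\<^sub>M N) (\<lambda>(x, y). f x y)"
    by (rule PF.integrable_bounded[of _ A]) (auto simp: f split: prod.split)
  then show ?thesis by (rule P.Fubini_integral)
qed

text \<open>
Let \<open>F r\<close> be the spherical integral on the left, and \<open>a(\<xi>) = e(x \<bullet> \<xi>) \<nu>\<^sup>^(\<xi>)\<close>, so that
\<open>F r = \<integral> a(r\<omega>) d\<sigma>(\<omega>)\<close>. Expanding only one factor of \<open>\<bar>F r\<bar>\<^sup>2\<close>, polar coordinates give the integral of
the Gaussian times \<open>a(\<xi>)\<close> times the conjugate of \<open>F \<bar>\<xi>\<bar>\<close> over the whole space. In the conjugate factor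
the transform of \<open>\<sigma>\<close> occurs at \<open>\<bar>\<xi>\<bar>(z - x)\<close>; being radial it may be taken at \<open>\<bar>z - x\<bar>\<xi>\<close> instead. All
phases are now linear in \<open>\<xi>\<close>, and the Gaussian integrates them to a positive kernel.
\<close>

lemma nn_integral_gaussian_spherical_square:
  fixes \<nu> :: "'a::euclidean_space measure" and x :: 'a
  assumes s [measurable_cong]: "sets \<nu> = sets borel" and fin: "finite_measure \<nu>" and R: "0 < (R::real)"
  shows "(\<integral>\<^sup>+r. ennreal (indicator {0<..} r * r ^ (DIM('a) - 1) * exp (- pi * r\<^sup>2 / R\<^sup>2) *
        (cmod (LINT \<omega>|surface. cis2pi (r * (x \<bullet> \<omega>)) * fourier \<nu> (r *\<^sub>R \<omega>)))\<^sup>2) \<partial>lborel) =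
    (\<integral>\<^sup>+y. \<integral>\<^sup>+z. \<integral>\<^sup>+\<omega>. ennreal (R ^ DIM('a) * exp (- pi * R\<^sup>2 * (norm (norm (z - x) *\<^sub>R \<omega> - (y - x)))\<^sup>2))
       \<partial>surface \<partial>\<nu> \<partial>\<nu>)"
proof -
  interpret \<nu>: finite_measure \<nu> by fact
  note [measurable] = borel_measurable_fourier[OF s fin]
  define F where "F r = (LINT \<omega>|surface. cis2pi (r * (x \<bullet> \<omega>)) * fourier \<nu> (r *\<^sub>R \<omega>))" for r
  define a where "a \<xi> = cis2pi (x \<bullet> \<xi>) * fourier \<nu> \<xi>" for \<xi>
  have [measurable]: "F \<in> borel_measurable borel" unfolding F_def by measurable
  have [measurable]: "a \<in> borel_measurable borel" unfolding a_def by measurable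
  have a: "a \<xi> = (LINT y|\<nu>. cis2pi (- ((y - x) \<bullet> \<xi>)))" for \<xi>
    unfolding a_def fourier_eq
    by (subst integral_mult_right_zero[symmetric]) (simp add: cis_mult inner_diff_left algebra_simps)
  have Fa: "F r = (LINT \<omega>|surface. a (r *\<^sub>R \<omega>))" for r
    by (simp add: F_def a_def)
  have cF: "cnj (F r) = (LINT z|\<nu>. LINT \<omega>|surface. cis2pi ((r *\<^sub>R (z - x)) \<bullet> \<omega>))" for r
  proof -
    have "F r = (LINT z|\<nu>. LINT \<omega>|surface. cis2pi (- ((z - x) \<bullet> (r *\<^sub>R \<omega>))))"
      unfolding Fa a by (rule Fubini_integral_bounded[where A=1]) (use fin finite_measure_surface in auto)
    then have "cnj (F r) = (LINT z|\<nu>. LINT \<omega>|surface. cnj (cis2pi (- ((z - x) \<bullet> (r *\<^sub>R \<omega>)))))"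
      by (subst Bochner_Integration.integral_cnj, subst Bochner_Integration.integral_cnj) simp
    then show ?thesis by (simp add: cis_cnj)
  qed
  define P where "P = \<nu> \<Otimes>\<^sub>M (\<nu> \<Otimes>\<^sub>M (surface :: 'a measure))"
  have finP: "finite_measure P"
    unfolding P_def by (intro finite_measure_pair_measure fin finite_measure_surface)
  interpret P: finite_measure P by fact
  define u where "u = (\<lambda>(y, z, \<omega>). norm (z - x) *\<^sub>R \<omega> - (y - x))"
  have [measurable]: "u \<in> borel_measurable P" unfolding u_def P_def by measurable
  have aF: "a \<xi> * cnj (F (norm \<xi>)) = (LINT p|P. cis2pi (u p \<bullet> \<xi>))" for \<xi>
  proof -
    \<comment> \<open>This exchange of the two lengths is where rotation invariance enters.\<close>
    have "cnj (F (norm \<xi>)) = (LINT z|\<nu>. LINT \<omega>|surface. cis2pi ((norm (z - x) *\<^sub>R \<xi>) \<bullet> \<omega>))"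
      unfolding cF by (intro Bochner_Integration.integral_cong HOL.refl surface_exponential_radial) simp
    also have "\<dots> = (LINT q|(\<nu> \<Otimes>\<^sub>M surface). cis2pi ((norm (fst q - x) *\<^sub>R \<xi>) \<bullet> snd q))"
    proof -
      interpret P: pair_sigma_finite \<nu> "surface :: 'a measure" ..
      interpret PF: finite_measure "\<nu> \<Otimes>\<^sub>M (surface :: 'a measure)" by (rule finite_measure_pair_measure) (fact | rule finite_measure_surface)+
      have "integrable (\<nu> \<Otimes>\<^sub>M surface) (\<lambda>q. cis2pi ((norm (fst q - x) *\<^sub>R \<xi>) \<bullet> snd q))"
        by (rule PF.integrable_bounded[of _ 1]) auto
      from P.integral_fst'[OF this] show ?thesis by simp
    qed
    finally have "a \<xi> * cnj (F (norm \<xi>)) =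
      (LINT p|P. cis2pi (- ((fst p - x) \<bullet> \<xi>)) * cis2pi ((norm (fst (snd p) - x) *\<^sub>R \<xi>) \<bullet> snd (snd p)))"
      unfolding a P_def
      by (simp only:) (rule integral_mult_pair[where A=1 and B=1],
        use fin finite_measure_surface finite_measure_pair_measure[OF finite_measure_surface fin] in auto)
    also have "\<dots> = (LINT p|P. cis2pi (u p \<bullet> \<xi>))"
      by (intro Bochner_Integration.integral_cong)
        (auto simp: u_def cis_mult inner_diff_left inner_commute algebra_simps)
    finally show ?thesis .
  qed
  define \<Phi> where "\<Phi> \<xi> = of_real (exp (- pi * (norm \<xi>)\<^sup>2 / R\<^sup>2)) * (a \<xi> * cnj (F (norm \<xi>)))" for \<xi>
  have int\<Phi>: "integrable lborel \<Phi>"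
  proof (rule Bochner_Integration.integrable_bound)
    show "integrable lborel (\<lambda>\<xi>::'a. exp (- pi * (norm \<xi>)\<^sup>2 / R\<^sup>2) * measure P (space P))"
      by (intro integrable_mult_left integrable_gaussian R)
    show "\<Phi> \<in> borel_measurable lborel" unfolding \<Phi>_def by measurable
    have "cmod (a \<xi> * cnj (F (norm \<xi>))) \<le> measure P (space P)" for \<xi>
    proof -
      have "cmod (LINT p|P. cis2pi (u p \<bullet> \<xi>)) \<le> (LINT p|P. cmod (cis2pi (u p \<bullet> \<xi>)))"
        by (rule integral_norm_bound)
      then show ?thesis unfolding aF by simp
    qed
    then show "AE \<xi> in lborel. norm (\<Phi> \<xi>) \<le> norm (exp (- pi * (norm \<xi>)\<^sup>2 / R\<^sup>2) * measure P (space P))"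
      unfolding \<Phi>_def by (intro AE_I2) (simp add: norm_mult)
  qed
  let ?h = "\<lambda>r. indicator {0<..} r * r ^ (DIM('a) - 1) * exp (- pi * r\<^sup>2 / R\<^sup>2) * (cmod (F r))\<^sup>2"
  have h: "(indicator {0<..} r * r ^ (DIM('a) - 1)) *\<^sub>R (LINT \<omega>|surface. \<Phi> (r *\<^sub>R \<omega>)) = of_real (?h r)" for r
  proof (cases "0 < r")
    case True
    have "(LINT \<omega>|surface. \<Phi> (r *\<^sub>R \<omega>)) = (LINT \<omega>|surface. of_real (exp (- pi * r\<^sup>2 / R\<^sup>2)) * cnj (F r) * a (r *\<^sub>R \<omega>))"
    proof (rule Bochner_Integration.integral_cong_AE)
      show "AE \<omega> in surface. \<Phi> (r *\<^sub>R \<omega>) = of_real (exp (- pi * r\<^sup>2 / R\<^sup>2)) * cnj (F r) * a (r *\<^sub>R \<omega>)"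
        using AE_surface_norm by eventually_elim (use True in \<open>simp add: \<Phi>_def mult_ac\<close>)
    qed (auto simp: \<Phi>_def)
    also have "\<dots> = of_real (exp (- pi * r\<^sup>2 / R\<^sup>2)) * cnj (F r) * F r"
      by (simp add: Fa)
    also have "\<dots> = of_real (exp (- pi * r\<^sup>2 / R\<^sup>2) * (cmod (F r))\<^sup>2)"
      unfolding of_real_mult complex_norm_square by (simp add: mult_ac)
    finally show ?thesis using True by (simp add: scaleR_conv_of_real mult.assoc)
  qed simp
  have inth: "integrable lborel ?h"
    using integrable_polar[OF int\<Phi>] unfolding h complex_of_real_integrable_eq .
  have "complex_of_real (LINT r|lborel. ?h r) = (LINT \<xi>|lborel. \<Phi> \<xi>)"
    unfolding integral_polar[OF int\<Phi>] h by (rule integral_complex_of_real[symmetric])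
  also have "\<dots> = of_real (LINT p|P. R ^ DIM('a) * exp (- pi * R\<^sup>2 * (norm (u p))\<^sup>2))"
    unfolding \<Phi>_def aF by (rule gaussian_average[OF finP _ R]) measurable
  finally have eq: "(LINT r|lborel. ?h r) = (LINT p|P. R ^ DIM('a) * exp (- pi * R\<^sup>2 * (norm (u p))\<^sup>2))"
    by (simp only: of_real_eq_iff)
  have "(\<integral>\<^sup>+r. ennreal (?h r) \<partial>lborel) = ennreal (LINT r|lborel. ?h r)"
    by (rule nn_integral_eq_integral[OF inth]) (auto split: split_indicator)
  also have "\<dots> = (\<integral>\<^sup>+p. ennreal (R ^ DIM('a) * exp (- pi * R\<^sup>2 * (norm (u p))\<^sup>2)) \<partial>P)"
    unfolding eq
  proof (rule nn_integral_eq_integral[symmetric])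
    show "integrable P (\<lambda>p. R ^ DIM('a) * exp (- pi * R\<^sup>2 * (norm (u p))\<^sup>2))"
      using R by (intro P.integrable_bounded[of _ "R ^ DIM('a)"]) (auto simp: mult_le_cancel_left2 abs_mult)
  qed (use R in auto)
  also have "\<dots> = (\<integral>\<^sup>+y. \<integral>\<^sup>+q. ennreal (R ^ DIM('a) * exp (- pi * R\<^sup>2 * (norm (u (y, q)))\<^sup>2)) \<partial>(\<nu> \<Otimes>\<^sub>M surface) \<partial>\<nu>)"
  proof -
    interpret PF: finite_measure "\<nu> \<Otimes>\<^sub>M (surface :: 'a measure)" by (rule finite_measure_pair_measure) (fact | rule finite_measure_surface)+
    have [measurable]: "u \<in> borel_measurable (\<nu> \<Otimes>\<^sub>M (\<nu> \<Otimes>\<^sub>M (surface :: 'a measure)))" unfolding u_def by measurable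
    show ?thesis unfolding P_def by (rule PF.nn_integral_fst[symmetric]) measurable
  qed
  also have "\<dots> = (\<integral>\<^sup>+y. \<integral>\<^sup>+z. \<integral>\<^sup>+\<omega>. ennreal (R ^ DIM('a) * exp (- pi * R\<^sup>2 * (norm (u (y, z, \<omega>)))\<^sup>2)) \<partial>surface \<partial>\<nu> \<partial>\<nu>)"
  proof (rule nn_integral_cong)
    fix y :: 'a
    have [measurable]: "(\<lambda>q. u (y, q)) \<in> borel_measurable (\<nu> \<Otimes>\<^sub>M (surface :: 'a measure))"
      unfolding u_def split_beta fst_conv snd_conv by measurable
    show "(\<integral>\<^sup>+q. ennreal (R ^ DIM('a) * exp (- pi * R\<^sup>2 * (norm (u (y, q)))\<^sup>2)) \<partial>(\<nu> \<Otimes>\<^sub>M surface)) =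
      (\<integral>\<^sup>+z. \<integral>\<^sup>+\<omega>. ennreal (R ^ DIM('a) * exp (- pi * R\<^sup>2 * (norm (u (y, z, \<omega>)))\<^sup>2)) \<partial>surface \<partial>\<nu>)"
      by (rule surface.nn_integral_fst[symmetric]) measurable
  qed
  finally show ?thesis by (simp add: F_def u_def)
qed

section \<open>Caps and a lower bound for the averaged Gaussian\<close>

text \<open>
Compare with the volume of the ball of radius \<open>\<delta> / 2\<close> around \<open>e\<close>. In polar coordinates it lives on radii
within \<open>\<delta> / 2\<close> of \<open>1\<close>, and the direction of each of its points is within \<open>\<delta>\<close> of \<open>e\<close>; so its volume,
of order \<open>\<delta>\<^sup>n\<close>, is at most of order \<open>\<delta>\<close> times the measure of the cap.
\<close>

lemma emeasure_surface_cap_ge: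
  fixes e :: "'a::euclidean_space"
  assumes e: "norm e = 1" and \<delta>: "0 < \<delta>" "\<delta> \<le> 1"
  shows "ennreal (unit_ball_vol (real DIM('a)) / 4 ^ DIM('a) * \<delta> ^ (DIM('a) - 1)) \<le> emeasure surface (cball e \<delta>)"
proof -
  define n where "n = DIM('a)"
  let ?I = "\<lambda>r. \<integral>\<^sup>+\<omega>. indicator (cball e (\<delta> / 2)) (r *\<^sub>R \<omega>) \<partial>surface"
  have n: "0 < n" by (simp add: n_def)
  define m where "m = measure surface (cball e \<delta>)"
  have em: "emeasure surface (cball e \<delta>) = ennreal m"
    unfolding m_def by (rule surface.emeasure_eq_measure)
  have "ennreal (unit_ball_vol (real n) * (\<delta> / 2) ^ n) = (\<integral>\<^sup>+x. indicator (cball e (\<delta> / 2)) x \<partial>lborel)"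
    using \<delta> by (simp add: emeasure_cball n_def)
  also have "\<dots> = (\<integral>\<^sup>+r. indicator {0<..} r * ennreal (r ^ (n - 1)) * (?I r) \<partial>lborel)"
    unfolding n_def by (rule nn_integral_polar) measurable
  also have "\<dots> \<le> (\<integral>\<^sup>+r. ennreal (2 ^ (n - 1) * m) * indicator {1 - \<delta> / 2..1 + \<delta> / 2} r \<partial>lborel)"
  proof (rule nn_integral_mono)
    fix r :: real
    show "indicator {0<..} r * ennreal (r ^ (n - 1)) * (?I r)
      \<le> ennreal (2 ^ (n - 1) * m) * indicator {1 - \<delta> / 2..1 + \<delta> / 2} r"
    proof (cases "0 < r")
      case True
      have norms: "r \<in> {1 - \<delta> / 2..1 + \<delta> / 2}" "norm (\<omega> - e) \<le> \<delta>"
        if "norm \<omega> = 1" "r *\<^sub>R \<omega> \<in> cball e (\<delta> / 2)" for \<omega>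
      proof -
        have d: "norm (r *\<^sub>R \<omega> - e) \<le> \<delta> / 2"
          using that(2) by (simp add: dist_norm norm_minus_commute)
        have "\<bar>r - 1\<bar> \<le> norm (r *\<^sub>R \<omega> - e)"
          using norm_triangle_ineq3[of "r *\<^sub>R \<omega>" e] that(1) e True by simp
        with d have r1: "\<bar>r - 1\<bar> \<le> \<delta> / 2" by simp
        then show "r \<in> {1 - \<delta> / 2..1 + \<delta> / 2}" by (auto simp: abs_if split: if_splits)
        have "norm (\<omega> - e) \<le> norm ((1 - r) *\<^sub>R \<omega>) + norm (r *\<^sub>R \<omega> - e)"
          using norm_triangle_ineq[of "(1 - r) *\<^sub>R \<omega>" "r *\<^sub>R \<omega> - e"] by (simp add: algebra_simps)
        also have "\<dots> \<le> \<delta> / 2 + \<delta> / 2"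
          using d r1 that(1) by (intro add_mono) (auto simp: abs_minus_commute)
        finally show "norm (\<omega> - e) \<le> \<delta>" by simp
      qed
      show ?thesis
      proof (cases "r \<in> {1 - \<delta> / 2..1 + \<delta> / 2}")
        case r: True
        have "(?I r) \<le> (\<integral>\<^sup>+\<omega>. indicator (cball e \<delta>) \<omega> \<partial>surface)"
        proof (rule nn_integral_mono_AE)
          show "AE \<omega> in surface. indicator (cball e (\<delta> / 2)) (r *\<^sub>R \<omega>) \<le> (indicator (cball e \<delta>) \<omega> :: ennreal)"
            using AE_surface_norm
            by eventually_elim (use norms(2) in \<open>auto simp: dist_norm norm_minus_commute split: split_indicator\<close>)
        qed
        also have "\<dots> = ennreal m" by (simp add: em)
        finally have 1: "(?I r) \<le> ennreal m" .
        have 2: "ennreal (r ^ (n - 1)) \<le> ennreal (2 ^ (n - 1))"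
          using r \<delta> True by (intro ennreal_leI power_mono) auto
        show ?thesis
          using mult_mono[OF 2 1] True r by (simp add: ennreal_mult m_def)
      next
        case r: False
        have "(?I r) = (\<integral>\<^sup>+\<omega>. 0 \<partial>(surface :: 'a measure))"
        proof (rule nn_integral_cong_AE)
          show "AE \<omega> in surface. indicator (cball e (\<delta> / 2)) (r *\<^sub>R \<omega>) = (0 :: ennreal)"
            using AE_surface_norm by eventually_elim (use norms(1) r in \<open>auto split: split_indicator\<close>)
        qed
        then show ?thesis by simp
      qed
    qed simp
  qed
  also have "\<dots> = ennreal (2 ^ (n - 1) * m) * ennreal \<delta>"
    using \<delta> by (simp add: nn_integral_cmult)
  also have "\<dots> = ennreal (2 ^ (n - 1) * m * \<delta>)"
    using \<delta> by (simp add: ennreal_mult m_def)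
  finally have "unit_ball_vol (real n) * (\<delta> / 2) ^ n \<le> 2 ^ (n - 1) * m * \<delta>"
    using \<delta> by (subst (asm) ennreal_le_iff) (auto simp: m_def)
  then have "unit_ball_vol (real n) / 4 ^ n * \<delta> ^ (n - 1) \<le> m"
  proof -
    obtain k where k: "n = Suc k" using n by (cases n) auto
    assume "unit_ball_vol (real n) * (\<delta> / 2) ^ n \<le> 2 ^ (n - 1) * m * \<delta>"
    then have "(unit_ball_vol (real n) * \<delta> ^ k) * \<delta> \<le> (2 ^ k * 2 ^ Suc k * m) * \<delta>"
      by (simp add: k power_divide field_simps)
    then have "unit_ball_vol (real n) * \<delta> ^ k \<le> 2 ^ k * 2 ^ Suc k * m"
      using \<delta>(1) by (rule mult_right_le_imp_le)
    also have "\<dots> \<le> 4 ^ n * m"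
    proof (rule mult_right_mono)
      have "(2::real) ^ k * 2 ^ Suc k = 2 * 4 ^ k" by (simp add: power_mult_distrib[symmetric])
      then show "(2::real) ^ k * 2 ^ Suc k \<le> 4 ^ n" by (simp add: k)
    qed (simp add: m_def)
    finally show ?thesis by (simp add: k field_simps)
  qed
  then show ?thesis unfolding em n_def by (rule ennreal_leI)
qed

text \<open>
For \<open>\<omega>\<close> within \<open>\<delta> = 2 / (R b)\<close> of the direction of \<open>u\<close>, the point \<open>b\<omega>\<close> is within \<open>4 / R\<close> of \<open>u\<close>, where the
exponential is at least \<open>exp (-16\<pi>)\<close>. The cap has measure of order \<open>(R b)\<^sup>-\<^sup>(\<^sup>n\<^sup>-\<^sup>1\<^sup>)\<close>, which leaves
\<open>R b\<^sup>-\<^sup>(\<^sup>n\<^sup>-\<^sup>1\<^sup>)\<close>; and \<open>\<bar>u\<bar>\<close> and \<open>b\<close> are comparable.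
\<close>

lemma spherical_gaussian_ge:
  fixes u :: "'a::euclidean_space"
  assumes R: "0 < R" and ab: "\<bar>norm u - b\<bar> \<le> 2 / R" and b: "4 / R \<le> b"
  defines "s \<equiv> (real DIM('a) - 1) / 2"
  defines "c \<equiv> exp (- 16 * pi) * (unit_ball_vol (real DIM('a)) / 4 ^ DIM('a)) * 2 ^ (DIM('a) - 1) / 2 powr s"
  shows "ennreal (c * R * (norm u powr - s * b powr - s)) \<le>
    (\<integral>\<^sup>+\<omega>. ennreal (R ^ DIM('a) * exp (- pi * R\<^sup>2 * (norm (b *\<^sub>R \<omega> - u))\<^sup>2)) \<partial>surface)"
proof -
  define n where "n = DIM('a)"
  have n: "0 < n" by (simp add: n_def)
  have R': "0 < 4 / R" using R by simp
  have b0: "0 < b" using b R' by linarith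
  have s0: "0 \<le> s" using DIM_positive[where 'a='a] unfolding s_def by (simp add: Suc_le_eq)
  have "4 / R = 2 * (2 / R)" by simp
  then have "2 * (2 / R) \<le> b" using b by simp
  then have a0: "b / 2 \<le> norm u" using ab unfolding abs_le_iff by linarith
  then have u0: "0 < norm u" using b0 by linarith
  define e where "e = u /\<^sub>R norm u"
  have e: "norm e = 1" using u0 by (simp add: e_def)
  define \<delta> where "\<delta> = 2 / (R * b)"
  have \<delta>: "0 < \<delta>" "\<delta> \<le> 1" using R b0 b by (auto simp: \<delta>_def field_simps)
  define k where "k = unit_ball_vol (real n) / 4 ^ n"
  have k0: "0 < k" by (simp add: k_def)
  have "ennreal (R ^ n * exp (- 16 * pi) * (k * \<delta> ^ (n - 1))) = ennreal (R ^ n * exp (- 16 * pi)) * ennreal (k * \<delta> ^ (n - 1))"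
    using R k0 \<delta> by (intro ennreal_mult) auto
  also have "\<dots> \<le> ennreal (R ^ n * exp (- 16 * pi)) * emeasure surface (cball e \<delta>)"
    using emeasure_surface_cap_ge[OF e \<delta>] unfolding n_def[symmetric] k_def[symmetric] by (rule mult_left_mono) simp
  also have "\<dots> = (\<integral>\<^sup>+\<omega>. ennreal (R ^ n * exp (- 16 * pi)) * indicator (cball e \<delta>) \<omega> \<partial>surface)"
    by (simp add: nn_integral_cmult)
  also have "\<dots> \<le> (\<integral>\<^sup>+\<omega>. ennreal (R ^ n * exp (- pi * R\<^sup>2 * (norm (b *\<^sub>R \<omega> - u))\<^sup>2)) \<partial>surface)"
  proof (rule nn_integral_mono)
    fix \<omega> :: 'a
    show "ennreal (R ^ n * exp (- 16 * pi)) * indicator (cball e \<delta>) \<omega> \<le> ennreal (R ^ n * exp (- pi * R\<^sup>2 * (norm (b *\<^sub>R \<omega> - u))\<^sup>2))"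
    proof (cases "\<omega> \<in> cball e \<delta>")
      case True
      have "norm (b *\<^sub>R \<omega> - u) \<le> norm (b *\<^sub>R (\<omega> - e)) + norm (b *\<^sub>R e - u)"
        using norm_triangle_ineq[of "b *\<^sub>R (\<omega> - e)" "b *\<^sub>R e - u"] by (simp add: algebra_simps)
      also have "norm (b *\<^sub>R (\<omega> - e)) \<le> b * \<delta>"
        using True b0 by (simp add: dist_norm norm_minus_commute)
      also have "b * \<delta> = 2 / R" using b0 R by (simp add: \<delta>_def)
      also have "b *\<^sub>R e - u = (b - norm u) *\<^sub>R e"
        using u0 by (simp add: e_def algebra_simps)
      also have "norm ((b - norm u) *\<^sub>R e) \<le> 2 / R" using ab e by (simp add: abs_minus_commute)
      finally have "norm (b *\<^sub>R \<omega> - u) \<le> 4 / R" by simp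
      then have "(norm (b *\<^sub>R \<omega> - u))\<^sup>2 \<le> (4 / R)\<^sup>2" by (intro power_mono) auto
      then have "R\<^sup>2 * (norm (b *\<^sub>R \<omega> - u))\<^sup>2 \<le> R\<^sup>2 * (4 / R)\<^sup>2" by (intro mult_left_mono) auto
      also have "\<dots> = 16" using R by (simp add: power_divide)
      finally have "R\<^sup>2 * (norm (b *\<^sub>R \<omega> - u))\<^sup>2 \<le> 16" .
      then have "pi * (R\<^sup>2 * (norm (b *\<^sub>R \<omega> - u))\<^sup>2) \<le> pi * 16" by (intro mult_left_mono) auto
      then have "- 16 * pi \<le> - pi * R\<^sup>2 * (norm (b *\<^sub>R \<omega> - u))\<^sup>2" by (simp add: mult.assoc)
      then have "R ^ n * exp (- 16 * pi) \<le> R ^ n * exp (- pi * R\<^sup>2 * (norm (b *\<^sub>R \<omega> - u))\<^sup>2)"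
        using R by (intro mult_left_mono) auto
      then show ?thesis using True by (simp add: ennreal_leI)
    qed simp
  qed
  finally have 1: "ennreal (R ^ n * exp (- 16 * pi) * (k * \<delta> ^ (n - 1))) \<le>
    (\<integral>\<^sup>+\<omega>. ennreal (R ^ n * exp (- pi * R\<^sup>2 * (norm (b *\<^sub>R \<omega> - u))\<^sup>2)) \<partial>surface)" .
  have "c * R * (norm u powr - s * b powr - s) \<le> c * R * ((2 powr s * b powr - s) * b powr - s)"
  proof (intro mult_left_mono mult_right_mono)
    have "norm u powr - s \<le> (b / 2) powr - s"
      using a0 b0 s0 by (intro powr_mono2') auto
    also have "\<dots> = 2 powr s * b powr - s"
      using b0 by (simp add: powr_divide powr_minus_divide)
    finally show "norm u powr - s \<le> 2 powr s * b powr - s" .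
  qed (use R in \<open>auto simp: c_def\<close>)
  also have "(2 powr s * b powr - s) * b powr - s = 2 powr s * (1 / b ^ (n - 1))"
  proof -
    have "- s + - s = - real (n - 1)" using n by (simp add: s_def n_def of_nat_diff)
    then have "b powr - s * b powr - s = b powr - real (n - 1)"
      by (simp only: powr_add[symmetric])
    also have "\<dots> = 1 / b ^ (n - 1)" using b0 by (simp add: powr_minus_divide powr_realpow)
    finally show ?thesis by (simp add: mult.assoc)
  qed
  also have "c * R * (2 powr s * (1 / b ^ (n - 1))) = R ^ n * exp (- 16 * pi) * (k * \<delta> ^ (n - 1))"
  proof -
    have "R ^ n = R * R ^ (n - 1)" using n by (cases n) auto
    then show ?thesis
      using R b0 unfolding c_def n_def[symmetric] k_def[symmetric] \<delta>_def
      by (simp add: power_divide power_mult_distrib)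
  qed
  finally have "ennreal (c * R * (norm u powr - s * b powr - s)) \<le> ennreal (R ^ n * exp (- 16 * pi) * (k * \<delta> ^ (n - 1)))"
    by (rule ennreal_leI)
  from order_trans[OF this 1] show ?thesis unfolding n_def .
qed

section \<open>Gaussian averages of the Fourier transform and energies\<close>

lemma nn_integral_gaussian_fourier:
  fixes M :: "'a::euclidean_space measure"
  assumes s [measurable_cong]: "sets M = sets borel" and fin: "finite_measure M" and R: "0 < (R::real)"
  shows "(\<integral>\<^sup>+\<xi>. ennreal (exp (- pi * (norm \<xi>)\<^sup>2 / R\<^sup>2) * (cmod (fourier M \<xi>))\<^sup>2) \<partial>lborel) =
    (\<integral>\<^sup>+y. \<integral>\<^sup>+x. ennreal (R ^ DIM('a) * exp (- pi * R\<^sup>2 * (dist x y)\<^sup>2)) \<partial>M \<partial>M)"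
proof -
  interpret M: finite_measure M by fact
  note [measurable] = borel_measurable_fourier[OF s fin]
  define P where "P = M \<Otimes>\<^sub>M M"
  have finP: "finite_measure P" unfolding P_def by (intro finite_measure_pair_measure fin)
  interpret P: finite_measure P by fact
  define u :: "'a \<times> 'a \<Rightarrow> 'a" where "u p = fst p - snd p" for p
  have [measurable]: "u \<in> borel_measurable P" unfolding u_def P_def by measurable
  have sq: "complex_of_real ((cmod (fourier M \<xi>))\<^sup>2) = (LINT p|P. cis2pi (u p \<bullet> \<xi>))" for \<xi>
  proof -
    have "cnj (fourier M \<xi>) = (LINT x|M. cis2pi (x \<bullet> \<xi>))"
      unfolding fourier_eq by (subst Bochner_Integration.integral_cnj[symmetric]) (simp add: cis_cnj)
    then have "complex_of_real ((cmod (fourier M \<xi>))\<^sup>2) = (LINT x|M. cis2pi (x \<bullet> \<xi>)) * (LINT x|M. cis2pi (- (x \<bullet> \<xi>)))"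
      unfolding complex_norm_square by (simp add: fourier_eq mult.commute)
    also have "\<dots> = (LINT p|P. cis2pi (fst p \<bullet> \<xi>) * cis2pi (- (snd p \<bullet> \<xi>)))"
      unfolding P_def by (rule integral_mult_pair[where A=1 and B=1]) (use fin in auto)
    also have "\<dots> = (LINT p|P. cis2pi (u p \<bullet> \<xi>))"
      by (simp add: u_def cis_mult inner_diff_left algebra_simps)
    finally show ?thesis .
  qed
  have int: "integrable lborel (\<lambda>\<xi>. exp (- pi * (norm \<xi>)\<^sup>2 / R\<^sup>2) * (cmod (fourier M \<xi>))\<^sup>2)"
  proof (rule Bochner_Integration.integrable_bound)
    show "integrable lborel (\<lambda>\<xi>::'a. exp (- pi * (norm \<xi>)\<^sup>2 / R\<^sup>2) * (measure M (space M))\<^sup>2)"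
      by (intro integrable_mult_left integrable_gaussian R)
    show "AE \<xi> in lborel. norm (exp (- pi * (norm \<xi>)\<^sup>2 / R\<^sup>2) * (cmod (fourier M \<xi>))\<^sup>2) \<le> norm (exp (- pi * (norm \<xi>)\<^sup>2 / R\<^sup>2) * (measure M (space M))\<^sup>2)"
      by (auto intro!: power_mono cmod_fourier_le fin)
  qed measurable
  have "complex_of_real (LINT \<xi>|lborel. exp (- pi * (norm \<xi>)\<^sup>2 / R\<^sup>2) * (cmod (fourier M \<xi>))\<^sup>2) =
    (LINT \<xi>|lborel. of_real (exp (- pi * (norm \<xi>)\<^sup>2 / R\<^sup>2)) * (LINT p|P. cis2pi (u p \<bullet> \<xi>)))"
    unfolding sq[symmetric] of_real_mult[symmetric] by (rule integral_complex_of_real[symmetric])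
  also have "\<dots> = of_real (LINT p|P. R ^ DIM('a) * exp (- pi * R\<^sup>2 * (norm (u p))\<^sup>2))"
    by (rule gaussian_average[OF finP _ R]) measurable
  finally have eq: "(LINT \<xi>|lborel. exp (- pi * (norm \<xi>)\<^sup>2 / R\<^sup>2) * (cmod (fourier M \<xi>))\<^sup>2) =
      (LINT p|P. R ^ DIM('a) * exp (- pi * R\<^sup>2 * (norm (u p))\<^sup>2))"
    by (simp only: of_real_eq_iff)
  have "(\<integral>\<^sup>+\<xi>. ennreal (exp (- pi * (norm \<xi>)\<^sup>2 / R\<^sup>2) * (cmod (fourier M \<xi>))\<^sup>2) \<partial>lborel) =
    (\<integral>\<^sup>+p. ennreal (R ^ DIM('a) * exp (- pi * R\<^sup>2 * (norm (u p))\<^sup>2)) \<partial>P)"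
  proof (subst nn_integral_eq_integral[OF int], simp, unfold eq, rule nn_integral_eq_integral[symmetric])
    show "integrable P (\<lambda>p. R ^ DIM('a) * exp (- pi * R\<^sup>2 * (norm (u p))\<^sup>2))"
      using R by (intro P.integrable_bounded[of _ "R ^ DIM('a)"]) (auto simp: mult_le_cancel_left2 abs_mult)
  qed (use R in auto)
  also have "\<dots> = (\<integral>\<^sup>+y. \<integral>\<^sup>+x. ennreal (R ^ DIM('a) * exp (- pi * R\<^sup>2 * (norm (u (x, y)))\<^sup>2)) \<partial>M \<partial>M)"
  proof -
    interpret PP: pair_sigma_finite M M ..
    have [measurable]: "u \<in> borel_measurable (M \<Otimes>\<^sub>M M)" unfolding u_def by measurable
    show ?thesis unfolding P_def by (rule PP.nn_integral_snd[symmetric]) measurable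
  qed
  finally show ?thesis by (simp add: u_def dist_norm)
qed

lemma power_div_fact_le_exp:
  fixes y :: real
  assumes "0 \<le> y"
  shows "y ^ n / fact n \<le> exp y"
proof -
  have "(\<Sum>k\<in>{n}. inverse (fact k) * y ^ k) \<le> (\<Sum>k. inverse (fact k) * y ^ k)"
    by (intro sum_le_suminf summable_exp) (use assms in auto)
  then show ?thesis by (simp add: exp_def scaleR_conv_of_real field_simps)
qed

text \<open>
In terms of \<open>s = R d\<close> the claim is that \<open>s\<^sup>\<gamma> exp (-\<pi> s\<^sup>2)\<close> is bounded uniformly in \<open>\<gamma> \<le> n\<close>; for
\<open>s \<ge> 1\<close> one has \<open>s\<^sup>\<gamma> \<le> (s\<^sup>2)\<^sup>n \<le> n! exp (s\<^sup>2)\<close>.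
\<close>

lemma gaussian_le_riesz_kernel:
  assumes \<gamma>: "0 \<le> \<gamma>" "\<gamma> \<le> real n" and R: "0 < R" and d: "0 \<le> d"
  shows "ennreal (exp (- pi * R\<^sup>2 * d\<^sup>2)) \<le> ennreal (fact n * R powr - \<gamma>) * riesz_kernel \<gamma> d"
proof (cases "d = 0")
  case True
  show ?thesis
  proof (cases "\<gamma> = 0")
    case True
    with \<open>d = 0\<close> R show ?thesis by (simp add: riesz_kernel_def)
  next
    case False
    with \<open>d = 0\<close> R \<gamma> show ?thesis by (simp add: riesz_kernel_zero ennreal_mult_top)
  qed
next
  case False
  then have d: "0 < d" using d by simp
  define s where "s = R * d"
  have s: "0 < s" using R d by (simp add: s_def)
  have "exp (- pi * s\<^sup>2) * s powr \<gamma> \<le> fact n"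
  proof (cases "s \<le> 1")
    case True
    have "exp (- pi * s\<^sup>2) \<le> 1" by simp
    moreover have "s powr \<gamma> \<le> 1" using True s \<gamma> by (simp add: powr_le1)
    ultimately have "exp (- pi * s\<^sup>2) * s powr \<gamma> \<le> 1 * 1" by (intro mult_mono) auto
    also have "1 * 1 \<le> (fact n :: real)" by simp
    finally show ?thesis .
  next
    case False
    then have s1: "1 \<le> s" by simp
    have "s powr \<gamma> \<le> s powr (2 * real n)" using \<gamma> s1 by (intro powr_mono) auto
    also have "\<dots> = s powr real (2 * n)" by simp
    also have "\<dots> = s ^ (2 * n)" using s by (rule powr_realpow)
    also have "\<dots> = (s\<^sup>2) ^ n" by (rule power_mult)
    also have "\<dots> \<le> fact n * exp (s\<^sup>2)"
    proof -
      have "(s\<^sup>2) ^ n / fact n \<le> exp (s\<^sup>2)" by (rule power_div_fact_le_exp) simp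
      then show ?thesis by (simp add: field_simps)
    qed
    finally have "exp (- pi * s\<^sup>2) * s powr \<gamma> \<le> exp (- pi * s\<^sup>2) * (fact n * exp (s\<^sup>2))"
      by (intro mult_left_mono) auto
    also have "\<dots> = fact n * (exp (- pi * s\<^sup>2) * exp (s\<^sup>2))" by (rule mult.left_commute)
    also have "\<dots> = fact n * exp (- pi * s\<^sup>2 + s\<^sup>2)" by (simp only: exp_add)
    also have "\<dots> \<le> fact n * 1"
    proof (intro mult_left_mono)
      have "1 * s\<^sup>2 \<le> pi * s\<^sup>2" using pi_gt3 by (intro mult_right_mono) auto
      then show "exp (- pi * s\<^sup>2 + s\<^sup>2) \<le> 1" by simp
    qed auto
    finally show ?thesis by simp
  qed
  then have "exp (- pi * s\<^sup>2) \<le> fact n * s powr - \<gamma>"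
    using s by (simp add: powr_minus field_simps)
  also have "s powr - \<gamma> = R powr - \<gamma> * d powr - \<gamma>" using R d by (simp add: s_def powr_mult)
  finally show ?thesis
    using d R by (simp add: riesz_kernel_pos ennreal_mult[symmetric] s_def power_mult_distrib mult_ac)
qed

lemma gaussian_fourier_le_energy:
  fixes M :: "'a::euclidean_space measure"
  assumes s [measurable_cong]: "sets M = sets borel" and fin: "finite_measure M" and R: "0 < (R::real)"
    and \<gamma>: "0 \<le> \<gamma>" "\<gamma> \<le> real DIM('a)"
  shows "(\<integral>\<^sup>+\<xi>. ennreal (exp (- pi * (norm \<xi>)\<^sup>2 / R\<^sup>2) * (cmod (fourier M \<xi>))\<^sup>2) \<partial>lborel)
    \<le> ennreal (fact DIM('a) * R powr (real DIM('a) - \<gamma>)) * energy \<gamma> M"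
proof -
  interpret M: finite_measure M by fact
  have "(\<integral>\<^sup>+\<xi>. ennreal (exp (- pi * (norm \<xi>)\<^sup>2 / R\<^sup>2) * (cmod (fourier M \<xi>))\<^sup>2) \<partial>lborel) =
    (\<integral>\<^sup>+y. \<integral>\<^sup>+x. ennreal (R ^ DIM('a) * exp (- pi * R\<^sup>2 * (dist x y)\<^sup>2)) \<partial>M \<partial>M)"
    by (rule nn_integral_gaussian_fourier[OF s fin R])
  also have "\<dots> \<le> (\<integral>\<^sup>+y. \<integral>\<^sup>+x. ennreal (fact DIM('a) * R powr (real DIM('a) - \<gamma>)) * riesz_kernel \<gamma> (dist x y) \<partial>M \<partial>M)"
  proof (intro nn_integral_mono)
    fix x y :: 'a
    have "ennreal (R ^ DIM('a) * exp (- pi * R\<^sup>2 * (dist x y)\<^sup>2)) = ennreal (R ^ DIM('a)) * ennreal (exp (- pi * R\<^sup>2 * (dist x y)\<^sup>2))"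
      using R by (intro ennreal_mult) auto
    also have "\<dots> \<le> ennreal (R ^ DIM('a)) * (ennreal (fact DIM('a) * R powr - \<gamma>) * riesz_kernel \<gamma> (dist x y))"
      by (intro mult_left_mono gaussian_le_riesz_kernel \<gamma> R) auto
    also have "\<dots> = ennreal (R ^ DIM('a) * (fact DIM('a) * R powr - \<gamma>)) * riesz_kernel \<gamma> (dist x y)"
      using R by (simp add: ennreal_mult mult.assoc)
    also have "R ^ DIM('a) * (fact DIM('a) * R powr - \<gamma>) = fact DIM('a) * R powr (real DIM('a) - \<gamma>)"
      using R by (simp add: powr_diff powr_minus_divide powr_realpow)
    finally show "ennreal (R ^ DIM('a) * exp (- pi * R\<^sup>2 * (dist x y)\<^sup>2)) \<le>
      ennreal (fact DIM('a) * R powr (real DIM('a) - \<gamma>)) * riesz_kernel \<gamma> (dist x y)" .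
  qed
  also have "\<dots> = ennreal (fact DIM('a) * R powr (real DIM('a) - \<gamma>)) * energy \<gamma> M"
    unfolding energy_def by (simp add: nn_integral_cmult)
  finally show ?thesis .
qed

text \<open>
The Gaussian average \<open>\<integral> exp (-\<pi> \<bar>\<xi>\<bar>\<^sup>2 / R\<^sup>2) \<bar>M\<^sup>^(\<xi>)\<bar>\<^sup>2 d\<xi>\<close> increases with \<open>R\<close>. In physical space its kernel
\<open>R\<^sup>n exp (-\<pi> R\<^sup>2 \<bar>x - y\<bar>\<^sup>2)\<close> is dominated by a multiple of \<open>\<bar>x - y\<bar>\<^sup>-\<^sup>n\<close> and tends to \<open>0\<close> off the diagonal, which is
a null set as the energy is finite. Hence the averages tend to \<open>0\<close>, so the one for \<open>R = 1\<close> vanishes; but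
its kernel is positive everywhere.
\<close>

lemma energy_dim_finite_imp_null:
  fixes M :: "'a::euclidean_space measure"
  assumes s [measurable_cong]: "sets M = sets borel" and fin: "finite_measure M"
    and E: "energy (real DIM('a)) M < \<infinity>"
  shows "emeasure M UNIV = 0"
proof -
  interpret M: finite_measure M by fact
  interpret PP: pair_sigma_finite M M ..
  let ?n = "DIM('a)"
  let ?g = "\<lambda>R p. ennreal (R ^ ?n * exp (- pi * R\<^sup>2 * (dist (fst p) (snd p))\<^sup>2)) :: ennreal"
  let ?w = "\<lambda>p. ennreal (fact ?n) * riesz_kernel (real ?n) (dist (fst p) (snd p))"
  have Enn: "(\<integral>\<^sup>+p. riesz_kernel (real ?n) (dist (fst p) (snd p)) \<partial>(M \<Otimes>\<^sub>M M)) = energy (real ?n) M"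
    unfolding energy_def by (subst PP.nn_integral_snd[symmetric]) auto
  have fing: "(\<integral>\<^sup>+\<xi>. ennreal (exp (- pi * (norm \<xi>)\<^sup>2 / R\<^sup>2) * (cmod (fourier M \<xi>))\<^sup>2) \<partial>lborel) = (\<integral>\<^sup>+p. ?g R p \<partial>(M \<Otimes>\<^sub>M M))"
    if "0 < R" for R
    unfolding nn_integral_gaussian_fourier[OF s fin that] by (subst PP.nn_integral_snd[symmetric]) auto
  have "(\<lambda>k. \<integral>\<^sup>+p. ?g (real (Suc k)) p \<partial>(M \<Otimes>\<^sub>M M)) \<longlonglongrightarrow> (\<integral>\<^sup>+p. 0 \<partial>(M \<Otimes>\<^sub>M M))"
  proof (rule nn_integral_dominated_convergence)
    show "(\<integral>\<^sup>+p. ?w p \<partial>(M \<Otimes>\<^sub>M M)) < \<infinity>"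
      using E by (simp add: nn_integral_cmult Enn ennreal_mult_less_top)
    show "AE p in M \<Otimes>\<^sub>M M. ?g (real (Suc k)) p \<le> ?w p" for k
    proof (intro AE_I2)
      fix p :: "'a \<times> 'a"
      define R where "R = real (Suc k)"
      have R: "0 < R" by (simp add: R_def)
      have "?g R p = ennreal (R ^ ?n) * ennreal (exp (- pi * R\<^sup>2 * (dist (fst p) (snd p))\<^sup>2))"
        using R by (intro ennreal_mult) auto
      also have "\<dots> \<le> ennreal (R ^ ?n) * (ennreal (fact ?n * R powr - real ?n) * riesz_kernel (real ?n) (dist (fst p) (snd p)))"
        by (intro mult_left_mono gaussian_le_riesz_kernel R) auto
      also have "\<dots> = ennreal (R ^ ?n * (fact ?n * R powr - real ?n)) * riesz_kernel (real ?n) (dist (fst p) (snd p))"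
        using R by (simp add: ennreal_mult mult.assoc)
      also have "R ^ ?n * (fact ?n * R powr - real ?n) = fact ?n"
        using R by (simp add: powr_minus_divide powr_realpow)
      finally show "?g (real (Suc k)) p \<le> ?w p" by (simp add: R_def)
    qed
    have "AE p in M \<Otimes>\<^sub>M M. riesz_kernel (real ?n) (dist (fst p) (snd p)) \<noteq> \<infinity>"
      by (rule nn_integral_PInf_AE) (use E Enn in auto)
    then show "AE p in M \<Otimes>\<^sub>M M. (\<lambda>k. ?g (real (Suc k)) p) \<longlonglongrightarrow> 0"
    proof eventually_elim
      fix p :: "'a \<times> 'a" assume "riesz_kernel (real ?n) (dist (fst p) (snd p)) \<noteq> \<infinity>"
      then have d: "0 < dist (fst p) (snd p)" by (auto simp: riesz_kernel_zero)
      define d where "d = dist (fst p) (snd p)"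
      have "((\<lambda>R. R ^ ?n * exp (- pi * R\<^sup>2 * d\<^sup>2)) \<longlongrightarrow> 0) at_top"
        using d unfolding d_def[symmetric] by real_asymp
      then have "(\<lambda>k. real (Suc k) ^ ?n * exp (- pi * (real (Suc k))\<^sup>2 * d\<^sup>2)) \<longlonglongrightarrow> 0"
        by (rule filterlim_compose) (rule filterlim_compose[OF filterlim_real_sequentially filterlim_Suc])
      then show "(\<lambda>k. ?g (real (Suc k)) p) \<longlonglongrightarrow> 0"
        using tendsto_ennrealI by (fastforce simp: d_def)
    qed
  qed auto
  then have lim: "(\<lambda>k. \<integral>\<^sup>+p. ?g (real (Suc k)) p \<partial>(M \<Otimes>\<^sub>M M)) \<longlonglongrightarrow> 0" by simp
  have "(\<integral>\<^sup>+p. ?g 1 p \<partial>(M \<Otimes>\<^sub>M M)) \<le> (\<integral>\<^sup>+p. ?g (real (Suc k)) p \<partial>(M \<Otimes>\<^sub>M M))" for k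
  proof -
    have "(\<integral>\<^sup>+\<xi>. ennreal (exp (- pi * (norm \<xi>)\<^sup>2 / 1\<^sup>2) * (cmod (fourier M \<xi>))\<^sup>2) \<partial>lborel)
      \<le> (\<integral>\<^sup>+\<xi>. ennreal (exp (- pi * (norm \<xi>)\<^sup>2 / (real (Suc k))\<^sup>2) * (cmod (fourier M \<xi>))\<^sup>2) \<partial>lborel)"
    proof (intro nn_integral_mono ennreal_leI mult_right_mono)
      fix \<xi> :: 'a
      have "1 \<le> (real (Suc k))\<^sup>2" by (rule one_le_power) simp
      then have "pi * (norm \<xi>)\<^sup>2 / (real (Suc k))\<^sup>2 \<le> pi * (norm \<xi>)\<^sup>2 / 1"
        by (intro divide_left_mono) auto
      then show "exp (- pi * (norm \<xi>)\<^sup>2 / 1\<^sup>2) \<le> exp (- pi * (norm \<xi>)\<^sup>2 / (real (Suc k))\<^sup>2)" by simp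
    qed auto
    then show ?thesis by (subst (asm) (1 2) fing) auto
  qed
  then have "(\<integral>\<^sup>+p. ?g 1 p \<partial>(M \<Otimes>\<^sub>M M)) \<le> 0"
    by (intro LIMSEQ_le_const[OF lim]) auto
  then have "AE p in M \<Otimes>\<^sub>M M. ?g 1 p = 0"
    by (subst (asm) le_zero_eq, subst (asm) nn_integral_0_iff_AE) auto
  then have "AE p in M \<Otimes>\<^sub>M M. False" by eventually_elim (simp add: ennreal_eq_0_iff not_le)
  then have "emeasure (M \<Otimes>\<^sub>M M) (space (M \<Otimes>\<^sub>M M)) = 0"
    by (simp add: AE_iff_null null_setsD1)
  moreover have "space M = UNIV" using sets_eq_imp_space_eq[OF s] by simp
  ultimately show ?thesis
    using M.emeasure_pair_measure_Times[of UNIV M UNIV] by (simp add: space_pair_measure)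
qed

section \<open>Mollification at the scale of the frequency\<close>

lemma suminf_geometric_ennreal:
  assumes "0 \<le> c" "0 \<le> q" "q < 1"
  shows "(\<Sum>k. ennreal (c * q ^ k)) = ennreal (c / (1 - q))"
proof (rule suminf_ennreal_eq)
  show "(\<lambda>k. c * q ^ k) sums (c / (1 - q))"
    using sums_mult[OF geometric_sums[of q], of c] assms by simp
qed (use assms in auto)

lemma unit_ball_measures_iff:
  fixes M :: "'a::euclidean_space measure"
  shows "M \<in> unit_ball_measures \<longleftrightarrow> sets M = sets borel \<and> finite_measure M \<and> (AE x in M. norm x \<le> 1)"
proof (cases "sets M = sets borel")
  case True
  have sp: "space M = UNIV" using sets_eq_imp_space_eq[OF True] by simp
  have eq: "{x \<in> space M. \<not> norm x \<le> 1} = - cball 0 (1::real)" by (auto simp: sp)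
  have "(AE x in M. norm x \<le> 1) \<longleftrightarrow> emeasure M (- cball 0 1) = 0"
    unfolding eq[symmetric] by (rule AE_iff_measurable[OF _ HOL.refl]) (simp add: eq True)
  then show ?thesis
    using measure_support_subset_closed_iff[OF True closed_cball[of 0 1]] by (simp add: unit_ball_measures_def True)
qed (simp add: unit_ball_measures_def)

lemma riesz_kernel_scale:
  assumes "0 \<le> s" "0 < c" "0 \<le> d"
  shows "riesz_kernel s (c * d) = ennreal (c powr - s) * riesz_kernel s d"
proof (cases "d = 0")
  case True
  then show ?thesis using assms by (cases "s = 0") (auto simp: riesz_kernel_zero riesz_kernel_def ennreal_mult_top)
next
  case False
  then show ?thesis using assms by (simp add: riesz_kernel_pos powr_mult ennreal_mult)
qed

text \<open>
The part of the unit ball where \<open>b + u\<close> is in the unit ball is handled by translation and dyadic shells,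
which is where \<open>\<alpha> < n\<close> makes the geometric series converge; on the rest the kernel is at most \<open>1\<close>.
\<close>

lemma nn_integral_riesz_kernel_ball:
  fixes b :: "'a::euclidean_space"
  assumes \<alpha>: "0 \<le> \<alpha>" "\<alpha> < real DIM('a)"
  defines "C \<equiv> unit_ball_vol (real DIM('a)) * 2 powr \<alpha> / (1 - 2 powr (\<alpha> - real DIM('a))) + unit_ball_vol (real DIM('a))"
  shows "(\<integral>\<^sup>+u. riesz_kernel \<alpha> (norm (b + u)) * indicator (cball 0 1) u \<partial>lborel) \<le> ennreal C"
proof -
  let ?V = "unit_ball_vol (real DIM('a))"
  define q where "q = (2::real) powr (\<alpha> - real DIM('a))"
  have q: "0 \<le> q" "q < 1" using \<alpha> by (auto simp: q_def powr_less_one)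
  have "(\<integral>\<^sup>+w. riesz_kernel \<alpha> (norm w) * indicator (cball 0 1) (w::'a) \<partial>lborel)
    \<le> (\<integral>\<^sup>+w. (\<Sum>k. ennreal ((1 / 2 ^ Suc k) powr - \<alpha>) * indicator (cball 0 (1 / 2 ^ k)) (w::'a)) \<partial>lborel)"
  proof (rule nn_integral_mono)
    fix w :: 'a
    show "riesz_kernel \<alpha> (norm w) * indicator (cball 0 1) w \<le> (\<Sum>k. ennreal ((1 / 2 ^ Suc k) powr - \<alpha>) * indicator (cball 0 (1 / 2 ^ k)) w)"
    proof (cases "norm w \<le> 1")
      case True
      have "indicator {..(1::real) / 2 ^ k} (norm w) = (indicator (cball 0 (1 / 2 ^ k)) w :: ennreal)" for k
        by (auto simp: indicator_def)
      with riesz_kernel_le_dyadic_sum[OF \<alpha>(1) norm_ge_zero True] True show ?thesis by simp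
    qed simp
  qed
  also have "\<dots> = (\<Sum>k. ennreal ((1 / 2 ^ Suc k) powr - \<alpha>) * emeasure lborel (cball (0::'a) (1 / 2 ^ k)))"
    by (subst nn_integral_suminf) (auto simp: nn_integral_cmult)
  also have "\<dots> = (\<Sum>k. ennreal (?V * 2 powr \<alpha> * q ^ k))"
  proof (rule suminf_cong)
    fix k :: nat
    have a: "(1 / 2 ^ Suc k) powr - \<alpha> = 2 powr \<alpha> * 2 powr (real k * \<alpha>)"
    proof -
      have "(1 / 2 ^ Suc k) powr - \<alpha> = (2 ^ Suc k) powr \<alpha>"
        by (simp add: powr_divide powr_minus_divide)
      also have "\<dots> = (2 powr real (Suc k)) powr \<alpha>" by (subst powr_realpow) auto
      also have "(2 powr real (Suc k)) powr \<alpha> = 2 powr \<alpha> * 2 powr (real k * \<alpha>)"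
        by (simp add: powr_powr powr_add[symmetric] algebra_simps)
      finally show ?thesis .
    qed
    have b: "((1::real) / 2 ^ k) ^ DIM('a) = 2 powr (- (real k * real DIM('a)))"
      by (simp add: powr_minus_divide powr_realpow[symmetric] powr_powr power_divide flip: power_mult)
    have c: "q ^ k = 2 powr (real k * \<alpha>) * 2 powr (- (real k * real DIM('a)))"
      unfolding q_def by (subst powr_realpow[symmetric]) (auto simp: powr_powr powr_add[symmetric] algebra_simps)
    show "ennreal ((1 / 2 ^ Suc k) powr - \<alpha>) * emeasure lborel (cball (0::'a) (1 / 2 ^ k)) = ennreal (?V * 2 powr \<alpha> * q ^ k)"
    proof -
      have "emeasure lborel (cball (0::'a) (1 / 2 ^ k)) = ennreal (?V * 2 powr (- (real k * real DIM('a))))"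
        by (subst emeasure_cball) (simp_all add: b[simplified])
      then show ?thesis
        unfolding a c by (simp add: ennreal_mult[symmetric] mult_ac)
    qed
  qed
  also have "\<dots> = ennreal (?V * 2 powr \<alpha> / (1 - q))"
    by (rule suminf_geometric_ennreal) (use q in auto)
  finally have near: "(\<integral>\<^sup>+w. riesz_kernel \<alpha> (norm w) * indicator (cball 0 1) (w::'a) \<partial>lborel) \<le> ennreal (?V * 2 powr \<alpha> / (1 - q))" .
  have "(\<integral>\<^sup>+u. riesz_kernel \<alpha> (norm (b + u)) * indicator (cball 0 1) u \<partial>lborel)
    \<le> (\<integral>\<^sup>+u. riesz_kernel \<alpha> (norm (b + u)) * indicator (cball 0 1) (b + u) + indicator (cball 0 1) u \<partial>lborel)"
  proof (rule nn_integral_mono)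
    fix u :: 'a
    show "riesz_kernel \<alpha> (norm (b + u)) * indicator (cball 0 1) u \<le> riesz_kernel \<alpha> (norm (b + u)) * indicator (cball 0 1) (b + u) + indicator (cball 0 1) u"
    proof (cases "norm (b + u) \<le> 1")
      case True
      then show ?thesis by (auto split: split_indicator)
    next
      case False
      then have "riesz_kernel \<alpha> (norm (b + u)) \<le> riesz_kernel \<alpha> 1" using \<alpha> by (intro riesz_kernel_mono) auto
      then show ?thesis by (auto simp: riesz_kernel_pos split: split_indicator)
    qed
  qed
  also have "\<dots> = (\<integral>\<^sup>+u. riesz_kernel \<alpha> (norm (b + u)) * indicator (cball 0 1) (b + u) \<partial>lborel) + emeasure lborel (cball (0::'a) 1)"
    by (subst nn_integral_add) auto
  also have "(\<integral>\<^sup>+u. riesz_kernel \<alpha> (norm (b + u)) * indicator (cball 0 1) (b + u) \<partial>lborel) = (\<integral>\<^sup>+w. riesz_kernel \<alpha> (norm w) * indicator (cball 0 1) (w::'a) \<partial>lborel)"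
  proof -
    have "(\<lambda>w. riesz_kernel \<alpha> (norm w) * indicator (cball 0 1) (w::'a)) \<in> borel_measurable borel" by measurable
    from nn_integral_lborel_scale[OF this, of 1 b] show ?thesis by simp
  qed
  also have "\<dots> + emeasure lborel (cball (0::'a) 1) \<le> ennreal (?V * 2 powr \<alpha> / (1 - q)) + ennreal ?V"
    using near by (intro add_mono) (auto simp: emeasure_cball)
  also have "\<dots> = ennreal C"
    unfolding C_def q_def[symmetric] using q by (subst ennreal_plus) auto
  finally show ?thesis .
qed

lemma nn_integral_uniform_riesz_kernel:
  assumes \<alpha>: "0 \<le> \<alpha>" "\<alpha> < real DIM('a::euclidean_space)"
  obtains C where "0 \<le> C"
    "\<And>(a::'a) \<rho>. 0 < \<rho> \<Longrightarrow> (\<integral>\<^sup>+u. riesz_kernel \<alpha> (norm (a + \<rho> *\<^sub>R u)) \<partial>uniform_measure lborel (cball 0 1)) \<le> ennreal (C * \<rho> powr - \<alpha>)"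
proof -
  let ?V = "unit_ball_vol (real DIM('a))"
  define C where "C = ?V * 2 powr \<alpha> / (1 - 2 powr (\<alpha> - real DIM('a))) + ?V"
  have V: "emeasure lborel (cball (0::'a) 1) = ennreal ?V" by (simp add: emeasure_cball)
  have "2 powr (\<alpha> - real DIM('a)) < 1" using \<alpha> by (simp add: powr_less_one)
  then have C: "0 \<le> C" by (auto simp: C_def)
  show thesis
  proof
    show "0 \<le> C / ?V" using C by simp
    fix a :: 'a and \<rho> :: real assume \<rho>: "0 < \<rho>"
    have "norm (a + \<rho> *\<^sub>R u) = \<rho> * norm ((1 / \<rho>) *\<^sub>R a + u)" for u
    proof -
      have "a + \<rho> *\<^sub>R u = \<rho> *\<^sub>R ((1 / \<rho>) *\<^sub>R a + u)" using \<rho> by (simp add: scaleR_add_right)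
      then show ?thesis using \<rho> by simp
    qed
    then have "(\<integral>\<^sup>+u. riesz_kernel \<alpha> (norm (a + \<rho> *\<^sub>R u)) \<partial>uniform_measure lborel (cball 0 1)) =
      (\<integral>\<^sup>+u. ennreal (\<rho> powr - \<alpha>) * riesz_kernel \<alpha> (norm ((1 / \<rho>) *\<^sub>R a + u)) \<partial>uniform_measure lborel (cball 0 1))"
      using \<rho> \<alpha> by (simp add: riesz_kernel_scale)
    also have "\<dots> = ennreal (\<rho> powr - \<alpha>) * (\<integral>\<^sup>+u. riesz_kernel \<alpha> (norm ((1 / \<rho>) *\<^sub>R a + u)) \<partial>uniform_measure lborel (cball 0 1))"
      by (rule nn_integral_cmult) measurable
    also have "(\<integral>\<^sup>+u. riesz_kernel \<alpha> (norm ((1 / \<rho>) *\<^sub>R a + u)) \<partial>uniform_measure lborel (cball 0 1)) =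
       (\<integral>\<^sup>+u. riesz_kernel \<alpha> (norm ((1 / \<rho>) *\<^sub>R a + u)) * indicator (cball 0 1) u \<partial>lborel) / ennreal ?V"
      unfolding V[symmetric] by (subst nn_integral_uniform_measure) (auto simp: mult.commute)
    also have "\<dots> \<le> ennreal C / ennreal ?V"
      unfolding C_def by (intro divide_right_mono_ennreal nn_integral_riesz_kernel_ball \<alpha>)
    also have "\<dots> = ennreal (C / ?V)" using C by (simp add: divide_ennreal)
    also have "ennreal (\<rho> powr - \<alpha>) * ennreal (C / ?V) = ennreal (C / ?V * \<rho> powr - \<alpha>)"
      using C by (simp add: ennreal_mult[symmetric] mult.commute)
    finally show "(\<integral>\<^sup>+u. riesz_kernel \<alpha> (norm (a + \<rho> *\<^sub>R u)) \<partial>uniform_measure lborel (cball 0 1)) \<le> ennreal (C / ?V * \<rho> powr - \<alpha>)"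
      by (simp add: mult_left_mono)
  qed
qed

lemma cmod_cis_minus_one_le: "cmod (cis t - 1) \<le> \<bar>t\<bar>"
  using iexp_approx1[of t 0] by (simp add: cis_conv_exp)

lemma prob_space_uniform_ball: "prob_space (uniform_measure lborel (cball (0::'a::euclidean_space) 1))"
  using emeasure_lborel_cball_finite[of "0::'a" 1]
  by (intro prob_space_uniform_measure, insert unit_ball_vol_pos[of "real DIM('a)"], auto simp: emeasure_cball simp del: unit_ball_vol_pos)

lemma AE_uniform_ball: "AE u in uniform_measure lborel (cball (0::'a::euclidean_space) 1). norm u \<le> 1"
  by (rule AE_uniform_measureI) auto

lemma cmod_fourier_uniform_ball_ge:
  fixes \<eta> :: "'a::euclidean_space"
  assumes "norm \<eta> \<le> 1 / (4 * pi)"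
  shows "1 / 2 \<le> cmod (fourier (uniform_measure lborel (cball 0 1)) \<eta>)"
proof -
  let ?U = "uniform_measure lborel (cball (0::'a) 1)"
  interpret U: prob_space ?U by (rule prob_space_uniform_ball)
  have int: "integrable ?U (\<lambda>u. cis2pi (- (u \<bullet> \<eta>)))"
    by (rule U.integrable_bounded[of _ 1]) auto
  have "cmod (fourier ?U \<eta> - 1) = cmod (LINT u|?U. cis2pi (- (u \<bullet> \<eta>)) - 1)"
    unfolding fourier_eq using int by (subst Bochner_Integration.integral_diff) (auto simp: U.prob_space[simplified])
  also have "\<dots> \<le> (LINT u|?U. cmod (cis2pi (- (u \<bullet> \<eta>)) - 1))"
    by (rule integral_norm_bound)
  also have "\<dots> \<le> (LINT u|?U. 1 / 2)"
  proof (rule integral_mono_AE)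
    show "integrable ?U (\<lambda>u. cmod (cis2pi (- (u \<bullet> \<eta>)) - 1))"
      using int by auto
    show "AE u in ?U. cmod (cis2pi (- (u \<bullet> \<eta>)) - 1) \<le> 1 / 2"
      using AE_uniform_ball
    proof eventually_elim
      fix u :: 'a assume u: "norm u \<le> 1"
      have "cmod (cis2pi (- (u \<bullet> \<eta>)) - 1) \<le> \<bar>2 * pi * - (u \<bullet> \<eta>)\<bar>" by (rule cmod_cis_minus_one_le)
      also have "\<dots> = 2 * pi * \<bar>u \<bullet> \<eta>\<bar>" by (simp add: abs_mult)
      also have "\<bar>u \<bullet> \<eta>\<bar> \<le> norm u * norm \<eta>" by (rule Cauchy_Schwarz_ineq2)
      also have "\<dots> \<le> 1 * (1 / (4 * pi))" using u assms by (intro mult_mono) auto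
      finally show "cmod (cis2pi (- (u \<bullet> \<eta>)) - 1) \<le> 1 / 2" by simp
    qed
  qed auto
  also have "\<dots> = 1 / 2" by (simp add: U.prob_space[simplified])
  finally have "cmod (fourier ?U \<eta> - 1) \<le> 1 / 2" .
  moreover have "1 \<le> cmod (fourier ?U \<eta>) + cmod (fourier ?U \<eta> - 1)"
    using norm_triangle_ineq4[of "fourier ?U \<eta>" "fourier ?U \<eta> - 1"] by simp
  ultimately show ?thesis by simp
qed

text \<open>
The inequality whose admissible exponents \<open>\<beta>\<close> define \<open>\<beta>(\<alpha>, S\<^sup>n\<^sup>-\<^sup>1)\<close>, for a fixed constant.
\<close>

definition spherical_decay_bound :: "'a::euclidean_space itself \<Rightarrow> real \<Rightarrow> real \<Rightarrow> real \<Rightarrow> bool" where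
  "spherical_decay_bound _ \<alpha> \<beta> C \<longleftrightarrow> (\<forall>M \<in> (unit_ball_measures :: 'a measure set). \<forall>r>0.
    (\<integral>\<^sup>+\<omega>. ennreal ((cmod (fourier M (r *\<^sub>R \<omega>)))\<^sup>2) \<partial>surface) \<le> ennreal C * ennreal (r powr - \<beta>) * energy \<alpha> M)"

text \<open>
The same inequality with the kernel of the energy truncated at distance \<open>1 / r\<close>. Unlike the energy,
the truncated one is finite for every finite measure.
\<close>

definition mollified_decay_bound :: "'a::euclidean_space itself \<Rightarrow> real \<Rightarrow> real \<Rightarrow> real \<Rightarrow> bool" where
  "mollified_decay_bound _ \<alpha> \<beta> C \<longleftrightarrow> (\<forall>N \<in> (unit_ball_measures :: 'a measure set). \<forall>r\<ge>1.
      (\<integral>\<^sup>+\<omega>. ennreal ((cmod (fourier N (r *\<^sub>R \<omega>)))\<^sup>2) \<partial>surface) \<le>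
      ennreal (C * r powr - \<beta>) * (\<integral>\<^sup>+y. \<integral>\<^sup>+x. ennreal (max (dist x y) (1 / r) powr - \<alpha>) \<partial>N \<partial>N))"

text \<open>
Apply the hypothesis to the image \<open>M\<close> of \<open>N \<times> U\<close> under \<open>(x, u) \<mapsto> (x + \<rho> u) / 2\<close>, where \<open>U\<close> is the uniform
probability on the unit ball and \<open>\<rho> = 1 / (4\<pi>r)\<close>. On the sphere of radius \<open>2r\<close> the transform of \<open>M\<close> is that of
\<open>N\<close> at radius \<open>r\<close> times a factor of modulus at least \<open>1/2\<close>, while averaging over \<open>U\<close> caps the kernel of the
energy of \<open>M\<close> at distances below \<open>1 / r\<close>.
\<close>

lemma spherical_decay_bound_mollified:
  assumes \<alpha>: "0 \<le> \<alpha>" "\<alpha> < real DIM('a)" and C0: "0 \<le> C0"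
    and adm: "spherical_decay_bound TYPE('a::euclidean_space) \<alpha> \<beta> C0"
  obtains C where "0 \<le> C" "mollified_decay_bound TYPE('a) \<alpha> \<beta> C"
proof -
  obtain C1 where C1: "0 \<le> C1"
    "\<And>(a::'a) \<rho>. 0 < \<rho> \<Longrightarrow> (\<integral>\<^sup>+u. riesz_kernel \<alpha> (norm (a + \<rho> *\<^sub>R u)) \<partial>uniform_measure lborel (cball 0 1)) \<le> ennreal (C1 * \<rho> powr - \<alpha>)"
    by (rule nn_integral_uniform_riesz_kernel[OF \<alpha>]) blast
  define K where "K = 4 powr \<alpha> + (8 * pi) powr \<alpha> * C1"
  have K: "0 \<le> K" using C1 by (simp add: K_def)
  define U where "U = uniform_measure lborel (cball (0::'a) 1)"
  interpret U: prob_space U unfolding U_def by (rule prob_space_uniform_ball)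
  have sU [simp, measurable_cong]: "sets U = sets borel" by (simp add: U_def)
  show thesis
  proof
    show "0 \<le> 4 * C0 * 2 powr - \<beta> * K" using C0 K by simp
    show "mollified_decay_bound TYPE('a) \<alpha> \<beta> (4 * C0 * 2 powr - \<beta> * K)"
      unfolding mollified_decay_bound_def
    proof (intro ballI allI impI)
      fix N :: "'a measure" and r :: real
      assume N: "N \<in> unit_ball_measures" and r: "1 \<le> r"
      let ?T = "\<integral>\<^sup>+y. \<integral>\<^sup>+x. ennreal (max (dist x y) (1 / r) powr - \<alpha>) \<partial>N \<partial>N"
      have sN [measurable_cong]: "sets N = sets borel" and finN: "finite_measure N" and AEN: "AE x in N. norm x \<le> 1"
        using N by (auto simp: unit_ball_measures_iff)
      interpret N: finite_measure N by fact
      interpret NU: pair_sigma_finite N U ..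
      interpret NUF: finite_measure "N \<Otimes>\<^sub>M U"
        by (rule finite_measure_pair_measure) (rule finN U.finite_measure_axioms)+
      \<comment> \<open>With this radius \<open>\<rho> r\<close> is small enough for the transform of \<open>U\<close> to have modulus at least \<open>1/2\<close>.\<close>
      define \<rho> where "\<rho> = 1 / (4 * pi * r)"
      have \<rho>: "0 < \<rho>" using r by (simp add: \<rho>_def)
      have "1 \<le> 4 * pi * r" using mult_mono[of 1 "4 * pi" 1 r] pi_gt3 r by simp
      then have \<rho>1: "\<rho> \<le> 1" by (simp add: \<rho>_def)
      \<comment> \<open>Halving keeps the support in the unit ball; it is paid for by doubling the frequency.\<close>
      define h where "h p = (1 / 2) *\<^sub>R (fst p + \<rho> *\<^sub>R snd p)" for p :: "'a \<times> 'a"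
      have h[measurable]: "h \<in> borel_measurable (N \<Otimes>\<^sub>M U)" unfolding h_def by measurable
      define M where "M = distr (N \<Otimes>\<^sub>M U) borel h"
      have sM [simp, measurable_cong]: "sets M = sets borel" by (simp add: M_def)
      have AEU: "AE u in U. norm u \<le> 1" unfolding U_def by (rule AE_uniform_ball)
      have "AE p in N \<Otimes>\<^sub>M U. norm (h p) \<le> 1"
      proof (rule NU.AE_pair_measure)
        show "{p \<in> space (N \<Otimes>\<^sub>M U). norm (h p) \<le> 1} \<in> sets (N \<Otimes>\<^sub>M U)" by measurable
        show "AE x in N. AE u in U. norm (h (x, u)) \<le> 1"
          using AEN
        proof eventually_elim
          fix x :: 'a assume x: "norm x \<le> 1"
          show "AE u in U. norm (h (x, u)) \<le> 1"
            using AEU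
          proof eventually_elim
            fix u :: 'a assume u: "norm u \<le> 1"
            have "norm (x + \<rho> *\<^sub>R u) \<le> norm x + norm (\<rho> *\<^sub>R u)" by (rule norm_triangle_ineq)
            also have "norm (\<rho> *\<^sub>R u) \<le> 1 * 1" using \<rho> \<rho>1 u unfolding norm_scaleR by (intro mult_mono) auto
            finally show "norm (h (x, u)) \<le> 1" using x by (simp add: h_def)
          qed
        qed
      qed
      then have M: "M \<in> unit_ball_measures"
        unfolding unit_ball_measures_iff M_def
        by (auto simp: AE_distr_iff NUF.finite_measure_distr)
      have four: "cmod (fourier N (r *\<^sub>R \<omega>)) \<le> 2 * cmod (fourier M ((2 * r) *\<^sub>R \<omega>))" if \<omega>: "norm \<omega> = 1" for \<omega>
      proof -
        have "fourier M ((2 * r) *\<^sub>R \<omega>) = (LINT p|(N \<Otimes>\<^sub>M U). cis2pi (- (h p \<bullet> ((2 * r) *\<^sub>R \<omega>))))"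
          unfolding fourier_eq M_def by (rule integral_distr) measurable
        also have "\<dots> = (LINT p|(N \<Otimes>\<^sub>M U). cis2pi (- (fst p \<bullet> (r *\<^sub>R \<omega>))) * cis2pi (- (snd p \<bullet> ((\<rho> * r) *\<^sub>R \<omega>))))"
          by (intro Bochner_Integration.integral_cong HOL.refl)
            (simp add: h_def cis_mult inner_add_left algebra_simps)
        also have "\<dots> = fourier N (r *\<^sub>R \<omega>) * fourier U ((\<rho> * r) *\<^sub>R \<omega>)"
          unfolding fourier_eq
          by (rule integral_mult_pair[where A=1 and B=1, symmetric]) (use finN U.finite_measure_axioms in auto)
        finally have "cmod (fourier M ((2 * r) *\<^sub>R \<omega>)) = cmod (fourier N (r *\<^sub>R \<omega>)) * cmod (fourier U ((\<rho> * r) *\<^sub>R \<omega>))"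
          by (simp add: norm_mult)
        moreover have "1 / 2 \<le> cmod (fourier U ((\<rho> * r) *\<^sub>R \<omega>))"
          unfolding U_def using r \<omega> by (intro cmod_fourier_uniform_ball_ge) (simp add: \<rho>_def)
        then have "cmod (fourier N (r *\<^sub>R \<omega>)) * (1 / 2) \<le> cmod (fourier N (r *\<^sub>R \<omega>)) * cmod (fourier U ((\<rho> * r) *\<^sub>R \<omega>))"
          by (rule mult_left_mono) simp
        ultimately show ?thesis by simp
      qed
      note [measurable] = borel_measurable_fourier[OF sN finN]
      have finM: "finite_measure M" using M by (simp add: unit_ball_measures_iff)
      note [measurable] = borel_measurable_fourier[OF sM finM]
      have "(\<integral>\<^sup>+\<omega>. ennreal ((cmod (fourier N (r *\<^sub>R \<omega>)))\<^sup>2) \<partial>surface) \<le> (\<integral>\<^sup>+\<omega>. 4 * ennreal ((cmod (fourier M ((2 * r) *\<^sub>R \<omega>)))\<^sup>2) \<partial>surface)"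
      proof (rule nn_integral_mono_AE)
        show "AE \<omega> in surface. ennreal ((cmod (fourier N (r *\<^sub>R \<omega>)))\<^sup>2) \<le> 4 * ennreal ((cmod (fourier M ((2 * r) *\<^sub>R \<omega>)))\<^sup>2)"
          using AE_surface_norm
        proof eventually_elim
          fix \<omega> :: 'a assume "norm \<omega> = 1"
          from power_mono[OF four[OF this], of 2]
          have "ennreal ((cmod (fourier N (r *\<^sub>R \<omega>)))\<^sup>2) \<le> ennreal (4 * (cmod (fourier M ((2 * r) *\<^sub>R \<omega>)))\<^sup>2)"
            by (intro ennreal_leI) (simp add: power_mult_distrib)
          then show "ennreal ((cmod (fourier N (r *\<^sub>R \<omega>)))\<^sup>2) \<le> 4 * ennreal ((cmod (fourier M ((2 * r) *\<^sub>R \<omega>)))\<^sup>2)"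
            by (simp add: ennreal_mult)
        qed
      qed
      also have "\<dots> = 4 * (\<integral>\<^sup>+\<omega>. ennreal ((cmod (fourier M ((2 * r) *\<^sub>R \<omega>)))\<^sup>2) \<partial>surface)"
        by (rule nn_integral_cmult) measurable
      also have "\<dots> \<le> 4 * (ennreal C0 * ennreal ((2 * r) powr - \<beta>) * energy \<alpha> M)"
      proof (rule mult_left_mono)
        show "(\<integral>\<^sup>+\<omega>. ennreal ((cmod (fourier M ((2 * r) *\<^sub>R \<omega>)))\<^sup>2) \<partial>surface) \<le> ennreal C0 * ennreal ((2 * r) powr - \<beta>) * energy \<alpha> M"
          using adm M r unfolding spherical_decay_bound_def by auto
      qed simp
      also have "energy \<alpha> M \<le> ennreal K * ?T"
      proof -
        have key: "(\<integral>\<^sup>+u. riesz_kernel \<alpha> (dist (h (x, u)) (h (y, v))) \<partial>U) \<le> ennreal K * ennreal (max (dist x y) (1 / r) powr - \<alpha>)"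
          if v: "norm v \<le> 1" for x y v
        proof -
          have d: "dist (h (x, u)) (h (y, v)) = 1 / 2 * norm ((x - y - \<rho> *\<^sub>R v) + \<rho> *\<^sub>R u)" for u
          proof -
            have "h (x, u) - h (y, v) = (1 / 2) *\<^sub>R ((x - y - \<rho> *\<^sub>R v) + \<rho> *\<^sub>R u)"
              by (simp add: h_def algebra_simps)
            then show ?thesis by (simp add: dist_norm)
          qed
          show ?thesis
          proof (cases "1 / r \<le> dist x y")
            case True
            have r4: "4 * \<rho> \<le> 1 / r"
            proof -
              have "4 * \<rho> = (1 / pi) * (1 / r)" by (simp add: \<rho>_def)
              also have "\<dots> \<le> 1 * (1 / r)" using pi_gt3 r by (intro mult_right_mono) auto
              finally show ?thesis by simp
            qed
            then have dp: "0 < dist x y" using True \<rho> by linarith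
            have "(\<integral>\<^sup>+u. riesz_kernel \<alpha> (dist (h (x, u)) (h (y, v))) \<partial>U) \<le> (\<integral>\<^sup>+u. ennreal (4 powr \<alpha> * dist x y powr - \<alpha>) \<partial>U)"
            proof (rule nn_integral_mono_AE)
              show "AE u in U. riesz_kernel \<alpha> (dist (h (x, u)) (h (y, v))) \<le> ennreal (4 powr \<alpha> * dist x y powr - \<alpha>)"
                using AEU
              proof eventually_elim
                fix u :: 'a assume u: "norm u \<le> 1"
                have "norm (x - y) \<le> norm ((x - y - \<rho> *\<^sub>R v) + \<rho> *\<^sub>R u) + norm (\<rho> *\<^sub>R v - \<rho> *\<^sub>R u)"
                  using norm_triangle_ineq[of "(x - y - \<rho> *\<^sub>R v) + \<rho> *\<^sub>R u" "\<rho> *\<^sub>R v - \<rho> *\<^sub>R u"] by simp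
                moreover have "norm (\<rho> *\<^sub>R v - \<rho> *\<^sub>R u) \<le> \<rho> * 1 + \<rho> * 1"
                proof -
                  have "norm (\<rho> *\<^sub>R v) \<le> \<rho> * 1" "norm (\<rho> *\<^sub>R u) \<le> \<rho> * 1"
                    using \<rho> u v by simp_all
                  then show ?thesis using norm_triangle_ineq4[of "\<rho> *\<^sub>R v" "\<rho> *\<^sub>R u"] by linarith
                qed
                ultimately have "1 / 4 * dist x y \<le> dist (h (x, u)) (h (y, v))"
                  using r4 True dist_norm[of x y] unfolding d by linarith
                then have "riesz_kernel \<alpha> (dist (h (x, u)) (h (y, v))) \<le> riesz_kernel \<alpha> (1 / 4 * dist x y)"
                  using \<alpha> by (intro riesz_kernel_mono) auto
                also have "\<dots> = ennreal ((1 / 4) powr - \<alpha> * dist x y powr - \<alpha>)"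
                  using dp \<alpha> by (simp add: riesz_kernel_pos powr_mult[symmetric])
                also have "(1 / 4 :: real) powr - \<alpha> = 4 powr \<alpha>" by (simp add: powr_divide powr_minus_divide)
                finally show "riesz_kernel \<alpha> (dist (h (x, u)) (h (y, v))) \<le> ennreal (4 powr \<alpha> * dist x y powr - \<alpha>)" .
              qed
            qed
            also have "\<dots> = ennreal (4 powr \<alpha> * dist x y powr - \<alpha>)" by (simp add: U.emeasure_space_1)
            also have "\<dots> \<le> ennreal (K * max (dist x y) (1 / r) powr - \<alpha>)"
              using True C1 by (intro ennreal_leI) (auto simp: K_def max_def intro!: mult_right_mono)
            finally show ?thesis using K by (simp add: ennreal_mult)
          next
            case False
            have "(\<integral>\<^sup>+u. riesz_kernel \<alpha> (dist (h (x, u)) (h (y, v))) \<partial>U) = (\<integral>\<^sup>+u. ennreal ((1 / 2) powr - \<alpha>) * riesz_kernel \<alpha> (norm ((x - y - \<rho> *\<^sub>R v) + \<rho> *\<^sub>R u)) \<partial>U)"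
              unfolding d using \<alpha> by (intro nn_integral_cong riesz_kernel_scale) auto
            also have "\<dots> = ennreal ((1 / 2) powr - \<alpha>) * (\<integral>\<^sup>+u. riesz_kernel \<alpha> (norm ((x - y - \<rho> *\<^sub>R v) + \<rho> *\<^sub>R u)) \<partial>U)"
              by (rule nn_integral_cmult) measurable
            also have "\<dots> \<le> ennreal ((1 / 2) powr - \<alpha>) * ennreal (C1 * \<rho> powr - \<alpha>)"
              unfolding U_def by (intro mult_left_mono C1 \<rho>) auto
            also have "\<dots> = ennreal (((1 / 2) powr - \<alpha>) * (C1 * \<rho> powr - \<alpha>))"
              using C1 by (simp add: ennreal_mult[symmetric])
            also have "((1 / 2) powr - \<alpha>) * (C1 * \<rho> powr - \<alpha>) = C1 * ((1 / 2) * \<rho>) powr - \<alpha>"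
              using \<rho> by (subst powr_mult) (auto simp: mult_ac)
            also have "(1 / 2) * \<rho> = (1 / (8 * pi)) * (1 / r)" using r by (simp add: \<rho>_def)
            also have "\<dots> powr - \<alpha> = (8 * pi) powr \<alpha> * (1 / r) powr - \<alpha>"
              using r by (subst powr_mult) (auto simp: powr_divide powr_minus_divide)
            also have "ennreal (C1 * ((8 * pi) powr \<alpha> * (1 / r) powr - \<alpha>)) \<le> ennreal (K * max (dist x y) (1 / r) powr - \<alpha>)"
            proof (rule ennreal_leI)
              have "C1 * ((8 * pi) powr \<alpha> * (1 / r) powr - \<alpha>) = ((8 * pi) powr \<alpha> * C1) * (1 / r) powr - \<alpha>" by simp
              also have "\<dots> \<le> K * (1 / r) powr - \<alpha>" by (intro mult_right_mono) (auto simp: K_def)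
              finally show "C1 * ((8 * pi) powr \<alpha> * (1 / r) powr - \<alpha>) \<le> K * max (dist x y) (1 / r) powr - \<alpha>"
                using False by (simp add: max_def)
            qed
            finally show ?thesis using K by (simp add: ennreal_mult)
          qed
        qed
        have "energy \<alpha> M = (\<integral>\<^sup>+q. \<integral>\<^sup>+p. riesz_kernel \<alpha> (dist (h p) (h q)) \<partial>(N \<Otimes>\<^sub>M U) \<partial>(N \<Otimes>\<^sub>M U))"
        proof -
          interpret M: finite_measure M by (rule finM)
          have "energy \<alpha> M = (\<integral>\<^sup>+y. \<integral>\<^sup>+p. riesz_kernel \<alpha> (dist (h p) y) \<partial>(N \<Otimes>\<^sub>M U) \<partial>M)"
            unfolding energy_def by (intro nn_integral_cong) (subst (1) M_def, subst nn_integral_distr, auto)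
          also have "\<dots> = (\<integral>\<^sup>+q. \<integral>\<^sup>+p. riesz_kernel \<alpha> (dist (h p) (h q)) \<partial>(N \<Otimes>\<^sub>M U) \<partial>(N \<Otimes>\<^sub>M U))"
            unfolding M_def by (rule nn_integral_distr) measurable
          finally show ?thesis .
        qed
        also have "\<dots> = (\<integral>\<^sup>+y. \<integral>\<^sup>+v. \<integral>\<^sup>+p. riesz_kernel \<alpha> (dist (h p) (h (y, v))) \<partial>(N \<Otimes>\<^sub>M U) \<partial>U \<partial>N)"
          by (rule U.nn_integral_fst[symmetric]) measurable
        also have "\<dots> = (\<integral>\<^sup>+y. \<integral>\<^sup>+v. \<integral>\<^sup>+x. \<integral>\<^sup>+u. riesz_kernel \<alpha> (dist (h (x, u)) (h (y, v))) \<partial>U \<partial>N \<partial>U \<partial>N)"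
          by (intro nn_integral_cong, rule U.nn_integral_fst[symmetric]) measurable
        also have "\<dots> \<le> (\<integral>\<^sup>+y. \<integral>\<^sup>+v. \<integral>\<^sup>+x. ennreal K * ennreal (max (dist x y) (1 / r) powr - \<alpha>) \<partial>N \<partial>U \<partial>N)"
        proof (rule nn_integral_mono)
          fix y :: 'a
          show "(\<integral>\<^sup>+v. \<integral>\<^sup>+x. \<integral>\<^sup>+u. riesz_kernel \<alpha> (dist (h (x, u)) (h (y, v))) \<partial>U \<partial>N \<partial>U) \<le> (\<integral>\<^sup>+v. \<integral>\<^sup>+x. ennreal K * ennreal (max (dist x y) (1 / r) powr - \<alpha>) \<partial>N \<partial>U)"
          proof (rule nn_integral_mono_AE)
            show "AE v in U. (\<integral>\<^sup>+x. \<integral>\<^sup>+u. riesz_kernel \<alpha> (dist (h (x, u)) (h (y, v))) \<partial>U \<partial>N) \<le> (\<integral>\<^sup>+x. ennreal K * ennreal (max (dist x y) (1 / r) powr - \<alpha>) \<partial>N)"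
              using AEU by eventually_elim (intro nn_integral_mono key)
          qed
        qed
        also have "\<dots> = ennreal K * ?T"
          by (simp add: nn_integral_cmult U.emeasure_space_1)
        finally show ?thesis .
      qed
      also have "4 * (ennreal C0 * ennreal ((2 * r) powr - \<beta>) * (ennreal K * ?T)) =
        ennreal (4 * C0 * 2 powr - \<beta> * K * r powr - \<beta>) * ?T"
        using C0 K r by (simp add: powr_mult ennreal_mult mult_ac)
      finally show "(\<integral>\<^sup>+\<omega>. ennreal ((cmod (fourier N (r *\<^sub>R \<omega>)))\<^sup>2) \<partial>surface) \<le>
        ennreal (4 * C0 * 2 powr - \<beta> * K * r powr - \<beta>) * ?T"
        by (simp add: mult_left_mono)
    qed
  qed
qed

lemma measure_surface_pos: "0 < measure (surface :: 'a::euclidean_space measure) UNIV"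
proof -
  obtain e :: 'a where e: "norm e = 1" using norm_Basis nonempty_Basis by blast
  have "0 < ennreal (unit_ball_vol (real DIM('a)) / 4 ^ DIM('a) * 1 ^ (DIM('a) - 1))" by simp
  also have "\<dots> \<le> emeasure surface (cball e 1)" by (rule emeasure_surface_cap_ge[OF e]) auto
  also have "\<dots> \<le> emeasure (surface :: 'a measure) UNIV" by (rule emeasure_mono) auto
  finally show ?thesis by (simp add: surface.emeasure_eq_measure)
qed

text \<open>
For a point mass the left-hand side of the mollified inequality is the constant \<open>\<sigma>(S\<^sup>n\<^sup>-\<^sup>1) > 0\<close>, whereas the
right-hand side is \<open>C r\<^sup>\<alpha>\<^sup>-\<^sup>\<beta>\<close>.
\<close>

lemma decay_exponent_le_dimension:
  assumes C: "0 \<le> C" and moll: "mollified_decay_bound TYPE('a::euclidean_space) \<alpha> \<beta> C"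
  shows "\<beta> \<le> \<alpha>"
proof (rule ccontr)
  assume "\<not> \<beta> \<le> \<alpha>"
  then have neg: "\<alpha> - \<beta> < 0" by simp
  define m where "m = measure (surface :: 'a measure) UNIV"
  let ?N = "return borel (0::'a)"
  interpret prob_space ?N by (rule prob_space_return) simp
  have N: "?N \<in> unit_ball_measures"
    by (auto simp: unit_ball_measures_iff AE_return finite_measure_axioms)
  have four: "fourier ?N \<xi> = 1" for \<xi>
    unfolding fourier_eq by (subst integral_return) auto
  have "m \<le> C * real (Suc k) powr (\<alpha> - \<beta>)" for k
  proof -
    define r where "r = real (Suc k)"
    have r: "1 \<le> r" by (simp add: r_def)
    have "(\<integral>\<^sup>+\<omega>. ennreal ((cmod (fourier ?N (r *\<^sub>R \<omega>)))\<^sup>2) \<partial>surface) \<le>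
      ennreal (C * r powr - \<beta>) * (\<integral>\<^sup>+y. \<integral>\<^sup>+x. ennreal (max (dist x y) (1 / r) powr - \<alpha>) \<partial>?N \<partial>?N)"
      using moll N r unfolding mollified_decay_bound_def by blast
    also have "(\<integral>\<^sup>+\<omega>. ennreal ((cmod (fourier ?N (r *\<^sub>R \<omega>)))\<^sup>2) \<partial>surface) = ennreal m"
      unfolding four by (simp add: m_def surface.emeasure_eq_measure)
    also have "(\<integral>\<^sup>+y. \<integral>\<^sup>+x. ennreal (max (dist x y) (1 / r) powr - \<alpha>) \<partial>?N \<partial>?N) = ennreal ((1 / r) powr - \<alpha>)"
      using r by (simp add: nn_integral_return max_def)
    also have "(1 / r) powr - \<alpha> = r powr \<alpha>" using r by (simp add: powr_divide powr_minus_divide)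
    also have "ennreal (C * r powr - \<beta>) * ennreal (r powr \<alpha>) = ennreal (C * r powr (\<alpha> - \<beta>))"
      using C by (simp add: ennreal_mult[symmetric] powr_add[symmetric] mult.assoc)
    finally show ?thesis using C by (simp add: r_def)
  qed
  moreover have "(\<lambda>k. C * real (Suc k) powr (\<alpha> - \<beta>)) \<longlonglongrightarrow> C * 0"
    by (intro tendsto_mult tendsto_const tendsto_neg_powr neg)
      (rule filterlim_compose[OF filterlim_real_sequentially filterlim_Suc])
  ultimately have "m \<le> C * 0" by (intro LIMSEQ_le_const) auto
  then show False using measure_surface_pos[where 'a='a] by (simp add: m_def)
qed

section \<open>Restriction and extension with respect to a Frostman measure\<close>

lemma emeasure_cball_le_frostman_const:
  assumes "0 < r"
  shows "emeasure M (cball x r) \<le> frostman_const \<alpha> M * ennreal (r powr \<alpha>)"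
proof -
  have "emeasure M (cball x r) / ennreal (r powr \<alpha>) \<le> frostman_const \<alpha> M"
    unfolding frostman_const_def
    by (rule SUP_upper2[of x], simp, rule SUP_upper2[of r]) (use assms in auto)
  then have "emeasure M (cball x r) / ennreal (r powr \<alpha>) * ennreal (r powr \<alpha>) \<le> frostman_const \<alpha> M * ennreal (r powr \<alpha>)"
    by (rule mult_right_mono) simp
  then show ?thesis using assms
    by (simp add: ennreal_divide_times[symmetric] mult_divide_eq_ennreal ennreal_divide_times)
qed

lemma emeasure_UNIV_le_frostman_const:
  fixes M :: "'a::euclidean_space measure"
  assumes "M \<in> unit_ball_measures"
  shows "emeasure M UNIV \<le> frostman_const \<alpha> M"
proof -
  have s: "sets M = sets borel" and AE: "AE x in M. norm x \<le> 1" using assms by (auto simp: unit_ball_measures_iff)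
  have "emeasure M UNIV = emeasure M (cball 0 1)"
    using AE by (intro emeasure_eq_AE) (auto simp: s)
  also have "\<dots> \<le> frostman_const \<alpha> M" using emeasure_cball_le_frostman_const[of 1 M 0 \<alpha>] by simp
  finally show ?thesis .
qed

text \<open>
Without truncation the integral may diverge logarithmically under the Frostman condition. The truncation
allows to trade \<open>m\<^sup>-\<^sup>\<alpha>\<close> for \<open>r\<^sup>\<epsilon> m\<^sup>-\<^sup>(\<^sup>\<alpha>\<^sup>-\<^sup>\<epsilon>\<^sup>)\<close>, where \<open>m\<close> is the truncated distance, and the smaller exponent makes the
dyadic series geometric.
\<close>

lemma truncated_kernel_frostman:
  fixes M :: "'a::euclidean_space measure"
  assumes M: "M \<in> unit_ball_measures" and \<epsilon>: "0 < \<epsilon>" "\<epsilon> \<le> \<alpha>" and r: "1 \<le> r" and x: "norm x \<le> 1"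
  shows "(\<integral>\<^sup>+y. ennreal (max (dist y x) (1 / r) powr - \<alpha>) \<partial>M) \<le>
    ennreal (2 powr \<alpha> / (1 - 2 powr - \<epsilon>) * r powr \<epsilon>) * frostman_const \<alpha> M"
proof -
  have s [measurable_cong]: "sets M = sets borel" and AE: "AE x in M. norm x \<le> 1"
    using M by (auto simp: unit_ball_measures_iff)
  define q where "q = (2::real) powr - \<epsilon>"
  have q: "0 \<le> q" "q < 1" using \<epsilon> by (auto simp: q_def powr_less_one)
  let ?b = "\<lambda>k. ((2::real) / 2 ^ Suc k) powr - (\<alpha> - \<epsilon>)"
  have "(\<integral>\<^sup>+y. ennreal (max (dist y x) (1 / r) powr - \<alpha>) \<partial>M) \<le>
    (\<integral>\<^sup>+y. ennreal (r powr \<epsilon>) * (\<Sum>k. ennreal (?b k) * indicator (cball x (2 / 2 ^ k)) y) \<partial>M)"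
  proof (rule nn_integral_mono_AE)
    show "AE y in M. ennreal (max (dist y x) (1 / r) powr - \<alpha>) \<le> ennreal (r powr \<epsilon>) * (\<Sum>k. ennreal (?b k) * indicator (cball x (2 / 2 ^ k)) y)"
      using AE
    proof eventually_elim
      fix y :: 'a assume y: "norm y \<le> 1"
      define m where "m = max (dist y x) (1 / r)"
      have m0: "0 < m" using r by (simp add: m_def less_max_iff_disj)
      have "dist y x \<le> norm y + norm x" unfolding dist_norm by (rule norm_triangle_ineq4)
      moreover have "1 / r \<le> 1" using r by simp
      ultimately have m2: "m \<le> 2" using x y by (simp add: m_def)
      have "m powr - \<alpha> = m powr - \<epsilon> * m powr - (\<alpha> - \<epsilon>)" using m0 by (simp add: powr_add[symmetric])
      also have "m powr - \<epsilon> \<le> (1 / r) powr - \<epsilon>" using \<epsilon> r by (intro powr_mono2') (auto simp: m_def)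
      also have "(1 / r) powr - \<epsilon> = r powr \<epsilon>" using r by (simp add: powr_divide powr_minus_divide)
      finally have "ennreal (m powr - \<alpha>) \<le> ennreal (r powr \<epsilon> * m powr - (\<alpha> - \<epsilon>))"
        by (intro ennreal_leI) (simp add: mult_right_mono)
      also have "\<dots> = ennreal (r powr \<epsilon>) * riesz_kernel (\<alpha> - \<epsilon>) m"
        using m0 by (simp add: ennreal_mult riesz_kernel_pos)
      also have "riesz_kernel (\<alpha> - \<epsilon>) m \<le> (\<Sum>k. ennreal (?b k) * indicator {..2 / 2 ^ k} m)"
        using \<epsilon> m0 m2 by (intro riesz_kernel_le_dyadic_sum) auto
      also have "\<dots> \<le> (\<Sum>k. ennreal (?b k) * indicator (cball x (2 / 2 ^ k)) y)"
        by (intro suminf_le mult_left_mono) (auto simp: m_def dist_commute split: split_indicator)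
      finally show "ennreal (max (dist y x) (1 / r) powr - \<alpha>) \<le> ennreal (r powr \<epsilon>) * (\<Sum>k. ennreal (?b k) * indicator (cball x (2 / 2 ^ k)) y)"
        unfolding m_def by (simp add: mult_left_mono)
    qed
  qed
  also have "\<dots> = ennreal (r powr \<epsilon>) * (\<Sum>k. ennreal (?b k) * emeasure M (cball x (2 / 2 ^ k)))"
  proof -
    have "cball x (2 / 2 ^ k) \<in> sets M" for k :: nat by (simp add: s)
    then show ?thesis by (simp add: nn_integral_cmult nn_integral_suminf)
  qed
  also have "(\<Sum>k. ennreal (?b k) * emeasure M (cball x (2 / 2 ^ k))) \<le> (\<Sum>k. ennreal (2 powr \<alpha> * q ^ k) * frostman_const \<alpha> M)"
  proof (rule suminf_le)
    fix k :: nat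
    have p: "(2::real) ^ k = 2 powr real k" by (simp add: powr_realpow)
    have e: "?b k * (2 / 2 ^ k) powr \<alpha> = 2 powr \<alpha> * q ^ k"
    proof -
      have "(2::real) / 2 ^ Suc k = 2 powr (- real k)" by (simp add: p powr_minus_divide)
      then have "?b k = (2 powr (- real k)) powr - (\<alpha> - \<epsilon>)" by simp
      also have "\<dots> = 2 powr (real k * (\<alpha> - \<epsilon>))" unfolding powr_powr by (simp add: algebra_simps)
      finally have "?b k = 2 powr (real k * (\<alpha> - \<epsilon>))" .
      moreover have "(2 / 2 ^ k) powr \<alpha> = 2 powr \<alpha> * 2 powr (- (real k * \<alpha>))"
        by (simp add: p powr_divide powr_minus_divide powr_powr)
      moreover have "q ^ k = 2 powr (- (real k * \<epsilon>))"
        unfolding q_def by (subst powr_realpow[symmetric]) (auto simp: powr_powr mult.commute)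
      moreover have "(2::real) powr (real k * (\<alpha> - \<epsilon>)) * 2 powr (- (real k * \<alpha>)) = 2 powr (- (real k * \<epsilon>))"
        by (simp add: powr_add[symmetric] algebra_simps)
      ultimately show ?thesis by (simp add: mult_ac)
    qed
    have "ennreal (?b k) * emeasure M (cball x (2 / 2 ^ k)) \<le> ennreal (?b k) * (frostman_const \<alpha> M * ennreal ((2 / 2 ^ k) powr \<alpha>))"
      by (intro mult_left_mono emeasure_cball_le_frostman_const) auto
    also have "\<dots> = ennreal (?b k * (2 / 2 ^ k) powr \<alpha>) * frostman_const \<alpha> M"
      by (simp only: ennreal_mult powr_ge_zero mult_ac)
    finally show "ennreal (?b k) * emeasure M (cball x (2 / 2 ^ k)) \<le> ennreal (2 powr \<alpha> * q ^ k) * frostman_const \<alpha> M"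
      unfolding e .
  qed auto
  also have "\<dots> = ennreal (2 powr \<alpha> / (1 - q)) * frostman_const \<alpha> M"
    by (simp only: ennreal_suminf_multc suminf_geometric_ennreal[OF powr_ge_zero q])
  finally have "(\<integral>\<^sup>+y. ennreal (max (dist y x) (1 / r) powr - \<alpha>) \<partial>M) \<le>
      ennreal (r powr \<epsilon>) * (ennreal (2 powr \<alpha> / (1 - q)) * frostman_const \<alpha> M)"
    by (simp add: mult_left_mono)
  moreover have "ennreal (2 powr \<alpha> / (1 - q) * r powr \<epsilon>) = ennreal (2 powr \<alpha> / (1 - q)) * ennreal (r powr \<epsilon>)"
    using q by (intro ennreal_mult) auto
  ultimately show ?thesis
    unfolding q_def[symmetric] by (simp only: mult_ac)
qed

lemma schur_test:
  fixes k :: "'a \<Rightarrow> 'a \<Rightarrow> ennreal" and g :: "'a \<Rightarrow> real"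
  assumes M: "finite_measure M" and [measurable]: "(\<lambda>(x, y). k x y) \<in> borel_measurable (M \<Otimes>\<^sub>M M)" "g \<in> borel_measurable M"
    and g: "\<And>x. 0 \<le> g x"
    and 1: "AE x in M. (\<integral>\<^sup>+y. k x y \<partial>M) \<le> A" and 2: "AE y in M. (\<integral>\<^sup>+x. k x y \<partial>M) \<le> A"
  shows "(\<integral>\<^sup>+y. \<integral>\<^sup>+x. k x y * ennreal (g x) * ennreal (g y) \<partial>M \<partial>M) \<le> A * (\<integral>\<^sup>+x. ennreal ((g x)\<^sup>2) \<partial>M)"
proof -
  interpret finite_measure M by fact
  interpret P: pair_sigma_finite M M ..
  let ?h = "\<lambda>x. ennreal ((g x)\<^sup>2 / 2)"
  have "(\<integral>\<^sup>+y. \<integral>\<^sup>+x. k x y * ennreal (g x) * ennreal (g y) \<partial>M \<partial>M) \<le> (\<integral>\<^sup>+y. \<integral>\<^sup>+x. k x y * ?h x + k x y * ?h y \<partial>M \<partial>M)"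
  proof (intro nn_integral_mono)
    fix x y
    have "g x * g y \<le> (g x)\<^sup>2 / 2 + (g y)\<^sup>2 / 2"
      using sum_squares_bound[of "g x" "g y"] by simp
    then have "ennreal (g x) * ennreal (g y) \<le> ?h x + ?h y"
      using g by (simp add: ennreal_mult[symmetric] ennreal_plus[symmetric] ennreal_leI del: ennreal_plus)
    then show "k x y * ennreal (g x) * ennreal (g y) \<le> k x y * ?h x + k x y * ?h y"
      unfolding mult.assoc distrib_left[symmetric] by (rule mult_left_mono) simp
  qed
  also have "\<dots> = (\<integral>\<^sup>+y. (\<integral>\<^sup>+x. k x y * ?h x \<partial>M) + (\<integral>\<^sup>+x. k x y * ?h y \<partial>M) \<partial>M)"
    by (intro nn_integral_cong nn_integral_add) measurable
  also have "\<dots> = (\<integral>\<^sup>+y. \<integral>\<^sup>+x. k x y * ?h x \<partial>M \<partial>M) + (\<integral>\<^sup>+y. \<integral>\<^sup>+x. k x y * ?h y \<partial>M \<partial>M)"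
    by (rule nn_integral_add) measurable
  also have "(\<integral>\<^sup>+y. \<integral>\<^sup>+x. k x y * ?h x \<partial>M \<partial>M) = (\<integral>\<^sup>+x. \<integral>\<^sup>+y. k x y * ?h x \<partial>M \<partial>M)"
    by (rule P.Fubini') measurable
  also have "\<dots> = (\<integral>\<^sup>+x. (\<integral>\<^sup>+y. k x y \<partial>M) * ?h x \<partial>M)"
    by (intro nn_integral_cong nn_integral_multc) measurable
  also have "\<dots> \<le> (\<integral>\<^sup>+x. A * ?h x \<partial>M)"
    by (rule nn_integral_mono_AE, use 1 in eventually_elim) (rule mult_right_mono, auto)
  also have "(\<integral>\<^sup>+y. \<integral>\<^sup>+x. k x y * ?h y \<partial>M \<partial>M) = (\<integral>\<^sup>+y. (\<integral>\<^sup>+x. k x y \<partial>M) * ?h y \<partial>M)"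
    by (intro nn_integral_cong nn_integral_multc) measurable
  also have "\<dots> \<le> (\<integral>\<^sup>+x. A * ?h x \<partial>M)"
    by (rule nn_integral_mono_AE, use 2 in eventually_elim) (rule mult_right_mono, auto)
  also have "(\<integral>\<^sup>+x. A * ?h x \<partial>M) + (\<integral>\<^sup>+x. A * ?h x \<partial>M) = (\<integral>\<^sup>+x. A * ?h x + A * ?h x \<partial>M)"
    by (rule nn_integral_add[symmetric]) auto
  also have "\<dots> = (\<integral>\<^sup>+x. A * ennreal ((g x)\<^sup>2) \<partial>M)"
    by (intro nn_integral_cong) (simp add: distrib_left[symmetric] ennreal_plus[symmetric] del: ennreal_plus)
  also have "\<dots> = A * (\<integral>\<^sup>+x. ennreal ((g x)\<^sup>2) \<partial>M)" by (rule nn_integral_cmult) measurable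
  finally show ?thesis by (simp add: add_mono)
qed

text \<open>
The measure \<open>g M\<close> is again admissible in the mollified inequality, and its truncated energy is controlled
by Schur's test.
\<close>

lemma restriction_nonneg:
  fixes M :: "'a::euclidean_space measure" and g :: "'a \<Rightarrow> real"
  assumes C: "0 \<le> C" and moll: "mollified_decay_bound TYPE('a) \<alpha> \<beta> C"
    and M: "M \<in> unit_ball_measures" and \<epsilon>: "0 < \<epsilon>" "\<epsilon> \<le> \<alpha>" and r: "1 \<le> r"
    and [measurable]: "g \<in> borel_measurable borel" and g: "\<And>x. 0 \<le> g x" "\<And>x. g x \<le> B"
  shows "(\<integral>\<^sup>+\<omega>. ennreal ((cmod (LINT x|M. of_real (g x) * cis2pi (- (x \<bullet> (r *\<^sub>R \<omega>)))))\<^sup>2) \<partial>surface) \<le>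
    ennreal (C * (2 powr \<alpha> / (1 - 2 powr - \<epsilon>)) * r powr (\<epsilon> - \<beta>)) * frostman_const \<alpha> M * (\<integral>\<^sup>+x. ennreal ((g x)\<^sup>2) \<partial>M)"
proof -
  have s [measurable_cong]: "sets M = sets borel" and fin: "finite_measure M" and AE: "AE x in M. norm x \<le> 1"
    using M by (auto simp: unit_ball_measures_iff)
  interpret M: finite_measure M by fact
  define N where "N = density M (\<lambda>x. ennreal (g x))"
  have sN [simp, measurable_cong]: "sets N = sets borel" by (simp add: N_def s)
  have gm [measurable]: "g \<in> borel_measurable M" by measurable
  have finN: "finite_measure N"
  proof (rule finite_measureI)
    have "emeasure N (space N) = (\<integral>\<^sup>+x. ennreal (g x) \<partial>M)"
      unfolding N_def by (subst emeasure_density) (auto intro!: nn_integral_cong split: split_indicator)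
    also have "\<dots> \<le> (\<integral>\<^sup>+x. ennreal B \<partial>M)" by (intro nn_integral_mono ennreal_leI g)
    also have "\<dots> < \<infinity>" by (simp add: ennreal_mult_less_top M.emeasure_eq_measure)
    finally show "emeasure N (space N) \<noteq> \<infinity>" by simp
  qed
  have N: "N \<in> unit_ball_measures"
  proof -
    have "AE x in N. norm x \<le> 1" unfolding N_def by (subst AE_density) (use AE in auto)
    then show ?thesis by (simp add: unit_ball_measures_iff finN)
  qed
  have four: "fourier N \<xi> = (LINT x|M. of_real (g x) * cis2pi (- (x \<bullet> \<xi>)))" for \<xi>
    unfolding fourier_eq N_def
    by (subst integral_density) (auto simp: g scaleR_conv_of_real)
  let ?K = "2 powr \<alpha> / (1 - 2 powr - \<epsilon>)"
  have "2 powr - \<epsilon> < 1" using \<epsilon> by (simp add: powr_less_one)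
  then have K: "0 \<le> ?K" by simp
  let ?k = "\<lambda>x y::'a. ennreal (max (dist x y) (1 / r) powr - \<alpha>)"
  have "(\<integral>\<^sup>+\<omega>. ennreal ((cmod (fourier N (r *\<^sub>R \<omega>)))\<^sup>2) \<partial>surface) \<le> ennreal (C * r powr - \<beta>) * (\<integral>\<^sup>+y. \<integral>\<^sup>+x. ?k x y \<partial>N \<partial>N)"
    using moll N r unfolding mollified_decay_bound_def by blast
  also have "(\<integral>\<^sup>+y. \<integral>\<^sup>+x. ?k x y \<partial>N \<partial>N) = (\<integral>\<^sup>+y. \<integral>\<^sup>+x. ?k x y * ennreal (g x) * ennreal (g y) \<partial>M \<partial>M)"
    unfolding N_def by (simp add: nn_integral_density nn_integral_multc nn_integral_cmult mult_ac)
  also have "\<dots> \<le> (ennreal (?K * r powr \<epsilon>) * frostman_const \<alpha> M) * (\<integral>\<^sup>+x. ennreal ((g x)\<^sup>2) \<partial>M)"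
  proof (rule schur_test[OF fin])
    show "AE y in M. (\<integral>\<^sup>+x. ?k x y \<partial>M) \<le> ennreal (?K * r powr \<epsilon>) * frostman_const \<alpha> M"
      using AE by eventually_elim (rule truncated_kernel_frostman[OF M \<epsilon> r])
    show "AE x in M. (\<integral>\<^sup>+y. ?k x y \<partial>M) \<le> ennreal (?K * r powr \<epsilon>) * frostman_const \<alpha> M"
      using AE by eventually_elim (subst dist_commute, rule truncated_kernel_frostman[OF M \<epsilon> r])
  qed (auto simp: g)
  finally have "(\<integral>\<^sup>+\<omega>. ennreal ((cmod (fourier N (r *\<^sub>R \<omega>)))\<^sup>2) \<partial>surface) \<le>
    ennreal (C * r powr - \<beta>) * ((ennreal (?K * r powr \<epsilon>) * frostman_const \<alpha> M) * (\<integral>\<^sup>+x. ennreal ((g x)\<^sup>2) \<partial>M))"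
    by (simp add: mult_left_mono)
  also have "\<dots> = ennreal ((C * r powr - \<beta>) * (?K * r powr \<epsilon>)) * frostman_const \<alpha> M * (\<integral>\<^sup>+x. ennreal ((g x)\<^sup>2) \<partial>M)"
  proof -
    have gen: "ennreal a * ((ennreal b * c) * d) = ennreal (a * b) * c * d" if "0 \<le> a" "0 \<le> b" for a b c d
      using that by (simp add: ennreal_mult mult.assoc)
    show ?thesis by (rule gen) (use C K in \<open>auto intro!: mult_nonneg_nonneg simp del: times_divide_eq_left\<close>)
  qed
  also have "(C * r powr - \<beta>) * (?K * r powr \<epsilon>) = C * ?K * (r powr - \<beta> * r powr \<epsilon>)"
    by (simp only: mult_ac)
  also have "r powr - \<beta> * r powr \<epsilon> = r powr (\<epsilon> - \<beta>)"
    by (simp add: powr_add[symmetric])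
  finally show ?thesis unfolding four .
qed

lemma cmod_four_terms_square_le:
  "(cmod (a - b + \<i> * (c - d)))\<^sup>2 \<le> 4 * ((cmod a)\<^sup>2 + (cmod b)\<^sup>2 + (cmod c)\<^sup>2 + (cmod d)\<^sup>2)"
proof -
  have "cmod (a - b + \<i> * (c - d)) \<le> cmod (a - b) + cmod (\<i> * (c - d))" by (rule norm_triangle_ineq)
  also have "\<dots> \<le> (cmod a + cmod b) + (cmod c + cmod d)"
    using norm_triangle_ineq4[of a b] norm_triangle_ineq4[of c d] by (simp add: norm_mult)
  finally have "(cmod (a - b + \<i> * (c - d)))\<^sup>2 \<le> (cmod a + cmod b + (cmod c + cmod d))\<^sup>2"
    by (rule power_mono) simp
  also have "\<dots> \<le> 4 * ((cmod a)\<^sup>2 + (cmod b)\<^sup>2 + (cmod c)\<^sup>2 + (cmod d)\<^sup>2)"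
    using sum_squares_bound[of "cmod a" "cmod b"] sum_squares_bound[of "cmod a" "cmod c"] sum_squares_bound[of "cmod a" "cmod d"]
      sum_squares_bound[of "cmod b" "cmod c"] sum_squares_bound[of "cmod b" "cmod d"] sum_squares_bound[of "cmod c" "cmod d"]
    by (simp add: power2_eq_square algebra_simps)
  finally show ?thesis .
qed

text \<open>
The hypothesis speaks of positive measures only; a complex density is split into four nonnegative ones.
\<close>

lemma restriction_complex:
  fixes M :: "'a::euclidean_space measure" and g :: "'a \<Rightarrow> complex"
  assumes C: "0 \<le> C" and moll: "mollified_decay_bound TYPE('a) \<alpha> \<beta> C"
    and M: "M \<in> unit_ball_measures" and \<epsilon>: "0 < \<epsilon>" "\<epsilon> \<le> \<alpha>" and r: "1 \<le> r"
    and [measurable]: "g \<in> borel_measurable borel" and g: "\<And>x. cmod (g x) \<le> B"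
  shows "(\<integral>\<^sup>+\<omega>. ennreal ((cmod (LINT x|M. g x * cis2pi (- (x \<bullet> (r *\<^sub>R \<omega>)))))\<^sup>2) \<partial>surface) \<le>
    4 * (ennreal (C * (2 powr \<alpha> / (1 - 2 powr - \<epsilon>)) * r powr (\<epsilon> - \<beta>)) * frostman_const \<alpha> M) * (\<integral>\<^sup>+x. ennreal ((cmod (g x))\<^sup>2) \<partial>M)"
proof -
  have s [measurable_cong]: "sets M = sets borel" and fin: "finite_measure M"
    using M by (auto simp: unit_ball_measures_iff)
  interpret M: finite_measure M by fact
  let ?G = "\<lambda>\<omega>. LINT x|M. g x * cis2pi (- (x \<bullet> (r *\<^sub>R \<omega>)))"
  define p where "p i x = (if i = (0::nat) then max (Re (g x)) 0 else if i = 1 then max (- Re (g x)) 0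
    else if i = 2 then max (Im (g x)) 0 else max (- Im (g x)) 0)" for i x
  have [measurable]: "p i \<in> borel_measurable borel" for i unfolding p_def by measurable
  have p0: "0 \<le> p i x" for i x by (simp add: p_def)
  have pB: "p i x \<le> B" for i x
    using abs_Re_le_cmod[of "g x"] abs_Im_le_cmod[of "g x"] g[of x] norm_ge_zero[of "g x"] by (auto simp: p_def)
  have gp: "g x = of_real (p 0 x) - of_real (p 1 x) + \<i> * (of_real (p 2 x) - of_real (p 3 x))" for x
    by (auto simp: p_def complex_eq_iff max_def)
  have sq: "(cmod (g x))\<^sup>2 = (p 0 x)\<^sup>2 + (p 1 x)\<^sup>2 + (p 2 x)\<^sup>2 + (p 3 x)\<^sup>2" for x
    by (auto simp: p_def cmod_power2 max_def)
  define h where "h i \<omega> = (LINT x|M. of_real (p i x) * cis2pi (- (x \<bullet> (r *\<^sub>R \<omega>))))" for i \<omega>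
  have [measurable]: "h i \<in> borel_measurable borel" for i unfolding h_def by measurable
  have int: "integrable M (\<lambda>x. of_real (p i x) * cis2pi (- (x \<bullet> (r *\<^sub>R \<omega>))))" for i \<omega>
    by (rule M.integrable_bounded[of _ B]) (auto simp: norm_mult p0 pB)
  have gh: "(?G \<omega>) = h 0 \<omega> - h 1 \<omega> + \<i> * (h 2 \<omega> - h 3 \<omega>)" for \<omega>
  proof -
    have "(?G \<omega>) =
      (LINT x|M. (of_real (p 0 x) * cis2pi (- (x \<bullet> (r *\<^sub>R \<omega>))) - of_real (p 1 x) * cis2pi (- (x \<bullet> (r *\<^sub>R \<omega>))))
       + \<i> * (of_real (p 2 x) * cis2pi (- (x \<bullet> (r *\<^sub>R \<omega>))) - of_real (p 3 x) * cis2pi (- (x \<bullet> (r *\<^sub>R \<omega>)))))"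
      by (subst gp) (simp add: algebra_simps)
    also have "\<dots> = h 0 \<omega> - h 1 \<omega> + \<i> * (h 2 \<omega> - h 3 \<omega>)"
      using int unfolding h_def by (subst Bochner_Integration.integral_add) auto
    finally show ?thesis .
  qed
  let ?D = "ennreal (C * (2 powr \<alpha> / (1 - 2 powr - \<epsilon>)) * r powr (\<epsilon> - \<beta>)) * frostman_const \<alpha> M"
  let ?I = "\<lambda>i. \<integral>\<^sup>+\<omega>. ennreal ((cmod (h i \<omega>))\<^sup>2) \<partial>surface"
  let ?J = "\<lambda>i. \<integral>\<^sup>+x. ennreal ((p i x)\<^sup>2) \<partial>M"
  have IJ: "?I i \<le> ?D * ?J i" for i
    unfolding h_def by (rule restriction_nonneg[OF C moll M \<epsilon> r _ p0 pB]) measurable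
  have "(\<integral>\<^sup>+\<omega>. ennreal ((cmod (?G \<omega>))\<^sup>2) \<partial>surface) \<le>
    (\<integral>\<^sup>+\<omega>. 4 * (ennreal ((cmod (h 0 \<omega>))\<^sup>2) + ennreal ((cmod (h 1 \<omega>))\<^sup>2) + ennreal ((cmod (h 2 \<omega>))\<^sup>2) + ennreal ((cmod (h 3 \<omega>))\<^sup>2)) \<partial>surface)"
  proof (rule nn_integral_mono)
    fix \<omega>
    have "ennreal ((cmod (?G \<omega>))\<^sup>2) \<le>
      ennreal (4 * ((cmod (h 0 \<omega>))\<^sup>2 + (cmod (h 1 \<omega>))\<^sup>2 + (cmod (h 2 \<omega>))\<^sup>2 + (cmod (h 3 \<omega>))\<^sup>2))"
      unfolding gh by (intro ennreal_leI cmod_four_terms_square_le)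
    then show "ennreal ((cmod (?G \<omega>))\<^sup>2) \<le>
      4 * (ennreal ((cmod (h 0 \<omega>))\<^sup>2) + ennreal ((cmod (h 1 \<omega>))\<^sup>2) + ennreal ((cmod (h 2 \<omega>))\<^sup>2) + ennreal ((cmod (h 3 \<omega>))\<^sup>2))"
      by (simp add: ennreal_mult)
  qed
  also have "\<dots> = 4 * (?I 0 + ?I 1 + ?I 2 + ?I 3)"
    by (simp add: nn_integral_cmult nn_integral_add)
  also have "\<dots> \<le> 4 * (?D * ?J 0 + ?D * ?J 1 + ?D * ?J 2 + ?D * ?J 3)"
    by (intro mult_left_mono add_mono IJ) auto
  also have "\<dots> = 4 * ?D * (?J 0 + ?J 1 + ?J 2 + ?J 3)"
    by (simp add: distrib_left mult.assoc)
  also have "?J 0 + ?J 1 + ?J 2 + ?J 3 = (\<integral>\<^sup>+x. ennreal ((cmod (g x))\<^sup>2) \<partial>M)"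
    unfolding sq by (simp add: nn_integral_add)
  finally show ?thesis .
qed

text \<open>
The \<open>TT*\<close> argument. Let \<open>F\<close> be the extension of \<open>f\<close> and \<open>h\<close> the restriction of \<open>F M\<close>. Then
\<open>\<integral> \<bar>F\<bar>\<^sup>2 dM = \<integral> h f\<^sup>* dS \<le> D/2 \<integral> \<bar>f\<bar>\<^sup>2 dS + 1/(2D) \<integral> \<bar>h\<bar>\<^sup>2 dS\<close>, where \<open>f\<^sup>*\<close> is the conjugate, and by assumption the last
term is at most half of the left-hand side, which is finite because \<open>F\<close> is bounded.
\<close>

lemma extension_restriction_duality:
  fixes M S :: "'a::euclidean_space measure" and f :: "'a \<Rightarrow> complex"
  assumes M: "finite_measure M" "sets M = sets borel" and S: "finite_measure S" "sets S = sets borel"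
    and D: "0 < D"
    and restr: "\<And>g. g \<in> borel_measurable borel \<Longrightarrow> (\<exists>B. \<forall>x. cmod (g x) \<le> B) \<Longrightarrow>
      (\<integral>\<^sup>+\<omega>. ennreal ((cmod (LINT x|M. g x * cis2pi (- (x \<bullet> (r *\<^sub>R \<omega>)))))\<^sup>2) \<partial>S) \<le> ennreal D * (\<integral>\<^sup>+x. ennreal ((cmod (g x))\<^sup>2) \<partial>M)"
    and [measurable]: "f \<in> borel_measurable borel" and f: "\<And>x. cmod (f x) \<le> B"
  shows "(\<integral>\<^sup>+x. ennreal ((cmod (LINT \<omega>|S. cis2pi (r * (x \<bullet> \<omega>)) * f \<omega>))\<^sup>2) \<partial>M) \<le> ennreal D * (\<integral>\<^sup>+\<omega>. ennreal ((cmod (f \<omega>))\<^sup>2) \<partial>S)"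
proof -
  note [measurable_cong] = M(2) S(2)
  interpret M: finite_measure M by fact
  interpret S: finite_measure S by fact
  define F where "F x = (LINT \<omega>|S. cis2pi (r * (x \<bullet> \<omega>)) * f \<omega>)" for x
  have [measurable]: "F \<in> borel_measurable borel" unfolding F_def by measurable
  define BF where "BF = measure S (space S) * B"
  have FB: "cmod (F x) \<le> BF" for x
  proof -
    have "cmod (F x) \<le> (LINT \<omega>|S. cmod (cis2pi (r * (x \<bullet> \<omega>)) * f \<omega>))" unfolding F_def by (rule integral_norm_bound)
    also have "\<dots> \<le> (LINT \<omega>|S. B)"
      by (intro integral_mono S.integrable_bounded[of _ B]) (auto simp: norm_mult f intro: order_trans[OF norm_ge_zero f])
    finally show ?thesis by (simp add: BF_def)
  qed
  define h where "h \<omega> = (LINT x|M. F x * cis2pi (- (x \<bullet> (r *\<^sub>R \<omega>))))" for \<omega>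
  have [measurable]: "h \<in> borel_measurable borel" unfolding h_def by measurable
  define Bh where "Bh = measure M (space M) * BF"
  have hB: "cmod (h \<omega>) \<le> Bh" for \<omega>
  proof -
    have "cmod (h \<omega>) \<le> (LINT x|M. cmod (F x * cis2pi (- (x \<bullet> (r *\<^sub>R \<omega>)))))" unfolding h_def by (rule integral_norm_bound)
    also have "\<dots> \<le> (LINT \<omega>|M. BF)"
      by (intro integral_mono M.integrable_bounded[of _ BF]) (auto simp: norm_mult FB intro: order_trans[OF norm_ge_zero FB])
    finally show ?thesis by (simp add: Bh_def)
  qed
  have sqB: "norm ((cmod z)\<^sup>2) \<le> b\<^sup>2" if "cmod z \<le> b" for z b
    using that by (simp add: power_mono)
  have intF: "integrable M (\<lambda>x. (cmod (F x))\<^sup>2)" by (rule M.integrable_bounded[OF _ sqB[OF FB]]) measurable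
  have intf: "integrable S (\<lambda>x. (cmod (f x))\<^sup>2)" by (rule S.integrable_bounded[OF _ sqB[OF f]]) measurable
  have inth: "integrable S (\<lambda>x. (cmod (h x))\<^sup>2)" by (rule S.integrable_bounded[OF _ sqB[OF hB]]) measurable
  define X where "X = (LINT x|M. (cmod (F x))\<^sup>2)"
  define Y where "Y = (LINT \<omega>|S. (cmod (f \<omega>))\<^sup>2)"
  define Z where "Z = (LINT \<omega>|S. (cmod (h \<omega>))\<^sup>2)"
  have X0: "0 \<le> X" and Y0: "0 \<le> Y" by (simp_all add: X_def Y_def)
  have X: "(\<integral>\<^sup>+x. ennreal ((cmod (F x))\<^sup>2) \<partial>M) = ennreal X"
    unfolding X_def by (rule nn_integral_eq_integral[OF intF]) auto
  have Y: "(\<integral>\<^sup>+x. ennreal ((cmod (f x))\<^sup>2) \<partial>S) = ennreal Y"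
    unfolding Y_def by (rule nn_integral_eq_integral[OF intf]) auto
  have Z: "(\<integral>\<^sup>+x. ennreal ((cmod (h x))\<^sup>2) \<partial>S) = ennreal Z"
    unfolding Z_def by (rule nn_integral_eq_integral[OF inth]) auto
  have ZX: "Z \<le> D * X"
  proof -
    have "ennreal Z \<le> ennreal D * ennreal X"
      unfolding Z[symmetric] X[symmetric] h_def by (rule restr) (use FB in auto)
    then show ?thesis using D X0 by (simp add: ennreal_mult[symmetric])
  qed
  have "complex_of_real X = (LINT x|M. F x * cnj (F x))"
    unfolding X_def complex_norm_square[symmetric] by (rule integral_complex_of_real[symmetric])
  also have "\<dots> = (LINT x|M. LINT \<omega>|S. F x * (cis2pi (- (x \<bullet> (r *\<^sub>R \<omega>))) * cnj (f \<omega>)))"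
  proof (intro Bochner_Integration.integral_cong HOL.refl)
    fix x
    have "cnj (F x) = (LINT \<omega>|S. cnj (cis2pi (r * (x \<bullet> \<omega>)) * f \<omega>))"
      unfolding F_def by (rule Bochner_Integration.integral_cnj[symmetric])
    then show "F x * cnj (F x) = (LINT \<omega>|S. F x * (cis2pi (- (x \<bullet> (r *\<^sub>R \<omega>))) * cnj (f \<omega>)))"
      by (simp add: cis_cnj)
  qed
  also have "\<dots> = (LINT \<omega>|S. LINT x|M. F x * (cis2pi (- (x \<bullet> (r *\<^sub>R \<omega>))) * cnj (f \<omega>)))"
  proof (rule Fubini_integral_bounded[OF S(1) M(1)])
    fix \<omega> x
    show "cmod (F x * (cis2pi (- (x \<bullet> (r *\<^sub>R \<omega>))) * cnj (f \<omega>))) \<le> BF * B"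
      using mult_mono[OF FB f order_trans[OF norm_ge_zero FB] norm_ge_zero] by (simp add: norm_mult)
  qed measurable
  also have "\<dots> = (LINT \<omega>|S. h \<omega> * cnj (f \<omega>))"
  proof (intro Bochner_Integration.integral_cong HOL.refl)
    fix \<omega>
    have "h \<omega> * cnj (f \<omega>) = (LINT x|M. F x * cis2pi (- (x \<bullet> (r *\<^sub>R \<omega>))) * cnj (f \<omega>))"
      unfolding h_def by (rule integral_mult_left_zero[symmetric])
    then show "(LINT x|M. F x * (cis2pi (- (x \<bullet> (r *\<^sub>R \<omega>))) * cnj (f \<omega>))) = h \<omega> * cnj (f \<omega>)"
      by (simp add: mult.assoc)
  qed
  finally have "X = cmod (LINT \<omega>|S. h \<omega> * cnj (f \<omega>))"
    using X0 by (metis abs_of_nonneg norm_of_real)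
  also have "\<dots> \<le> (LINT \<omega>|S. cmod (h \<omega> * cnj (f \<omega>)))" by (rule integral_norm_bound)
  also have "\<dots> \<le> (LINT \<omega>|S. D / 2 * (cmod (f \<omega>))\<^sup>2 + 1 / (2 * D) * (cmod (h \<omega>))\<^sup>2)"
  proof (rule integral_mono_AE)
    show "integrable S (\<lambda>\<omega>. cmod (h \<omega> * cnj (f \<omega>)))"
    proof (rule S.integrable_bounded)
      fix \<omega> show "norm (cmod (h \<omega> * cnj (f \<omega>))) \<le> Bh * B"
        using mult_mono[OF hB f order_trans[OF norm_ge_zero hB] norm_ge_zero] by (simp add: norm_mult)
    qed measurable
    show "integrable S (\<lambda>\<omega>. D / 2 * (cmod (f \<omega>))\<^sup>2 + 1 / (2 * D) * (cmod (h \<omega>))\<^sup>2)"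
      using intf inth by (intro Bochner_Integration.integrable_add integrable_mult_right) auto
    show "AE \<omega> in S. cmod (h \<omega> * cnj (f \<omega>)) \<le> D / 2 * (cmod (f \<omega>))\<^sup>2 + 1 / (2 * D) * (cmod (h \<omega>))\<^sup>2"
    proof (intro AE_I2)
      fix \<omega>
      have "0 \<le> (D * cmod (f \<omega>) - cmod (h \<omega>))\<^sup>2" by simp
      then have "2 * D * (cmod (h \<omega>) * cmod (f \<omega>)) \<le> D\<^sup>2 * (cmod (f \<omega>))\<^sup>2 + (cmod (h \<omega>))\<^sup>2"
        by (simp add: power2_eq_square algebra_simps)
      then show "cmod (h \<omega> * cnj (f \<omega>)) \<le> D / 2 * (cmod (f \<omega>))\<^sup>2 + 1 / (2 * D) * (cmod (h \<omega>))\<^sup>2"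
        using D by (simp add: norm_mult field_simps power2_eq_square)
    qed
  qed
  also have "\<dots> = D / 2 * Y + 1 / (2 * D) * Z"
    unfolding Y_def Z_def using intf inth by (subst Bochner_Integration.integral_add) auto
  also have "\<dots> \<le> D / 2 * Y + 1 / (2 * D) * (D * X)"
    using ZX D by (intro add_left_mono mult_left_mono) auto
  also have "\<dots> = D / 2 * Y + X / 2" using D by simp
  finally have "X \<le> D * Y" by simp
  then show ?thesis
    unfolding F_def[symmetric] X Y using D Y0 by (simp add: ennreal_mult[symmetric] ennreal_leI)
qed

text \<open>
Cauchy-Schwarz in \<open>L\<^sup>2(S)\<close>. With \<open>S\<close> the surface measure it serves the low frequencies, where the mollified
inequality says nothing, and the exponent \<open>\<beta>' = 0\<close>, which has to be available even if \<open>\<beta> = 0\<close> leaves no room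
for an \<open>\<epsilon>\<close>-loss.
\<close>

lemma extension_trivial:
  fixes M S :: "'a::euclidean_space measure" and f :: "'a \<Rightarrow> complex"
  assumes M: "finite_measure M" "sets M = sets borel" and S: "finite_measure S" "sets S = sets borel"
    and [measurable]: "f \<in> borel_measurable borel" and f: "\<And>x. cmod (f x) \<le> B"
  shows "(\<integral>\<^sup>+x. ennreal ((cmod (LINT \<omega>|S. cis2pi (r * (x \<bullet> \<omega>)) * f \<omega>))\<^sup>2) \<partial>M) \<le>
    emeasure M UNIV * emeasure S UNIV * (\<integral>\<^sup>+\<omega>. ennreal ((cmod (f \<omega>))\<^sup>2) \<partial>S)"
proof -
  note [measurable_cong] = M(2) S(2)
  interpret M: finite_measure M by fact
  interpret S: finite_measure S by fact
  have sp: "space M = UNIV" "space S = UNIV" using M(2) S(2) sets_eq_imp_space_eq[of _ borel] by auto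
  let ?F = "\<lambda>x. LINT \<omega>|S. cis2pi (r * (x \<bullet> \<omega>)) * f \<omega>"
  let ?Y = "\<integral>\<^sup>+\<omega>. ennreal ((cmod (f \<omega>))\<^sup>2) \<partial>S"
  have "(\<integral>\<^sup>+x. ennreal ((cmod (?F x))\<^sup>2) \<partial>M) \<le>
    (\<integral>\<^sup>+x. ?Y * emeasure S UNIV \<partial>M)"
  proof (rule nn_integral_mono)
    fix x
    have int: "integrable S (\<lambda>\<omega>. cis2pi (r * (x \<bullet> \<omega>)) * f \<omega>)"
      by (rule S.integrable_bounded[of _ B]) (auto simp: norm_mult f)
    have "ennreal (cmod (?F x)) \<le> (\<integral>\<^sup>+\<omega>. ennreal (cmod (cis2pi (r * (x \<bullet> \<omega>)) * f \<omega>)) \<partial>S)"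
      by (rule integral_norm_bound_ennreal[OF int])
    also have "\<dots> = (\<integral>\<^sup>+\<omega>. ennreal (cmod (f \<omega>)) * 1 \<partial>S)" by (simp add: norm_mult)
    finally have "(ennreal (cmod (?F x)))\<^sup>2 \<le> (\<integral>\<^sup>+\<omega>. ennreal (cmod (f \<omega>)) * 1 \<partial>S)\<^sup>2"
      by (rule power_mono) simp
    also have "\<dots> \<le> (\<integral>\<^sup>+\<omega>. (ennreal (cmod (f \<omega>)))\<^sup>2 \<partial>S) * (\<integral>\<^sup>+\<omega>. 1\<^sup>2 \<partial>S)"
      by (rule Cauchy_Schwarz_nn_integral) measurable
    finally show "ennreal ((cmod (?F x))\<^sup>2) \<le> ?Y * emeasure S UNIV"
      by (simp add: ennreal_power sp)
  qed
  also have "\<dots> = emeasure M UNIV * emeasure S UNIV * ?Y"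
    by (simp add: sp mult_ac)
  finally show ?thesis .
qed

lemma extension_estimate:
  assumes C0: "0 \<le> C0" and moll: "mollified_decay_bound TYPE('a::euclidean_space) \<alpha> \<beta> C0"
    and \<beta>': "0 \<le> \<beta>'" "\<beta>' = 0 \<or> \<beta>' < \<beta>"
  obtains C where "0 < C"
    "\<And>(M :: 'a measure) f r B. M \<in> unit_ball_measures \<Longrightarrow> 0 < frostman_const \<alpha> M \<Longrightarrow> frostman_const \<alpha> M < \<infinity> \<Longrightarrow>
      f \<in> borel_measurable borel \<Longrightarrow> (\<And>x. cmod (f x) \<le> B) \<Longrightarrow>
      (\<integral>\<^sup>+x. ennreal ((cmod (LINT \<omega>|surface. cis2pi (r * (x \<bullet> \<omega>)) * f \<omega>))\<^sup>2) \<partial>M) \<le>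
      ennreal (C * max r 1 powr - \<beta>') * frostman_const \<alpha> M * (\<integral>\<^sup>+\<omega>. ennreal ((cmod (f \<omega>))\<^sup>2) \<partial>surface)"
proof -
  define m where "m = measure (surface :: 'a measure) UNIV"
  have m0: "0 \<le> m" by (simp add: m_def)
  define \<epsilon> where "\<epsilon> = \<beta> - \<beta>'"
  define K where "K = 4 * (C0 + 1) * (2 powr \<alpha> / (1 - 2 powr - \<epsilon>))"
  show thesis
  proof
    show "0 < m + \<bar>K\<bar> + 1" using m0 by simp
    fix M :: "'a measure" and f :: "'a \<Rightarrow> complex" and r B :: real
    assume M: "M \<in> unit_ball_measures" and fr: "0 < frostman_const \<alpha> M" "frostman_const \<alpha> M < \<infinity>"
      and f[measurable]: "f \<in> borel_measurable borel" and fB: "\<And>x. cmod (f x) \<le> B"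
    have sM: "sets M = sets borel" and fin: "finite_measure M" using M by (auto simp: unit_ball_measures_iff)
    define c where "c = enn2real (frostman_const \<alpha> M)"
    have c: "frostman_const \<alpha> M = ennreal c" "0 < c" using fr by (auto simp: c_def enn2real_positive_iff)
    let ?X = "\<integral>\<^sup>+x. ennreal ((cmod (LINT \<omega>|surface. cis2pi (r * (x \<bullet> \<omega>)) * f \<omega>))\<^sup>2) \<partial>M"
    let ?Y = "\<integral>\<^sup>+\<omega>. ennreal ((cmod (f \<omega>))\<^sup>2) \<partial>surface"
    show "?X \<le>
      ennreal ((m + \<bar>K\<bar> + 1) * max r 1 powr - \<beta>') * frostman_const \<alpha> M * ?Y"
    proof (cases "r < 1 \<or> \<beta>' = 0")
      case True
      have "?X \<le>
        emeasure M UNIV * emeasure (surface :: 'a measure) UNIV * ?Y"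
        by (rule extension_trivial[OF fin sM finite_measure_surface sets_surface f fB])
      also have "\<dots> \<le> ennreal ((m + \<bar>K\<bar> + 1) * max r 1 powr - \<beta>') * frostman_const \<alpha> M * ?Y"
      proof (rule mult_right_mono)
        have "emeasure M UNIV * emeasure (surface :: 'a measure) UNIV \<le> frostman_const \<alpha> M * ennreal m"
          using emeasure_UNIV_le_frostman_const[OF M] by (intro mult_mono) (auto simp: m_def surface.emeasure_eq_measure)
        also have "\<dots> \<le> frostman_const \<alpha> M * ennreal ((m + \<bar>K\<bar> + 1) * max r 1 powr - \<beta>')"
          using True by (intro mult_left_mono ennreal_leI) (auto simp: max_def)
        finally show "emeasure M UNIV * emeasure (surface :: 'a measure) UNIV \<le> ennreal ((m + \<bar>K\<bar> + 1) * max r 1 powr - \<beta>') * frostman_const \<alpha> M"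
          by (simp add: mult.commute)
      qed simp
      finally show ?thesis .
    next
      case False
      then have r: "1 \<le> r" and \<beta>: "0 < \<beta>'" "\<beta>' < \<beta>" using \<beta>' by auto
      have \<epsilon>: "0 < \<epsilon>" "\<epsilon> \<le> \<alpha>"
        using decay_exponent_le_dimension[OF C0 moll] \<beta> by (auto simp: \<epsilon>_def)
      have "2 powr - \<epsilon> < (1::real)" using \<epsilon> by (simp add: powr_less_one)
      then have K0: "0 < K" using C0 by (auto simp: K_def)
      \<comment> \<open>The duality argument needs a positive constant.\<close>
      have moll': "mollified_decay_bound TYPE('a) \<alpha> \<beta> (C0 + 1)"
        unfolding mollified_decay_bound_def
      proof (intro ballI allI impI)
        fix N :: "'a measure" and r :: real assume N: "N \<in> unit_ball_measures" and r: "1 \<le> r"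
        have "ennreal (C0 * r powr - \<beta>) \<le> ennreal ((C0 + 1) * r powr - \<beta>)"
          by (intro ennreal_leI mult_right_mono) auto
        then show "(\<integral>\<^sup>+\<omega>. ennreal ((cmod (fourier N (r *\<^sub>R \<omega>)))\<^sup>2) \<partial>surface) \<le>
          ennreal ((C0 + 1) * r powr - \<beta>) * (\<integral>\<^sup>+y. \<integral>\<^sup>+x. ennreal (max (dist x y) (1 / r) powr - \<alpha>) \<partial>N \<partial>N)"
          using moll N r unfolding mollified_decay_bound_def
          by (meson mult_right_mono order_trans zero_le)
      qed
      have "?X \<le>
        ennreal (K * r powr - \<beta>' * c) * ?Y"
      proof (rule extension_restriction_duality[OF fin sM finite_measure_surface sets_surface _ _ f fB])
        show "0 < K * r powr - \<beta>' * c" using K0 r c by simp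
        fix g :: "'a \<Rightarrow> complex" assume g: "g \<in> borel_measurable borel" and "\<exists>B. \<forall>x. cmod (g x) \<le> B"
        then obtain B' where B': "\<And>x. cmod (g x) \<le> B'" by blast
        have "4 * (ennreal ((C0 + 1) * (2 powr \<alpha> / (1 - 2 powr - \<epsilon>)) * r powr (\<epsilon> - \<beta>)) * frostman_const \<alpha> M) = ennreal (K * r powr - \<beta>' * c)"
        proof -
          have "4 * (ennreal ((C0 + 1) * (2 powr \<alpha> / (1 - 2 powr - \<epsilon>)) * r powr (\<epsilon> - \<beta>)) * ennreal c) =
            ennreal (4 * (((C0 + 1) * (2 powr \<alpha> / (1 - 2 powr - \<epsilon>)) * r powr (\<epsilon> - \<beta>)) * c))"
          proof -
            have gen: "4 * (ennreal a * ennreal c) = ennreal (4 * (a * c))" if "0 \<le> a" for a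
              using that c by (simp add: ennreal_mult)
            show ?thesis by (rule gen) (use C0 \<open>2 powr - \<epsilon> < 1\<close> in simp)
          qed
          also have "4 * (((C0 + 1) * (2 powr \<alpha> / (1 - 2 powr - \<epsilon>)) * r powr (\<epsilon> - \<beta>)) * c) = K * r powr - \<beta>' * c"
          proof -
            have e: "\<epsilon> - \<beta> = - \<beta>'" by (simp add: \<epsilon>_def)
            show ?thesis unfolding e K_def by (simp only: mult_ac)
          qed
          finally show ?thesis unfolding c .
        qed
        with restriction_complex[OF _ moll' M \<epsilon> r g B'] C0
        show "(\<integral>\<^sup>+\<omega>. ennreal ((cmod (LINT x|M. g x * cis2pi (- (x \<bullet> (r *\<^sub>R \<omega>)))))\<^sup>2) \<partial>surface) \<le>
          ennreal (K * r powr - \<beta>' * c) * (\<integral>\<^sup>+x. ennreal ((cmod (g x))\<^sup>2) \<partial>M)" by simp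
      qed
      also have "\<dots> \<le> ennreal ((m + \<bar>K\<bar> + 1) * max r 1 powr - \<beta>' * c) * ?Y"
        using r m0 c by (intro mult_right_mono ennreal_leI) (auto simp: max_def)
      also have "ennreal ((m + \<bar>K\<bar> + 1) * max r 1 powr - \<beta>' * c) = ennreal ((m + \<bar>K\<bar> + 1) * max r 1 powr - \<beta>') * frostman_const \<alpha> M"
        unfolding c using m0 c by (intro ennreal_mult) auto
      finally show ?thesis .
    qed
  qed
qed

section \<open>Points close to the pin\<close>

text \<open>
If \<open>x\<close> is within \<open>\<rho>\<close> of both \<open>y\<close> and \<open>z\<close>, then \<open>y\<close> and \<open>z\<close> are within \<open>2\<rho>\<close> of each other and \<open>x\<close> is in the ball around
\<open>y\<close>: integrating over \<open>x\<close> first gives the Frostman constant, over \<open>y\<close> and \<open>z\<close> the energy.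
\<close>

lemma nn_integral_ball_mass_square:
  fixes \<mu> \<nu> :: "'a::euclidean_space measure"
  assumes \<mu>: "finite_measure \<mu>" and s\<mu> [measurable_cong]: "sets \<mu> = sets borel"
    and \<nu>: "finite_measure \<nu>" and s\<nu> [measurable_cong]: "sets \<nu> = sets borel"
    and \<gamma>: "0 \<le> \<gamma>" and \<rho>: "0 < \<rho>"
  shows "(\<integral>\<^sup>+x. (\<integral>\<^sup>+y. indicator {..\<rho>} (dist y x) \<partial>\<nu>)\<^sup>2 \<partial>\<mu>) \<le>
    ennreal (\<rho> powr \<alpha> * (2 * \<rho>) powr \<gamma>) * (frostman_const \<alpha> \<mu> * energy \<gamma> \<nu>)"
proof -
  interpret \<mu>: finite_measure \<mu> by fact
  interpret \<nu>: finite_measure \<nu> by fact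
  interpret P: pair_sigma_finite \<mu> \<nu> ..
  let ?b = "\<lambda>y x::'a. indicator {..\<rho>} (dist y x) :: ennreal"
  have "(\<integral>\<^sup>+x. (\<integral>\<^sup>+y. ?b y x \<partial>\<nu>)\<^sup>2 \<partial>\<mu>) = (\<integral>\<^sup>+x. \<integral>\<^sup>+y. \<integral>\<^sup>+z. ?b y x * ?b z x \<partial>\<nu> \<partial>\<nu> \<partial>\<mu>)"
    by (simp add: power2_eq_square nn_integral_cmult nn_integral_multc)
  also have "\<dots> = (\<integral>\<^sup>+y. \<integral>\<^sup>+x. \<integral>\<^sup>+z. ?b y x * ?b z x \<partial>\<nu> \<partial>\<mu> \<partial>\<nu>)"
    by (rule P.Fubini'[symmetric]) measurable
  also have "\<dots> = (\<integral>\<^sup>+y. \<integral>\<^sup>+z. \<integral>\<^sup>+x. ?b y x * ?b z x \<partial>\<mu> \<partial>\<nu> \<partial>\<nu>)"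
    by (intro nn_integral_cong, rule P.Fubini'[symmetric]) measurable
  also have "\<dots> \<le> (\<integral>\<^sup>+y. \<integral>\<^sup>+z. (ennreal ((2 * \<rho>) powr \<gamma>) * riesz_kernel \<gamma> (dist z y)) * (frostman_const \<alpha> \<mu> * ennreal (\<rho> powr \<alpha>)) \<partial>\<nu> \<partial>\<nu>)"
  proof (intro nn_integral_mono)
    fix y z :: 'a
    have "(\<integral>\<^sup>+x. ?b y x * ?b z x \<partial>\<mu>) \<le> (\<integral>\<^sup>+x. indicator {..2 * \<rho>} (dist z y) * indicator (cball y \<rho>) x \<partial>\<mu>)"
    proof (rule nn_integral_mono)
      fix x
      have "dist z y \<le> dist z x + dist y x" by (metis dist_commute dist_triangle)
      then show "?b y x * ?b z x \<le> indicator {..2 * \<rho>} (dist z y) * indicator (cball y \<rho>) x"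
        by (auto split: split_indicator)
    qed
    also have "\<dots> = indicator {..2 * \<rho>} (dist z y) * emeasure \<mu> (cball y \<rho>)"
      by (subst nn_integral_cmult) (auto simp: s\<mu>)
    also have "\<dots> \<le> (ennreal ((2 * \<rho>) powr \<gamma>) * riesz_kernel \<gamma> (dist z y)) * (frostman_const \<alpha> \<mu> * ennreal (\<rho> powr \<alpha>))"
    proof (intro mult_mono emeasure_cball_le_frostman_const \<rho>)
      show "indicator {..2 * \<rho>} (dist z y) \<le> ennreal ((2 * \<rho>) powr \<gamma>) * riesz_kernel \<gamma> (dist z y)"
      proof (cases "dist z y \<le> 2 * \<rho>")
        case True
        have "(1 :: ennreal) = ennreal ((2 * \<rho>) powr \<gamma>) * riesz_kernel \<gamma> (2 * \<rho>)"
          using \<rho> by (simp add: riesz_kernel_pos ennreal_mult[symmetric] powr_add[symmetric])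
        also have "\<dots> \<le> ennreal ((2 * \<rho>) powr \<gamma>) * riesz_kernel \<gamma> (dist z y)"
          using True \<gamma> by (intro mult_left_mono riesz_kernel_mono) auto
        finally show ?thesis using True by simp
      qed simp
    qed auto
    finally show "(\<integral>\<^sup>+x. ?b y x * ?b z x \<partial>\<mu>) \<le> (ennreal ((2 * \<rho>) powr \<gamma>) * riesz_kernel \<gamma> (dist z y)) * (frostman_const \<alpha> \<mu> * ennreal (\<rho> powr \<alpha>))" .
  qed
  also have "\<dots> = ennreal ((2 * \<rho>) powr \<gamma>) * energy \<gamma> \<nu> * (frostman_const \<alpha> \<mu> * ennreal (\<rho> powr \<alpha>))"
    unfolding energy_def by (simp add: nn_integral_cmult nn_integral_multc)
  also have "\<dots> = ennreal (\<rho> powr \<alpha> * (2 * \<rho>) powr \<gamma>) * (frostman_const \<alpha> \<mu> * energy \<gamma> \<nu>)"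
    by (simp add: ennreal_mult mult_ac)
  finally show ?thesis .
qed

lemma Cauchy_Schwarz_suminf_ennreal:
  fixes f g :: "nat \<Rightarrow> ennreal"
  shows "(\<Sum>k. f k * g k)\<^sup>2 \<le> (\<Sum>k. (f k)\<^sup>2) * (\<Sum>k. (g k)\<^sup>2)"
  using Cauchy_Schwarz_nn_integral[of f "count_space UNIV" g] by (simp add: nn_integral_count_space_nat)

text \<open>
Decompose the weight dyadically into balls of radius \<open>\<rho> / 2\<^sup>k\<close>. The contribution of the \<open>k\<close>-th ball has a
squared norm of order \<open>(\<rho> / 2\<^sup>k)\<^sup>\<eta>\<close> in \<open>L\<^sup>2(\<mu>)\<close>. Cauchy-Schwarz with weights \<open>q\<^sup>k = 2\<^sup>-\<^sup>k\<^sup>\<eta>\<^sup>/\<^sup>2\<close> spends half of this decay on summing over \<open>k\<close>.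
\<close>

lemma near_part_estimate:
  assumes \<gamma>: "0 \<le> \<gamma>" and \<eta>: "0 < \<alpha> + \<gamma> - (real DIM('a::euclidean_space) - 1)"
  defines "s \<equiv> (real DIM('a) - 1) / 2" and "\<eta> \<equiv> \<alpha> + \<gamma> - (real DIM('a) - 1)"
  obtains C where "0 \<le> C"
    "\<And>(\<mu> :: 'a measure) \<nu> \<rho>. \<mu> \<in> unit_ball_measures \<Longrightarrow> \<nu> \<in> unit_ball_measures \<Longrightarrow> 0 < \<rho> \<Longrightarrow>
      (\<integral>\<^sup>+x. (\<integral>\<^sup>+y. riesz_kernel s (dist y x) * indicator {..\<rho>} (dist y x) \<partial>\<nu>)\<^sup>2 \<partial>\<mu>) \<le>
      ennreal (C * \<rho> powr \<eta>) * (frostman_const \<alpha> \<mu> * energy \<gamma> \<nu>)"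
proof -
  have \<eta>0: "0 < \<eta>" using \<eta> by (simp add: \<eta>_def)
  have s0: "0 \<le> s" using DIM_positive[where 'a='a] unfolding s_def by (simp add: Suc_le_eq)
  define q where "q = (2::real) powr (- \<eta> / 2)"
  have q: "0 < q" "0 \<le> q" "q < 1" using \<eta>0 by (auto simp: q_def powr_less_one)
  define A where "A = 2 powr (2 * s + \<gamma>)"
  show thesis
  proof
    show "0 \<le> 1 / (1 - q) * (A / (1 - q))" using q by (simp add: A_def)
    fix \<mu> \<nu> :: "'a measure" and \<rho> :: real
    assume \<mu>: "\<mu> \<in> unit_ball_measures" and \<nu>: "\<nu> \<in> unit_ball_measures" and \<rho>: "0 < \<rho>"
    have s\<mu> [measurable_cong]: "sets \<mu> = sets borel" and f\<mu>: "finite_measure \<mu>" using \<mu> by (auto simp: unit_ball_measures_iff)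
    have s\<nu> [measurable_cong]: "sets \<nu> = sets borel" and f\<nu>: "finite_measure \<nu>" using \<nu> by (auto simp: unit_ball_measures_iff)
    interpret \<mu>: finite_measure \<mu> by fact
    interpret \<nu>: finite_measure \<nu> by fact
    let ?cI = "frostman_const \<alpha> \<mu> * energy \<gamma> \<nu>"
    let ?A = "\<lambda>x. \<integral>\<^sup>+y. riesz_kernel s (dist y x) * indicator {..\<rho>} (dist y x) \<partial>\<nu>"
    define b where "b k = (\<rho> / 2 ^ Suc k) powr - s" for k :: nat
    define m where "m k x = (\<integral>\<^sup>+y. indicator {..\<rho> / 2 ^ k} (dist y x) \<partial>\<nu>)" for k :: nat and x :: 'a
    have [measurable]: "m k \<in> borel_measurable borel" for k unfolding m_def by measurable
    define e where "e k = sqrt (q ^ k)" for k :: nat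
    have e: "0 < e k" "(e k)\<^sup>2 = q ^ k" for k using q by (auto simp: e_def)
    have pt: "(?A x)\<^sup>2 \<le>
      ennreal (1 / (1 - q)) * (\<Sum>k. ennreal ((b k)\<^sup>2 / q ^ k) * (m k x)\<^sup>2)" for x
    proof -
      have "(?A x) \<le>
        (\<integral>\<^sup>+y. (\<Sum>k. ennreal (b k) * indicator {..\<rho> / 2 ^ k} (dist y x)) \<partial>\<nu>)"
      proof (rule nn_integral_mono)
        fix y
        show "riesz_kernel s (dist y x) * indicator {..\<rho>} (dist y x) \<le> (\<Sum>k. ennreal (b k) * indicator {..\<rho> / 2 ^ k} (dist y x))"
          using riesz_kernel_le_dyadic_sum[OF s0 zero_le_dist _ \<rho>, of y x]
          by (auto simp: b_def split: split_indicator)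
      qed
      also have "\<dots> = (\<Sum>k. ennreal (b k) * m k x)"
        unfolding m_def by (simp add: nn_integral_suminf nn_integral_cmult)
      also have "\<dots> = (\<Sum>k. ennreal (e k) * (ennreal (b k / e k) * m k x))"
        using e(1) by (intro suminf_cong) (simp add: mult.assoc[symmetric] ennreal_mult[symmetric] b_def less_imp_le less_imp_neq[symmetric])
      finally have "(?A x)\<^sup>2 \<le> (\<Sum>k. ennreal (e k) * (ennreal (b k / e k) * m k x))\<^sup>2"
        by (rule power_mono) simp
      also have "\<dots> \<le> (\<Sum>k. (ennreal (e k))\<^sup>2) * (\<Sum>k. (ennreal (b k / e k) * m k x)\<^sup>2)"
        by (rule Cauchy_Schwarz_suminf_ennreal)
      also have "(\<Sum>k. (ennreal (e k))\<^sup>2) = (\<Sum>k. ennreal (1 * q ^ k))"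
        using e by (simp add: ennreal_power less_imp_le del: suminf_ennreal2)
      also have "\<dots> = ennreal (1 / (1 - q))" by (rule suminf_geometric_ennreal) (use q in auto)
      also have "(\<Sum>k. (ennreal (b k / e k) * m k x)\<^sup>2) = (\<Sum>k. ennreal ((b k)\<^sup>2 / q ^ k) * (m k x)\<^sup>2)"
      proof (rule suminf_cong)
        fix k
        have "(ennreal (b k / e k) * m k x)\<^sup>2 = (ennreal (b k / e k))\<^sup>2 * (m k x)\<^sup>2" by (rule power_mult_distrib)
        also have "(ennreal (b k / e k))\<^sup>2 = ennreal ((b k / e k)\<^sup>2)"
          using e(1)[of k] by (subst ennreal_power) (auto simp: b_def)
        also have "(b k / e k)\<^sup>2 = (b k)\<^sup>2 / q ^ k" by (simp add: power_divide e)
        finally show "(ennreal (b k / e k) * m k x)\<^sup>2 = ennreal ((b k)\<^sup>2 / q ^ k) * (m k x)\<^sup>2" .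
      qed
      finally show ?thesis .
    qed
    have "(\<integral>\<^sup>+x. (?A x)\<^sup>2 \<partial>\<mu>) \<le>
      (\<integral>\<^sup>+x. ennreal (1 / (1 - q)) * (\<Sum>k. ennreal ((b k)\<^sup>2 / q ^ k) * (m k x)\<^sup>2) \<partial>\<mu>)"
      by (intro nn_integral_mono pt)
    also have "\<dots> = ennreal (1 / (1 - q)) * (\<Sum>k. ennreal ((b k)\<^sup>2 / q ^ k) * (\<integral>\<^sup>+x. (m k x)\<^sup>2 \<partial>\<mu>))"
      by (simp add: nn_integral_suminf nn_integral_cmult)
    also have "\<dots> \<le> ennreal (1 / (1 - q)) * (\<Sum>k. ennreal ((A * \<rho> powr \<eta>) * q ^ k) * ?cI)"
    proof (intro mult_left_mono suminf_le)
      fix k :: nat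
      have r: "0 < \<rho> / 2 ^ k" using \<rho> by simp
      have "ennreal ((b k)\<^sup>2 / q ^ k) * (\<integral>\<^sup>+x. (m k x)\<^sup>2 \<partial>\<mu>) \<le>
        ennreal ((b k)\<^sup>2 / q ^ k) * (ennreal ((\<rho> / 2 ^ k) powr \<alpha> * (2 * (\<rho> / 2 ^ k)) powr \<gamma>) * ?cI)"
        unfolding m_def by (intro mult_left_mono nn_integral_ball_mass_square f\<mu> s\<mu> f\<nu> s\<nu> \<gamma> r) auto
      also have "\<dots> = ennreal ((b k)\<^sup>2 / q ^ k * ((\<rho> / 2 ^ k) powr \<alpha> * (2 * (\<rho> / 2 ^ k)) powr \<gamma>)) * ?cI"
        using q by (subst ennreal_mult) (auto simp: mult.assoc)
      also have "(b k)\<^sup>2 / q ^ k * ((\<rho> / 2 ^ k) powr \<alpha> * (2 * (\<rho> / 2 ^ k)) powr \<gamma>) = (A * \<rho> powr \<eta>) * q ^ k"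
      proof -
        define d where "d = \<rho> / 2 ^ k"
        have d: "0 < d" using r by (simp add: d_def)
        have "(b k)\<^sup>2 = (d / 2) powr (- 2 * s)"
        proof -
          have "b k = (d / 2) powr - s" by (simp add: b_def d_def mult.commute)
          then show ?thesis by (simp add: power2_eq_square powr_add[symmetric])
        qed
        also have "\<dots> = d powr (- 2 * s) * 2 powr (2 * s)"
          using d by (simp add: powr_divide powr_minus_divide)
        finally have b2: "(b k)\<^sup>2 = d powr (- 2 * s) * 2 powr (2 * s)" .
        have "(b k)\<^sup>2 * (d powr \<alpha> * (2 * d) powr \<gamma>) = (2 powr (2 * s) * 2 powr \<gamma>) * (d powr (- 2 * s) * d powr \<alpha> * d powr \<gamma>)"
          using d unfolding b2 by (simp add: powr_mult mult_ac)
        also have "2 powr (2 * s) * 2 powr \<gamma> = A" by (simp add: A_def powr_add)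
        also have "d powr (- 2 * s) * d powr \<alpha> * d powr \<gamma> = d powr \<eta>"
        proof -
          have "- 2 * s + \<alpha> + \<gamma> = \<eta>" by (simp add: \<eta>_def s_def field_simps)
          then show ?thesis by (simp only: powr_add[symmetric])
        qed
        also have "d powr \<eta> = \<rho> powr \<eta> * (q ^ k * q ^ k)"
        proof -
          have "q ^ k * q ^ k = 2 powr (- (real k * \<eta>))"
            unfolding q_def by (simp add: powr_realpow[symmetric] powr_powr powr_add[symmetric] field_simps)
          moreover have "d powr \<eta> = \<rho> powr \<eta> * 2 powr (- (real k * \<eta>))"
            unfolding d_def using \<rho> by (simp add: powr_divide powr_minus_divide powr_realpow[symmetric] powr_powr)
          ultimately show ?thesis by simp
        qed
        finally have "(b k)\<^sup>2 * (d powr \<alpha> * (2 * d) powr \<gamma>) = A * (\<rho> powr \<eta> * (q ^ k * q ^ k))" .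
        then show ?thesis unfolding d_def[symmetric] using q by (simp add: field_simps)
      qed
      finally show "ennreal ((b k)\<^sup>2 / q ^ k) * (\<integral>\<^sup>+x. (m k x)\<^sup>2 \<partial>\<mu>) \<le> ennreal ((A * \<rho> powr \<eta>) * q ^ k) * ?cI" .
    qed auto
    also have "(\<Sum>k. ennreal ((A * \<rho> powr \<eta>) * q ^ k) * ?cI) = ennreal ((A * \<rho> powr \<eta>) / (1 - q)) * ?cI"
      unfolding ennreal_suminf_multc by (subst suminf_geometric_ennreal) (use q in \<open>auto simp: A_def\<close>)
    also have "ennreal (1 / (1 - q)) * (ennreal ((A * \<rho> powr \<eta>) / (1 - q)) * ?cI) = ennreal (1 / (1 - q) * (A / (1 - q)) * \<rho> powr \<eta>) * ?cI"
      using q by (simp add: mult.assoc[symmetric] ennreal_mult[symmetric] A_def)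
    finally show "(\<integral>\<^sup>+x. (?A x)\<^sup>2 \<partial>\<mu>) \<le>
      ennreal (1 / (1 - q) * (A / (1 - q)) * \<rho> powr \<eta>) * ?cI" .
  qed
qed

section \<open>Two distances that agree up to a given scale\<close>

text \<open>
Take the \<open>k\<close> with \<open>2\<^sup>k \<le> max d 1 < 2\<^sup>k\<^sup>+\<^sup>1\<close> if there is one below \<open>j\<close>, and \<open>k = j\<close> otherwise. In the first case the
exponential on the right is at least \<open>exp (-4\<pi>)\<close>.
\<close>

lemma weighted_gaussian_le_sum:
  fixes d :: real
  assumes d: "0 \<le> d" and \<beta>: "0 \<le> \<beta>"
  shows "max d 1 powr - \<beta> * exp (- pi * d\<^sup>2 / (2 ^ j)\<^sup>2) \<le>
    exp (4 * pi) * (\<Sum>k\<le>j. 2 powr (- (real k * \<beta>)) * exp (- pi * d\<^sup>2 / (2 ^ k)\<^sup>2))"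
proof -
  define m where "m = max d 1"
  have m1: "1 \<le> m" and dm: "d \<le> m" by (auto simp: m_def)
  have "\<exists>k\<le>j. m powr - \<beta> * exp (- pi * d\<^sup>2 / (2 ^ j)\<^sup>2) \<le> exp (4 * pi) * (2 powr (- (real k * \<beta>)) * exp (- pi * d\<^sup>2 / (2 ^ k)\<^sup>2))"
  proof -
    have le: "m powr - \<beta> \<le> 2 powr (- (real k * \<beta>))" if "2 ^ k \<le> m" for k
    proof -
      have "m powr - \<beta> \<le> (2 ^ k) powr - \<beta>" using that \<beta> by (intro powr_mono2') auto
      also have "\<dots> = (2 powr real k) powr - \<beta>" by (simp add: powr_realpow)
      also have "\<dots> = 2 powr (- (real k * \<beta>))" unfolding powr_powr by simp
      finally show ?thesis .
    qed
    show ?thesis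
    proof (cases "2 ^ j \<le> m")
      case True
      have "m powr - \<beta> * exp (- pi * d\<^sup>2 / (2 ^ j)\<^sup>2) \<le> 1 * (2 powr (- (real j * \<beta>)) * exp (- pi * d\<^sup>2 / (2 ^ j)\<^sup>2))"
        using le[OF True] by simp
      also have "\<dots> \<le> exp (4 * pi) * (2 powr (- (real j * \<beta>)) * exp (- pi * d\<^sup>2 / (2 ^ j)\<^sup>2))"
        by (intro mult_right_mono) auto
      finally show ?thesis by blast
    next
      case False
      define k where "k = (LEAST k. m < 2 ^ Suc k)"
      have "m < 2 ^ j" using False by simp
      also have "(2::real) ^ j < 2 ^ Suc j" by simp
      finally have "m < 2 ^ Suc j" .
      then have k1: "m < 2 ^ Suc k" and kj: "k \<le> j" unfolding k_def by (rule LeastI, rule Least_le)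
      have k2: "2 ^ k \<le> m"
      proof (cases k)
        case 0 then show ?thesis using m1 by simp
      next
        case (Suc i)
        then have "\<not> m < 2 ^ Suc i" using not_less_Least[of i "\<lambda>k. m < 2 ^ Suc k"] unfolding k_def by simp
        then show ?thesis using Suc by simp
      qed
      have "d\<^sup>2 \<le> (2 ^ Suc k)\<^sup>2" using d dm k1 by (intro power_mono) auto
      then have "d\<^sup>2 / (2 ^ k)\<^sup>2 \<le> 4" by (simp add: power_mult_distrib divide_le_eq)
      then have "pi * (d\<^sup>2 / (2 ^ k)\<^sup>2) \<le> pi * 4" by (intro mult_left_mono) auto
      then have "1 \<le> exp (4 * pi) * exp (- pi * d\<^sup>2 / (2 ^ k)\<^sup>2)"
        unfolding exp_add[symmetric] by simp
      then have "m powr - \<beta> * 1 \<le> 2 powr (- (real k * \<beta>)) * (exp (4 * pi) * exp (- pi * d\<^sup>2 / (2 ^ k)\<^sup>2))"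
        using le[OF k2] by (intro mult_mono) auto
      moreover have "m powr - \<beta> * exp (- pi * d\<^sup>2 / (2 ^ j)\<^sup>2) \<le> m powr - \<beta> * 1"
        by (intro mult_left_mono) auto
      ultimately have "m powr - \<beta> * exp (- pi * d\<^sup>2 / (2 ^ j)\<^sup>2) \<le> exp (4 * pi) * (2 powr (- (real k * \<beta>)) * exp (- pi * d\<^sup>2 / (2 ^ k)\<^sup>2))"
        by (simp only: mult_ac)
      then show ?thesis using kj by blast
    qed
  qed
  then obtain k where k: "k \<le> j" "m powr - \<beta> * exp (- pi * d\<^sup>2 / (2 ^ j)\<^sup>2) \<le> exp (4 * pi) * (2 powr (- (real k * \<beta>)) * exp (- pi * d\<^sup>2 / (2 ^ k)\<^sup>2))"
    by blast
  note k(2)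
  also have "exp (4 * pi) * (2 powr (- (real k * \<beta>)) * exp (- pi * d\<^sup>2 / (2 ^ k)\<^sup>2)) \<le>
    exp (4 * pi) * (\<Sum>k\<le>j. 2 powr (- (real k * \<beta>)) * exp (- pi * d\<^sup>2 / (2 ^ k)\<^sup>2))"
    using k(1) by (intro mult_left_mono member_le_sum) auto
  finally show ?thesis unfolding m_def .
qed

lemma weighted_gaussian_fourier_le_energy:
  fixes \<nu> :: "'a::euclidean_space measure"
  assumes s [measurable_cong]: "sets \<nu> = sets borel" and fin: "finite_measure \<nu>"
    and \<gamma>: "0 \<le> \<gamma>" "\<gamma> \<le> real DIM('a)" and \<beta>: "0 \<le> \<beta>" and \<theta>: "0 \<le> real DIM('a) - \<gamma> - \<beta>"
  shows "(\<integral>\<^sup>+\<xi>. ennreal (max (norm \<xi>) 1 powr - \<beta> * exp (- pi * (norm \<xi>)\<^sup>2 / (2 ^ j)\<^sup>2) * (cmod (fourier \<nu> \<xi>))\<^sup>2) \<partial>lborel)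
    \<le> ennreal (exp (4 * pi) * fact DIM('a) * (real (Suc j) * 2 powr (real j * (real DIM('a) - \<gamma> - \<beta>)))) * energy \<gamma> \<nu>"
proof -
  note [measurable] = borel_measurable_fourier[OF s fin]
  let ?\<theta> = "real DIM('a) - \<gamma> - \<beta>"
  let ?H = "\<lambda>\<xi>. max (norm \<xi>) 1 powr - \<beta> * exp (- pi * (norm \<xi>)\<^sup>2 / (2 ^ j)\<^sup>2) * (cmod (fourier \<nu> \<xi>))\<^sup>2"
  let ?F = "\<lambda>k \<xi>. exp (- pi * (norm \<xi>)\<^sup>2 / (2 ^ k)\<^sup>2) * (cmod (fourier \<nu> \<xi>))\<^sup>2"
  have "(\<integral>\<^sup>+\<xi>. ennreal (?H \<xi>) \<partial>lborel)
    \<le> (\<integral>\<^sup>+\<xi>. ennreal (exp (4 * pi)) * (\<Sum>k\<le>j. ennreal (2 powr (- (real k * \<beta>))) * ennreal (?F k \<xi>)) \<partial>lborel)"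
  proof (rule nn_integral_mono)
    fix \<xi> :: 'a
    have "?H \<xi> \<le>
      exp (4 * pi) * (\<Sum>k\<le>j. 2 powr (- (real k * \<beta>)) * exp (- pi * (norm \<xi>)\<^sup>2 / (2 ^ k)\<^sup>2)) * (cmod (fourier \<nu> \<xi>))\<^sup>2"
      by (intro mult_right_mono weighted_gaussian_le_sum \<beta>) auto
    also have "\<dots> = exp (4 * pi) * (\<Sum>k\<le>j. 2 powr (- (real k * \<beta>)) * ?F k \<xi>)"
      by (simp add: sum_distrib_right mult.assoc)
    finally have "ennreal (?H \<xi>) \<le>
      ennreal (exp (4 * pi) * (\<Sum>k\<le>j. 2 powr (- (real k * \<beta>)) * ?F k \<xi>))"
      by (rule ennreal_leI)
    also have "\<dots> = ennreal (exp (4 * pi)) * (\<Sum>k\<le>j. ennreal (2 powr (- (real k * \<beta>))) * ennreal (?F k \<xi>))"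
      by (subst ennreal_mult) (auto simp: sum_nonneg sum_ennreal[symmetric] ennreal_mult intro!: sum_nonneg)
    finally show "ennreal (?H \<xi>) \<le>
      ennreal (exp (4 * pi)) * (\<Sum>k\<le>j. ennreal (2 powr (- (real k * \<beta>))) * ennreal (?F k \<xi>))" .
  qed
  also have "\<dots> = ennreal (exp (4 * pi)) * (\<Sum>k\<le>j. ennreal (2 powr (- (real k * \<beta>))) * (\<integral>\<^sup>+\<xi>. ennreal (?F k \<xi>) \<partial>lborel))"
    by (simp add: nn_integral_cmult nn_integral_sum)
  also have "\<dots> \<le> ennreal (exp (4 * pi)) * (\<Sum>k\<le>j. ennreal (fact DIM('a) * 2 powr (real j * ?\<theta>)) * energy \<gamma> \<nu>)"
  proof (intro mult_left_mono sum_mono)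
    fix k assume k: "k \<in> {..j}"
    have "ennreal (2 powr (- (real k * \<beta>))) * (\<integral>\<^sup>+\<xi>. ennreal (?F k \<xi>) \<partial>lborel) \<le>
      ennreal (2 powr (- (real k * \<beta>))) * (ennreal (fact DIM('a) * (2 ^ k) powr (real DIM('a) - \<gamma>)) * energy \<gamma> \<nu>)"
      by (intro mult_left_mono gaussian_fourier_le_energy s fin \<gamma>) auto
    also have "\<dots> = ennreal (2 powr (- (real k * \<beta>)) * (fact DIM('a) * (2 ^ k) powr (real DIM('a) - \<gamma>))) * energy \<gamma> \<nu>"
      by (simp add: ennreal_mult mult.assoc)
    also have "\<dots> \<le> ennreal (fact DIM('a) * 2 powr (real j * ?\<theta>)) * energy \<gamma> \<nu>"
    proof (intro mult_right_mono ennreal_leI)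
      have "(2 ^ k :: real) powr (real DIM('a) - \<gamma>) = (2 powr real k) powr (real DIM('a) - \<gamma>)" by (simp add: powr_realpow)
      also have "\<dots> = 2 powr (real k * (real DIM('a) - \<gamma>))" by (rule powr_powr)
      finally have "2 powr (- (real k * \<beta>)) * (fact DIM('a) * (2 ^ k) powr (real DIM('a) - \<gamma>)) =
        fact DIM('a) * (2 powr (- (real k * \<beta>)) * 2 powr (real k * (real DIM('a) - \<gamma>)))" by simp
      also have "2 powr (- (real k * \<beta>)) * 2 powr (real k * (real DIM('a) - \<gamma>)) = 2 powr (real k * ?\<theta>)"
        by (simp add: powr_add[symmetric] algebra_simps)
      also have "(fact DIM('a) :: real) * 2 powr (real k * ?\<theta>) \<le> fact DIM('a) * 2 powr (real j * ?\<theta>)"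
        using k \<theta> by (intro mult_left_mono powr_mono mult_right_mono) auto
      finally show "2 powr (- (real k * \<beta>)) * (fact DIM('a) * (2 ^ k) powr (real DIM('a) - \<gamma>)) \<le> fact DIM('a) * 2 powr (real j * ?\<theta>)" .
    qed simp
    finally show "ennreal (2 powr (- (real k * \<beta>))) * (\<integral>\<^sup>+\<xi>. ennreal (?F k \<xi>) \<partial>lborel) \<le>
      ennreal (fact DIM('a) * 2 powr (real j * ?\<theta>)) * energy \<gamma> \<nu>" .
  qed simp
  also have "\<dots> = ennreal (exp (4 * pi) * fact DIM('a) * (real (Suc j) * 2 powr (real j * ?\<theta>))) * energy \<gamma> \<nu>"
  proof -
    have "(\<Sum>k\<le>j. ennreal (fact DIM('a) * 2 powr (real j * ?\<theta>)) * energy \<gamma> \<nu>) =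
      ennreal (real (Suc j)) * (ennreal (fact DIM('a) * 2 powr (real j * ?\<theta>)) * energy \<gamma> \<nu>)"
      by (simp add: ennreal_of_nat_eq_real_of_nat[symmetric] del: of_nat_Suc)
    then have "ennreal (exp (4 * pi)) * (\<Sum>k\<le>j. ennreal (fact DIM('a) * 2 powr (real j * ?\<theta>)) * energy \<gamma> \<nu>) =
      (ennreal (exp (4 * pi)) * ennreal (real (Suc j)) * ennreal (fact DIM('a) * 2 powr (real j * ?\<theta>))) * energy \<gamma> \<nu>"
      by (simp only: mult.assoc)
    also have "ennreal (exp (4 * pi)) * ennreal (real (Suc j)) * ennreal (fact DIM('a) * 2 powr (real j * ?\<theta>)) =
      ennreal (exp (4 * pi) * real (Suc j) * (fact DIM('a) * 2 powr (real j * ?\<theta>)))"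
      by (simp add: ennreal_mult[symmetric] del: of_nat_Suc)
    also have "exp (4 * pi) * real (Suc j) * (fact DIM('a) * 2 powr (real j * ?\<theta>)) =
      exp (4 * pi) * fact DIM('a) * (real (Suc j) * 2 powr (real j * ?\<theta>))"
      by (simp only: mult_ac)
    finally show ?thesis .
  qed
  finally show ?thesis .
qed

text \<open>
The identity for spherical averages, the extension estimate for each radius, and polar coordinates
backwards.
\<close>

lemma spherical_gaussian_average_estimate:
  assumes C0: "0 \<le> C0" and moll: "mollified_decay_bound TYPE('a::euclidean_space) \<alpha> \<beta> C0"
    and \<beta>': "0 \<le> \<beta>'" "\<beta>' = 0 \<or> \<beta>' < \<beta>"
    and \<gamma>: "0 \<le> \<gamma>" "\<gamma> \<le> real DIM('a)" and \<theta>: "0 \<le> real DIM('a) - \<gamma> - \<beta>'"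
  obtains C where "0 \<le> C"
    "\<And>(\<mu> :: 'a measure) \<nu> j. \<mu> \<in> unit_ball_measures \<Longrightarrow> \<nu> \<in> unit_ball_measures \<Longrightarrow>
      0 < frostman_const \<alpha> \<mu> \<Longrightarrow> frostman_const \<alpha> \<mu> < \<infinity> \<Longrightarrow>
      (\<integral>\<^sup>+x. \<integral>\<^sup>+y. \<integral>\<^sup>+z. \<integral>\<^sup>+\<omega>. ennreal ((2 ^ j) ^ DIM('a) *
          exp (- pi * (2 ^ j)\<^sup>2 * (norm (norm (z - x) *\<^sub>R \<omega> - (y - x)))\<^sup>2)) \<partial>surface \<partial>\<nu> \<partial>\<nu> \<partial>\<mu>) \<le>
      ennreal (C * (real (Suc j) * 2 powr (real j * (real DIM('a) - \<gamma> - \<beta>')))) * (frostman_const \<alpha> \<mu> * energy \<gamma> \<nu>)"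
proof -
  obtain C where C: "0 < C"
    "\<And>(M :: 'a measure) f r B. M \<in> unit_ball_measures \<Longrightarrow> 0 < frostman_const \<alpha> M \<Longrightarrow> frostman_const \<alpha> M < \<infinity> \<Longrightarrow>
      f \<in> borel_measurable borel \<Longrightarrow> (\<And>x. cmod (f x) \<le> B) \<Longrightarrow>
      (\<integral>\<^sup>+x. ennreal ((cmod (LINT \<omega>|surface. cis2pi (r * (x \<bullet> \<omega>)) * f \<omega>))\<^sup>2) \<partial>M) \<le>
      ennreal (C * max r 1 powr - \<beta>') * frostman_const \<alpha> M * (\<integral>\<^sup>+\<omega>. ennreal ((cmod (f \<omega>))\<^sup>2) \<partial>surface)"
    by (rule extension_estimate[OF C0 moll \<beta>']) blast
  define A where "A = exp (4 * pi) * fact DIM('a)"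
  show thesis
  proof
    show "0 \<le> C * A" using C by (simp add: A_def)
    fix \<mu> \<nu> :: "'a measure" and j :: nat
    assume \<mu>: "\<mu> \<in> unit_ball_measures" and \<nu>: "\<nu> \<in> unit_ball_measures"
      and fr: "0 < frostman_const \<alpha> \<mu>" "frostman_const \<alpha> \<mu> < \<infinity>"
    have s\<mu> [measurable_cong]: "sets \<mu> = sets borel" and f\<mu>: "finite_measure \<mu>" using \<mu> by (auto simp: unit_ball_measures_iff)
    have s\<nu> [measurable_cong]: "sets \<nu> = sets borel" and f\<nu>: "finite_measure \<nu>" using \<nu> by (auto simp: unit_ball_measures_iff)
    interpret \<mu>: finite_measure \<mu> by fact
    interpret \<nu>: finite_measure \<nu> by fact
    interpret P: pair_sigma_finite lborel \<mu> ..
    note [measurable] = borel_measurable_fourier[OF s\<nu> f\<nu>]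
    let ?n = "DIM('a)"
    let ?R = "2 ^ j :: real"
    let ?w = "\<lambda>r. indicator {0<..} r * r ^ (?n - 1) * exp (- pi * r\<^sup>2 / ?R\<^sup>2)"
    let ?F = "\<lambda>r x. LINT \<omega>|surface. cis2pi (r * (x \<bullet> \<omega>)) * fourier \<nu> (r *\<^sub>R \<omega>)"
    let ?c = "frostman_const \<alpha> \<mu>"
    let ?S = "\<lambda>r. \<integral>\<^sup>+\<omega>. ennreal ((cmod (fourier \<nu> (r *\<^sub>R \<omega>)))\<^sup>2) \<partial>surface"
    let ?H = "\<lambda>\<xi>::'a. max (norm \<xi>) 1 powr - \<beta>' * exp (- pi * (norm \<xi>)\<^sup>2 / ?R\<^sup>2) * (cmod (fourier \<nu> \<xi>))\<^sup>2"
    have w0: "0 \<le> ?w r" for r by (auto split: split_indicator)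
    have "(\<integral>\<^sup>+x. \<integral>\<^sup>+y. \<integral>\<^sup>+z. \<integral>\<^sup>+\<omega>. ennreal (?R ^ ?n *
          exp (- pi * ?R\<^sup>2 * (norm (norm (z - x) *\<^sub>R \<omega> - (y - x)))\<^sup>2)) \<partial>surface \<partial>\<nu> \<partial>\<nu> \<partial>\<mu>) =
      (\<integral>\<^sup>+x. \<integral>\<^sup>+r. ennreal (?w r * (cmod (?F r x))\<^sup>2) \<partial>lborel \<partial>\<mu>)"
      by (intro nn_integral_cong nn_integral_gaussian_spherical_square[symmetric] s\<nu> f\<nu>) auto
    also have "\<dots> = (\<integral>\<^sup>+r. \<integral>\<^sup>+x. ennreal (?w r * (cmod (?F r x))\<^sup>2) \<partial>\<mu> \<partial>lborel)"
      by (rule P.Fubini') measurable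
    also have "\<dots> = (\<integral>\<^sup>+r. ennreal (?w r) * (\<integral>\<^sup>+x. ennreal ((cmod (?F r x))\<^sup>2) \<partial>\<mu>) \<partial>lborel)"
      using w0 by (intro nn_integral_cong) (subst nn_integral_cmult[symmetric], measurable, simp add: ennreal_mult)
    also have "\<dots> \<le> (\<integral>\<^sup>+r. ennreal (?w r) * (ennreal (C * max r 1 powr - \<beta>') * ?c * ?S r) \<partial>lborel)"
    proof (intro nn_integral_mono mult_left_mono)
      fix r :: real
      show "(\<integral>\<^sup>+x. ennreal ((cmod (?F r x))\<^sup>2) \<partial>\<mu>) \<le> ennreal (C * max r 1 powr - \<beta>') * ?c * ?S r"
        by (rule C(2)[OF \<mu> fr, of _ "measure \<nu> (space \<nu>)"]) (measurable, rule cmod_fourier_le[OF f\<nu>])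
    qed simp
    also have "\<dots> = (\<integral>\<^sup>+r. (ennreal C * ?c) * (indicator {0<..} r * ennreal (r ^ (?n - 1)) *
      (\<integral>\<^sup>+\<omega>. ennreal (?H (r *\<^sub>R \<omega>)) \<partial>surface)) \<partial>lborel)"
    proof (rule nn_integral_cong)
      fix r :: real
      show "ennreal (?w r) * (ennreal (C * max r 1 powr - \<beta>') * ?c * ?S r) =
        (ennreal C * ?c) * (indicator {0<..} r * ennreal (r ^ (?n - 1)) *
        (\<integral>\<^sup>+\<omega>. ennreal (?H (r *\<^sub>R \<omega>)) \<partial>surface))"
      proof (cases "0 < r")
        case True
        have "(\<integral>\<^sup>+\<omega>. ennreal (?H (r *\<^sub>R \<omega>)) \<partial>surface)
          = (\<integral>\<^sup>+\<omega>. ennreal (max r 1 powr - \<beta>' * exp (- pi * r\<^sup>2 / ?R\<^sup>2)) * ennreal ((cmod (fourier \<nu> (r *\<^sub>R \<omega>)))\<^sup>2) \<partial>surface)"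
        proof (rule nn_integral_cong_AE)
          show "AE \<omega> in surface. ennreal (?H (r *\<^sub>R \<omega>))
            = ennreal (max r 1 powr - \<beta>' * exp (- pi * r\<^sup>2 / ?R\<^sup>2)) * ennreal ((cmod (fourier \<nu> (r *\<^sub>R \<omega>)))\<^sup>2)"
            using AE_surface_norm by eventually_elim (use True in \<open>simp add: ennreal_mult\<close>)
        qed
        also have "\<dots> = ennreal (max r 1 powr - \<beta>' * exp (- pi * r\<^sup>2 / ?R\<^sup>2)) * ?S r"
          by (rule nn_integral_cmult) measurable
        finally have 1: "(\<integral>\<^sup>+\<omega>. ennreal (?H (r *\<^sub>R \<omega>)) \<partial>surface)
          = ennreal (max r 1 powr - \<beta>' * exp (- pi * r\<^sup>2 / ?R\<^sup>2)) * ?S r" .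
        have 2: "ennreal (?w r) = ennreal (r ^ (?n - 1)) * ennreal (exp (- pi * r\<^sup>2 / ?R\<^sup>2))"
          using True by (simp add: ennreal_mult)
        have 3: "ennreal (C * max r 1 powr - \<beta>') = ennreal C * ennreal (max r 1 powr - \<beta>')"
          using C(1) by (simp add: ennreal_mult)
        have 4: "ennreal (max r 1 powr - \<beta>' * exp (- pi * r\<^sup>2 / ?R\<^sup>2)) = ennreal (max r 1 powr - \<beta>') * ennreal (exp (- pi * r\<^sup>2 / ?R\<^sup>2))"
          by (rule ennreal_mult) auto
        show ?thesis unfolding 1 2 3 4 using True by (simp add: mult_ac)
      qed simp
    qed
    also have "\<dots> = (ennreal C * ?c) * (\<integral>\<^sup>+r. indicator {0<..} r * ennreal (r ^ (?n - 1)) *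
      (\<integral>\<^sup>+\<omega>. ennreal (?H (r *\<^sub>R \<omega>)) \<partial>surface) \<partial>lborel)"
      by (rule nn_integral_cmult) measurable
    also have "\<dots> = (ennreal C * ?c) * (\<integral>\<^sup>+\<xi>. ennreal (max (norm \<xi>) 1 powr - \<beta>' * exp (- pi * (norm \<xi>)\<^sup>2 / ?R\<^sup>2) * (cmod (fourier \<nu> \<xi>))\<^sup>2) \<partial>lborel)"
      by (rule arg_cong2[where f="(*)", OF HOL.refl nn_integral_polar[symmetric]]) measurable
    also have "\<dots> \<le> (ennreal C * ?c) * (ennreal (A * (real (Suc j) * 2 powr (real j * (real ?n - \<gamma> - \<beta>')))) * energy \<gamma> \<nu>)"
      unfolding A_def by (intro mult_left_mono weighted_gaussian_fourier_le_energy s\<nu> f\<nu> \<gamma> \<beta>' \<theta>) auto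
    also have "\<dots> = ennreal (C * A * (real (Suc j) * 2 powr (real j * (real ?n - \<gamma> - \<beta>')))) * (?c * energy \<gamma> \<nu>)"
    proof -
      have gen: "(ennreal C * c) * (ennreal b * d) = ennreal (C * b) * (c * d)" if "0 \<le> b" for b c d
        using that C(1) by (simp add: ennreal_mult mult_ac)
      show ?thesis by (subst gen) (auto simp: A_def mult.assoc)
    qed
    finally show "(\<integral>\<^sup>+x. \<integral>\<^sup>+y. \<integral>\<^sup>+z. \<integral>\<^sup>+\<omega>. ennreal (?R ^ ?n *
          exp (- pi * ?R\<^sup>2 * (norm (norm (z - x) *\<^sub>R \<omega> - (y - x)))\<^sup>2)) \<partial>surface \<partial>\<nu> \<partial>\<nu> \<partial>\<mu>) \<le>
      ennreal (C * A * (real (Suc j) * 2 powr (real j * (real ?n - \<gamma> - \<beta>')))) * (?c * energy \<gamma> \<nu>)" .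
  qed
qed

text \<open>
Either \<open>z\<close> is within \<open>4 / R\<close> of the pin, and then both points are within \<open>6 / R\<close>, or the two distances are
comparable and the averaged Gaussian dominates the weights.
\<close>

lemma weighted_pair_le:
  fixes x y z :: "'a::euclidean_space"
  defines "s \<equiv> (real DIM('a) - 1) / 2"
  defines "c \<equiv> exp (- 16 * pi) * (unit_ball_vol (real DIM('a)) / 4 ^ DIM('a)) * 2 ^ (DIM('a) - 1) / 2 powr s"
  assumes R: "0 < R" and cl: "\<bar>dist z x - dist y x\<bar> \<le> 2 / R"
  shows "riesz_kernel s (dist y x) * riesz_kernel s (dist z x) \<le>
    (riesz_kernel s (dist y x) * indicator {..6 / R} (dist y x)) * (riesz_kernel s (dist z x) * indicator {..6 / R} (dist z x)) +
    ennreal (1 / (c * R)) * (\<integral>\<^sup>+\<omega>. ennreal (R ^ DIM('a) * exp (- pi * R\<^sup>2 * (norm (norm (z - x) *\<^sub>R \<omega> - (y - x)))\<^sup>2)) \<partial>surface)"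
proof (cases "4 / R \<le> dist z x")
  case True
  have c: "0 < c" by (simp add: c_def)
  have eq: "4 / R = 2 / R + 2 / R" "0 < 2 / R" using R by auto
  have pos: "0 < dist z x" "0 < dist y x" using True cl eq unfolding abs_le_iff by linarith+
  have "\<bar>norm (y - x) - norm (z - x)\<bar> \<le> 2 / R" "4 / R \<le> norm (z - x)"
    using cl True by (auto simp: dist_norm abs_minus_commute)
  from spherical_gaussian_ge[OF R this]
  have main: "ennreal (c * R * (dist y x powr - s * dist z x powr - s)) \<le>
    (\<integral>\<^sup>+\<omega>. ennreal (R ^ DIM('a) * exp (- pi * R\<^sup>2 * (norm (norm (z - x) *\<^sub>R \<omega> - (y - x)))\<^sup>2)) \<partial>surface)" (is "_ \<le> ?I")
    unfolding c_def s_def dist_norm .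
  have "riesz_kernel s (dist y x) * riesz_kernel s (dist z x) = ennreal (1 / (c * R)) * ennreal (c * R * (dist y x powr - s * dist z x powr - s))"
    using pos c R by (simp add: riesz_kernel_pos ennreal_mult[symmetric])
  also have "\<dots> \<le> ennreal (1 / (c * R)) * ?I" by (intro mult_left_mono main) auto
  finally show ?thesis by (rule order_trans) simp
next
  case False
  have "4 / R \<le> 6 / R" "6 / R = 4 / R + 2 / R" using R by (auto simp: divide_right_mono add_divide_distrib[symmetric])
  then have "dist z x \<le> 6 / R" "dist y x \<le> 6 / R" using False cl unfolding abs_le_iff by linarith+
  then show ?thesis by simp
qed

text \<open>
The near part decays with exponent \<open>\<alpha> + \<gamma> - n + 1\<close>, which is at least \<open>\<kappa>\<close> because \<open>\<beta>' \<le> \<beta> \<le> \<alpha>\<close>. In the far part the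
factor \<open>1 / R\<close> turns the growth \<open>n - \<gamma> - \<beta>'\<close> into the decay \<open>\<kappa>\<close>.
\<close>

lemma single_scale_estimate:
  assumes C0: "0 \<le> C0" and moll: "mollified_decay_bound TYPE('a::euclidean_space) \<alpha> \<beta> C0"
    and \<beta>0: "0 \<le> \<beta>" and \<beta>': "0 \<le> \<beta>'" "\<beta>' = 0 \<or> \<beta>' < \<beta>"
    and \<gamma>: "0 \<le> \<gamma>" "\<gamma> \<le> real DIM('a)" and \<theta>: "0 \<le> real DIM('a) - \<gamma> - \<beta>'"
    and \<kappa>: "0 < \<gamma> + \<beta>' - real DIM('a) + 1"
  defines "s \<equiv> (real DIM('a) - 1) / 2" and "\<kappa> \<equiv> \<gamma> + \<beta>' - real DIM('a) + 1"
  obtains C where "0 \<le> C"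
    "\<And>(\<mu> :: 'a measure) \<nu> j. \<mu> \<in> unit_ball_measures \<Longrightarrow> \<nu> \<in> unit_ball_measures \<Longrightarrow>
      0 < frostman_const \<alpha> \<mu> \<Longrightarrow> frostman_const \<alpha> \<mu> < \<infinity> \<Longrightarrow>
      (\<integral>\<^sup>+x. \<integral>\<^sup>+y. \<integral>\<^sup>+z. riesz_kernel s (dist y x) * riesz_kernel s (dist z x) *
          indicator {..2 / 2 ^ j} \<bar>dist z x - dist y x\<bar> \<partial>\<nu> \<partial>\<nu> \<partial>\<mu>) \<le>
      ennreal (C * (real (Suc j) * 2 powr (- (real j * \<kappa>)))) * (frostman_const \<alpha> \<mu> * energy \<gamma> \<nu>)"
proof -
  have \<beta>\<alpha>: "\<beta> \<le> \<alpha>" by (rule decay_exponent_le_dimension[OF C0 moll])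
  define \<eta> where "\<eta> = \<alpha> + \<gamma> - (real DIM('a) - 1)"
  have \<eta>: "\<kappa> \<le> \<eta>" "0 < \<eta>" using \<beta>\<alpha> \<beta>0 \<beta>' \<kappa> by (auto simp: \<kappa>_def \<eta>_def)
  obtain C1 where C1: "0 \<le> C1"
    "\<And>(\<mu> :: 'a measure) \<nu> \<rho>. \<mu> \<in> unit_ball_measures \<Longrightarrow> \<nu> \<in> unit_ball_measures \<Longrightarrow> 0 < \<rho> \<Longrightarrow>
      (\<integral>\<^sup>+x. (\<integral>\<^sup>+y. riesz_kernel s (dist y x) * indicator {..\<rho>} (dist y x) \<partial>\<nu>)\<^sup>2 \<partial>\<mu>) \<le>
      ennreal (C1 * \<rho> powr \<eta>) * (frostman_const \<alpha> \<mu> * energy \<gamma> \<nu>)"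
    using near_part_estimate[OF \<gamma>(1) \<eta>(2)[unfolded \<eta>_def]] unfolding s_def \<eta>_def by blast
  obtain C2 where C2: "0 \<le> C2"
    "\<And>(\<mu> :: 'a measure) \<nu> j. \<mu> \<in> unit_ball_measures \<Longrightarrow> \<nu> \<in> unit_ball_measures \<Longrightarrow>
      0 < frostman_const \<alpha> \<mu> \<Longrightarrow> frostman_const \<alpha> \<mu> < \<infinity> \<Longrightarrow>
      (\<integral>\<^sup>+x. \<integral>\<^sup>+y. \<integral>\<^sup>+z. \<integral>\<^sup>+\<omega>. ennreal ((2 ^ j) ^ DIM('a) *
          exp (- pi * (2 ^ j)\<^sup>2 * (norm (norm (z - x) *\<^sub>R \<omega> - (y - x)))\<^sup>2)) \<partial>surface \<partial>\<nu> \<partial>\<nu> \<partial>\<mu>) \<le>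
      ennreal (C2 * (real (Suc j) * 2 powr (real j * (real DIM('a) - \<gamma> - \<beta>')))) * (frostman_const \<alpha> \<mu> * energy \<gamma> \<nu>)"
    by (rule spherical_gaussian_average_estimate[OF C0 moll \<beta>' \<gamma> \<theta>]) blast
  define c where "c = exp (- 16 * pi) * (unit_ball_vol (real DIM('a)) / 4 ^ DIM('a)) * 2 ^ (DIM('a) - 1) / 2 powr s"
  have c: "0 < c" by (simp add: c_def)
  show thesis
  proof
    show "0 \<le> C1 * 6 powr \<eta> + C2 / c" using C1 C2 c by simp
    fix \<mu> \<nu> :: "'a measure" and j :: nat
    assume \<mu>: "\<mu> \<in> unit_ball_measures" and \<nu>: "\<nu> \<in> unit_ball_measures"
      and fr: "0 < frostman_const \<alpha> \<mu>" "frostman_const \<alpha> \<mu> < \<infinity>"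
    have s\<mu> [measurable_cong]: "sets \<mu> = sets borel" and f\<mu>: "finite_measure \<mu>" using \<mu> by (auto simp: unit_ball_measures_iff)
    have s\<nu> [measurable_cong]: "sets \<nu> = sets borel" and f\<nu>: "finite_measure \<nu>" using \<nu> by (auto simp: unit_ball_measures_iff)
    interpret \<mu>: finite_measure \<mu> by fact
    interpret \<nu>: finite_measure \<nu> by fact
    let ?R = "2 ^ j :: real"
    let ?cI = "frostman_const \<alpha> \<mu> * energy \<gamma> \<nu>"
    let ?W = "\<lambda>y x. riesz_kernel s (dist y x)"
    let ?N = "\<lambda>y x. ?W y x * indicator {..6 / ?R} (dist y x)"
    let ?G = "\<lambda>x y z. \<integral>\<^sup>+\<omega>. ennreal (?R ^ DIM('a) * exp (- pi * ?R\<^sup>2 * (norm (norm (z - x) *\<^sub>R \<omega> - (y - x)))\<^sup>2)) \<partial>surface"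
    have "(\<integral>\<^sup>+x. \<integral>\<^sup>+y. \<integral>\<^sup>+z. ?W y x * ?W z x * indicator {..2 / ?R} \<bar>dist z x - dist y x\<bar> \<partial>\<nu> \<partial>\<nu> \<partial>\<mu>) \<le>
      (\<integral>\<^sup>+x. \<integral>\<^sup>+y. \<integral>\<^sup>+z. ?N y x * ?N z x + ennreal (1 / (c * ?R)) * ?G x y z \<partial>\<nu> \<partial>\<nu> \<partial>\<mu>)"
    proof (intro nn_integral_mono)
      fix x y z :: 'a
      show "?W y x * ?W z x * indicator {..2 / ?R} \<bar>dist z x - dist y x\<bar> \<le> ?N y x * ?N z x + ennreal (1 / (c * ?R)) * ?G x y z"
      proof (cases "\<bar>dist z x - dist y x\<bar> \<le> 2 / ?R")
        case True
        have "?W y x * ?W z x \<le> ?N y x * ?N z x + ennreal (1 / (c * ?R)) * ?G x y z"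
          unfolding c_def s_def by (rule weighted_pair_le) (use True in auto)
        then show ?thesis using True by simp
      qed simp
    qed
    also have "\<dots> = (\<integral>\<^sup>+x. \<integral>\<^sup>+y. (\<integral>\<^sup>+z. ?N y x * ?N z x \<partial>\<nu>) + (\<integral>\<^sup>+z. ennreal (1 / (c * ?R)) * ?G x y z \<partial>\<nu>) \<partial>\<nu> \<partial>\<mu>)"
      by (intro nn_integral_cong nn_integral_add) measurable
    also have "\<dots> = (\<integral>\<^sup>+x. (\<integral>\<^sup>+y. \<integral>\<^sup>+z. ?N y x * ?N z x \<partial>\<nu> \<partial>\<nu>) + (\<integral>\<^sup>+y. \<integral>\<^sup>+z. ennreal (1 / (c * ?R)) * ?G x y z \<partial>\<nu> \<partial>\<nu>) \<partial>\<mu>)"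
      by (intro nn_integral_cong nn_integral_add) measurable
    also have "\<dots> = (\<integral>\<^sup>+x. \<integral>\<^sup>+y. \<integral>\<^sup>+z. ?N y x * ?N z x \<partial>\<nu> \<partial>\<nu> \<partial>\<mu>) + (\<integral>\<^sup>+x. \<integral>\<^sup>+y. \<integral>\<^sup>+z. ennreal (1 / (c * ?R)) * ?G x y z \<partial>\<nu> \<partial>\<nu> \<partial>\<mu>)"
      by (rule nn_integral_add) measurable
    also have "(\<integral>\<^sup>+x. \<integral>\<^sup>+y. \<integral>\<^sup>+z. ?N y x * ?N z x \<partial>\<nu> \<partial>\<nu> \<partial>\<mu>) = (\<integral>\<^sup>+x. (\<integral>\<^sup>+y. ?N y x \<partial>\<nu>)\<^sup>2 \<partial>\<mu>)"
      by (simp add: power2_eq_square nn_integral_cmult nn_integral_multc)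
    also have "(\<integral>\<^sup>+x. \<integral>\<^sup>+y. \<integral>\<^sup>+z. ennreal (1 / (c * ?R)) * ?G x y z \<partial>\<nu> \<partial>\<nu> \<partial>\<mu>) = ennreal (1 / (c * ?R)) * (\<integral>\<^sup>+x. \<integral>\<^sup>+y. \<integral>\<^sup>+z. ?G x y z \<partial>\<nu> \<partial>\<nu> \<partial>\<mu>)"
      by (simp add: nn_integral_cmult)
    also have "(\<integral>\<^sup>+x. (\<integral>\<^sup>+y. ?N y x \<partial>\<nu>)\<^sup>2 \<partial>\<mu>) + ennreal (1 / (c * ?R)) * (\<integral>\<^sup>+x. \<integral>\<^sup>+y. \<integral>\<^sup>+z. ?G x y z \<partial>\<nu> \<partial>\<nu> \<partial>\<mu>) \<le>
      ennreal (C1 * (6 / ?R) powr \<eta>) * ?cI +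
      ennreal (1 / (c * ?R)) * (ennreal (C2 * (real (Suc j) * 2 powr (real j * (real DIM('a) - \<gamma> - \<beta>')))) * ?cI)"
      by (intro add_mono mult_left_mono C1(2) C2(2) \<mu> \<nu> fr) auto
    also have "\<dots> = ennreal (C1 * (6 / ?R) powr \<eta> + 1 / (c * ?R) * (C2 * (real (Suc j) * 2 powr (real j * (real DIM('a) - \<gamma> - \<beta>'))))) * ?cI"
    proof -
      have gen: "ennreal a * d + ennreal b * (ennreal e * d) = ennreal (a + b * e) * d" if "0 \<le> a" "0 \<le> b" "0 \<le> e" for a b e d
        using that by (simp add: ennreal_mult distrib_right mult.assoc)
      show ?thesis by (rule gen) (use C1 C2 c in auto)
    qed
    also have "\<dots> \<le> ennreal ((C1 * 6 powr \<eta> + C2 / c) * (real (Suc j) * 2 powr (- (real j * \<kappa>)))) * ?cI"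
    proof (intro mult_right_mono ennreal_leI)
      have R: "?R = 2 powr real j" by (simp add: powr_realpow)
      have "C1 * (6 / ?R) powr \<eta> = C1 * 6 powr \<eta> * 2 powr (- (real j * \<eta>))"
        unfolding R by (simp add: powr_divide powr_powr powr_minus_divide)
      also have "\<dots> \<le> C1 * 6 powr \<eta> * (real (Suc j) * 2 powr (- (real j * \<kappa>)))"
      proof (intro mult_left_mono)
        have "2 powr (- (real j * \<eta>)) \<le> 2 powr (- (real j * \<kappa>))"
          using \<eta> by (intro powr_mono) (auto intro: mult_left_mono)
        also have "\<dots> \<le> real (Suc j) * 2 powr (- (real j * \<kappa>))" by simp
        finally show "2 powr (- (real j * \<eta>)) \<le> real (Suc j) * 2 powr (- (real j * \<kappa>))" .
      qed (use C1 in auto)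
      finally have 1: "C1 * (6 / ?R) powr \<eta> \<le> C1 * 6 powr \<eta> * (real (Suc j) * 2 powr (- (real j * \<kappa>)))" .
      have "1 / (c * ?R) * (C2 * (real (Suc j) * 2 powr (real j * (real DIM('a) - \<gamma> - \<beta>')))) =
        C2 / c * (real (Suc j) * (2 powr (- real j) * 2 powr (real j * (real DIM('a) - \<gamma> - \<beta>'))))"
        unfolding R by (simp add: powr_minus_divide)
      also have "2 powr (- real j) * 2 powr (real j * (real DIM('a) - \<gamma> - \<beta>')) = 2 powr (- (real j * \<kappa>))"
        by (simp add: powr_add[symmetric] \<kappa>_def algebra_simps)
      finally have 2: "1 / (c * ?R) * (C2 * (real (Suc j) * 2 powr (real j * (real DIM('a) - \<gamma> - \<beta>')))) = C2 / c * (real (Suc j) * 2 powr (- (real j * \<kappa>)))" .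
      show "C1 * (6 / ?R) powr \<eta> + 1 / (c * ?R) * (C2 * (real (Suc j) * 2 powr (real j * (real DIM('a) - \<gamma> - \<beta>')))) \<le>
        (C1 * 6 powr \<eta> + C2 / c) * (real (Suc j) * 2 powr (- (real j * \<kappa>)))"
        unfolding 2 distrib_right using 1 by simp
    qed simp
    finally show "(\<integral>\<^sup>+x. \<integral>\<^sup>+y. \<integral>\<^sup>+z. ?W y x * ?W z x * indicator {..2 / ?R} \<bar>dist z x - dist y x\<bar> \<partial>\<nu> \<partial>\<nu> \<partial>\<mu>) \<le>
      ennreal ((C1 * 6 powr \<eta> + C2 / c) * (real (Suc j) * 2 powr (- (real j * \<kappa>)))) * ?cI" .
  qed
qed

section \<open>Energies of pinned distance measures\<close>

lemma nn_integral_weighted_dist_return: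
  fixes \<nu> :: "'a::euclidean_space measure"
  assumes s [measurable_cong]: "sets \<nu> = sets borel" and fin: "finite_measure \<nu>" and [measurable]: "\<phi> \<in> borel_measurable borel"
  shows "(\<integral>\<^sup>+r. \<phi> r \<partial>weighted_dist \<nu> (return borel x)) =
    (\<integral>\<^sup>+z. riesz_kernel ((real DIM('a) - 1) / 2) (dist z x) * \<phi> (dist z x) \<partial>\<nu>)"
proof -
  interpret finite_measure \<nu> by fact
  interpret r: prob_space "return borel x" by (rule prob_space_return) simp
  show ?thesis
    by (subst nn_integral_weighted_dist[OF s fin _ r.finite_measure_axioms]) (simp_all add: nn_integral_return)
qed

lemma nn_integral_dist_push_return:
  fixes \<nu> :: "'a::euclidean_space measure"
  assumes s [measurable_cong]: "sets \<nu> = sets borel" and fin: "finite_measure \<nu>" and [measurable]: "\<phi> \<in> borel_measurable borel"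
  shows "(\<integral>\<^sup>+r. \<phi> r \<partial>dist_push \<nu> (return borel x)) = (\<integral>\<^sup>+z. \<phi> (dist z x) \<partial>\<nu>)"
proof -
  interpret finite_measure \<nu> by fact
  interpret r: prob_space "return borel x" by (rule prob_space_return) simp
  interpret P: pair_sigma_finite \<nu> "return borel x" ..
  note m [measurable] = measurable_dist_pair[OF s sets_return]
  have "(\<integral>\<^sup>+r. \<phi> r \<partial>dist_push \<nu> (return borel x)) = (\<integral>\<^sup>+p. \<phi> ((\<lambda>(x, y). dist x y) p) \<partial>(\<nu> \<Otimes>\<^sub>M return borel x))"
    unfolding dist_push_def by (rule nn_integral_distr) measurable
  also have "\<dots> = (\<integral>\<^sup>+y. \<integral>\<^sup>+z. \<phi> ((\<lambda>(x, y). dist x y) (z, y)) \<partial>\<nu> \<partial>return borel x)"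
    by (rule P.nn_integral_snd[symmetric]) measurable
  finally show ?thesis by (simp add: nn_integral_return)
qed

text \<open>
The inner integral is rewritten as one against \<open>\<nu>\<close> before the outer one, because \<open>\<Delta>(\<nu>, \<delta>\<^sub>x)\<close> need not be
\<open>\<sigma>\<close>-finite: it has an atom of infinite mass at \<open>0\<close> if \<open>\<nu>\<close> charges \<open>x\<close>. For the finite measure \<open>\<nu>\<close> the
inner integral is a measurable function of the outer variable.
\<close>

lemma energy_weighted_dist_return:
  fixes \<nu> :: "'a::euclidean_space measure"
  assumes s [measurable_cong]: "sets \<nu> = sets borel" and fin: "finite_measure \<nu>"
  defines "k \<equiv> riesz_kernel ((real DIM('a) - 1) / 2)"
  shows "energy t (weighted_dist \<nu> (return borel x)) =
    (\<integral>\<^sup>+y. \<integral>\<^sup>+z. k (dist y x) * k (dist z x) * riesz_kernel t \<bar>dist z x - dist y x\<bar> \<partial>\<nu> \<partial>\<nu>)"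
proof -
  interpret finite_measure \<nu> by fact
  have [measurable]: "k \<in> borel_measurable borel" unfolding k_def by measurable
  have "energy t (weighted_dist \<nu> (return borel x)) =
    (\<integral>\<^sup>+r'. \<integral>\<^sup>+z. k (dist z x) * riesz_kernel t (dist (dist z x) r') \<partial>\<nu> \<partial>weighted_dist \<nu> (return borel x))"
    unfolding energy_def k_def by (intro nn_integral_cong nn_integral_weighted_dist_return s fin) measurable
  also have "\<dots> = (\<integral>\<^sup>+y. k (dist y x) * (\<integral>\<^sup>+z. k (dist z x) * riesz_kernel t (dist (dist z x) (dist y x)) \<partial>\<nu>) \<partial>\<nu>)"
    unfolding k_def[symmetric] by (subst nn_integral_weighted_dist_return[OF s fin]) (auto simp: k_def)
  also have "\<dots> = (\<integral>\<^sup>+y. \<integral>\<^sup>+z. k (dist y x) * k (dist z x) * riesz_kernel t \<bar>dist z x - dist y x\<bar> \<partial>\<nu> \<partial>\<nu>)"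
    by (simp add: nn_integral_cmult[symmetric] mult.assoc dist_real_def)
  finally show ?thesis .
qed

text \<open>
Distances in the unit ball are at most \<open>2\<close>, where each of the two weights is at least \<open>2\<^sup>-\<^sup>(\<^sup>n\<^sup>-\<^sup>1\<^sup>)\<^sup>/\<^sup>2\<close>.
\<close>

lemma energy_dist_push_return_le:
  fixes \<nu> :: "'a::euclidean_space measure"
  assumes \<nu>: "\<nu> \<in> unit_ball_measures" and x: "norm x \<le> 1"
  shows "energy t (dist_push \<nu> (return borel x)) \<le> ennreal (2 ^ (DIM('a) - 1)) * energy t (weighted_dist \<nu> (return borel x))"
proof -
  have s [measurable_cong]: "sets \<nu> = sets borel" and fin: "finite_measure \<nu>" and AE: "AE y in \<nu>. norm y \<le> 1"
    using \<nu> by (auto simp: unit_ball_measures_iff)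
  interpret finite_measure \<nu> by fact
  define \<sigma> where "\<sigma> = (real DIM('a) - 1) / 2"
  have \<sigma>: "0 \<le> \<sigma>" using DIM_positive[where 'a='a] unfolding \<sigma>_def by (simp add: Suc_le_eq)
  let ?k = "riesz_kernel \<sigma>"
  have one: "1 \<le> ennreal (2 powr \<sigma>) * ?k (dist y x)" if "norm y \<le> 1" for y
  proof -
    have "dist y x \<le> norm y + norm x" unfolding dist_norm by (rule norm_triangle_ineq4)
    then have "dist y x \<le> 2" using that x by simp
    then have "?k 2 \<le> ?k (dist y x)" using \<sigma> by (intro riesz_kernel_mono) auto
    then have "ennreal (2 powr \<sigma>) * ?k 2 \<le> ennreal (2 powr \<sigma>) * ?k (dist y x)" by (rule mult_left_mono) simp
    then show ?thesis by (simp add: riesz_kernel_pos ennreal_mult[symmetric] powr_add[symmetric])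
  qed
  have two: "2 powr \<sigma> * 2 powr \<sigma> = 2 ^ (DIM('a) - 1)"
  proof -
    have "\<sigma> + \<sigma> = real (DIM('a) - 1)" using DIM_positive[where 'a='a] by (simp add: \<sigma>_def of_nat_diff Suc_le_eq)
    then show ?thesis by (simp only: powr_add[symmetric] powr_realpow zero_less_numeral)
  qed
  have "energy t (dist_push \<nu> (return borel x)) =
    (\<integral>\<^sup>+r'. \<integral>\<^sup>+z. riesz_kernel t (dist (dist z x) r') \<partial>\<nu> \<partial>dist_push \<nu> (return borel x))"
    unfolding energy_def by (intro nn_integral_cong nn_integral_dist_push_return s fin) measurable
  also have "\<dots> = (\<integral>\<^sup>+y. \<integral>\<^sup>+z. riesz_kernel t \<bar>dist z x - dist y x\<bar> \<partial>\<nu> \<partial>\<nu>)"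
    by (subst nn_integral_dist_push_return[OF s fin]) (auto simp: dist_real_def)
  also have "\<dots> \<le> (\<integral>\<^sup>+y. \<integral>\<^sup>+z. ennreal (2 ^ (DIM('a) - 1)) * (?k (dist y x) * ?k (dist z x) * riesz_kernel t \<bar>dist z x - dist y x\<bar>) \<partial>\<nu> \<partial>\<nu>)"
  proof (rule nn_integral_mono_AE, use AE in eventually_elim)
    fix y :: 'a assume y: "norm y \<le> 1"
    show "(\<integral>\<^sup>+z. riesz_kernel t \<bar>dist z x - dist y x\<bar> \<partial>\<nu>) \<le> (\<integral>\<^sup>+z. ennreal (2 ^ (DIM('a) - 1)) * (?k (dist y x) * ?k (dist z x) * riesz_kernel t \<bar>dist z x - dist y x\<bar>) \<partial>\<nu>)"
    proof (rule nn_integral_mono_AE, use AE in eventually_elim)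
      fix z :: 'a assume z: "norm z \<le> 1"
      have "1 * 1 * riesz_kernel t \<bar>dist z x - dist y x\<bar> \<le> (ennreal (2 powr \<sigma>) * ?k (dist y x)) * (ennreal (2 powr \<sigma>) * ?k (dist z x)) * riesz_kernel t \<bar>dist z x - dist y x\<bar>"
        by (intro mult_mono one y z) auto
      also have "\<dots> = ennreal (2 powr \<sigma> * 2 powr \<sigma>) * (?k (dist y x) * ?k (dist z x) * riesz_kernel t \<bar>dist z x - dist y x\<bar>)"
        by (simp add: ennreal_mult mult_ac)
      finally show "riesz_kernel t \<bar>dist z x - dist y x\<bar> \<le> ennreal (2 ^ (DIM('a) - 1)) * (?k (dist y x) * ?k (dist z x) * riesz_kernel t \<bar>dist z x - dist y x\<bar>)"
        unfolding two by simp
    qed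
  qed
  also have "\<dots> = ennreal (2 ^ (DIM('a) - 1)) * energy t (weighted_dist \<nu> (return borel x))"
    unfolding energy_weighted_dist_return[OF s fin] \<sigma>_def by (simp add: nn_integral_cmult)
  finally show ?thesis .
qed

lemma nn_integral_space_null:
  assumes "emeasure M (space M) = 0"
  shows "(\<integral>\<^sup>+x. f x \<partial>M) = 0"
proof -
  have "AE x in M. False" by (rule AE_I[of _ _ "space M"]) (use assms in auto)
  then have "(\<integral>\<^sup>+x. f x \<partial>M) = (\<integral>\<^sup>+x. 0 \<partial>M)" by (intro nn_integral_cong_AE) auto
  then show ?thesis by simp
qed

lemma energy_eq_0_imp_null:
  fixes \<nu> :: "'a::euclidean_space measure"
  assumes \<nu>: "\<nu> \<in> unit_ball_measures" and \<gamma>: "0 \<le> \<gamma>" and E: "energy \<gamma> \<nu> = 0"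
  shows "emeasure \<nu> UNIV = 0"
proof -
  have s [measurable_cong]: "sets \<nu> = sets borel" and fin: "finite_measure \<nu>" and AE: "AE y in \<nu>. norm y \<le> 1"
    using \<nu> by (auto simp: unit_ball_measures_iff)
  interpret finite_measure \<nu> by fact
  have sp: "space \<nu> = UNIV" using sets_eq_imp_space_eq[OF s] by simp
  have "(\<integral>\<^sup>+y. \<integral>\<^sup>+x. riesz_kernel \<gamma> 2 \<partial>\<nu> \<partial>\<nu>) \<le> energy \<gamma> \<nu>"
    unfolding energy_def
  proof (rule nn_integral_mono_AE, use AE in eventually_elim)
    fix y :: 'a assume y: "norm y \<le> 1"
    show "(\<integral>\<^sup>+x. riesz_kernel \<gamma> 2 \<partial>\<nu>) \<le> (\<integral>\<^sup>+x. riesz_kernel \<gamma> (dist x y) \<partial>\<nu>)"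
    proof (rule nn_integral_mono_AE, use AE in eventually_elim)
      fix x :: 'a assume x: "norm x \<le> 1"
      have "dist x y \<le> norm x + norm y" unfolding dist_norm by (rule norm_triangle_ineq4)
      then show "riesz_kernel \<gamma> 2 \<le> riesz_kernel \<gamma> (dist x y)" using x y \<gamma> by (intro riesz_kernel_mono) auto
    qed
  qed
  then show ?thesis by (auto simp: E sp riesz_kernel_pos)
qed

lemma weighted_energy_estimate:
  assumes C0: "0 \<le> C0" and moll: "mollified_decay_bound TYPE('a::euclidean_space) \<alpha> \<beta> C0"
    and \<beta>0: "0 \<le> \<beta>" and \<gamma>: "0 \<le> \<gamma>" "\<gamma> \<le> real DIM('a)"
    and t: "0 < t" "t < \<gamma> + \<beta> - real DIM('a) + 1" and le1: "\<gamma> + \<beta> - real DIM('a) + 1 \<le> 1"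
  obtains C where "0 < C"
    "\<And>(\<mu> :: 'a measure) \<nu>. \<mu> \<in> unit_ball_measures \<Longrightarrow> \<nu> \<in> unit_ball_measures \<Longrightarrow>
      (\<integral>\<^sup>+x. energy t (weighted_dist \<nu> (return borel x)) \<partial>\<mu>) \<le> ennreal C * (frostman_const \<alpha> \<mu> * energy \<gamma> \<nu>)"
proof -
  define \<delta> where "\<delta> = \<gamma> + \<beta> - real DIM('a) + 1 - t"
  have \<delta>: "0 < \<delta>" using t by (simp add: \<delta>_def)
  \<comment> \<open>Half of the gap \<open>\<delta>\<close> pays for the loss in the exponent, and the other half makes the sum over the
    scales converge. If \<open>\<beta> = 0\<close>, then \<open>\<beta>'\<close> may equal \<open>\<beta>\<close>.\<close>
  define \<beta>' where "\<beta>' = (if \<beta> = 0 then 0 else max 0 (\<beta> - \<delta> / 2))"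
  have \<beta>': "0 \<le> \<beta>'" "\<beta>' = 0 \<or> \<beta>' < \<beta>" using \<delta> \<beta>0 by (auto simp: \<beta>'_def)
  have \<beta>'le: "\<beta>' \<le> \<beta>" using \<beta>' \<beta>0 by auto
  define \<kappa> where "\<kappa> = \<gamma> + \<beta>' - real DIM('a) + 1"
  have "\<beta> - \<delta> / 2 \<le> \<beta>'" using \<delta> by (auto simp: \<beta>'_def)
  then have \<kappa>: "t < \<kappa>" using \<delta> by (simp add: \<kappa>_def \<delta>_def field_simps)
  have \<kappa>0: "0 < \<gamma> + \<beta>' - real DIM('a) + 1" using \<kappa> t by (simp add: \<kappa>_def)
  have \<theta>: "0 \<le> real DIM('a) - \<gamma> - \<beta>'" using \<beta>'le le1 by simp
  let ?k = "riesz_kernel ((real DIM('a) - 1) / 2)"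
  obtain C where C: "0 \<le> C"
    "\<And>(\<mu> :: 'a measure) \<nu> j. \<mu> \<in> unit_ball_measures \<Longrightarrow> \<nu> \<in> unit_ball_measures \<Longrightarrow>
      0 < frostman_const \<alpha> \<mu> \<Longrightarrow> frostman_const \<alpha> \<mu> < \<infinity> \<Longrightarrow>
      (\<integral>\<^sup>+x. \<integral>\<^sup>+y. \<integral>\<^sup>+z. ?k (dist y x) * ?k (dist z x) *
          indicator {..2 / 2 ^ j} \<bar>dist z x - dist y x\<bar> \<partial>\<nu> \<partial>\<nu> \<partial>\<mu>) \<le>
      ennreal (C * (real (Suc j) * 2 powr (- (real j * \<kappa>)))) * (frostman_const \<alpha> \<mu> * energy \<gamma> \<nu>)"
    using single_scale_estimate[OF C0 moll \<beta>0 \<beta>' \<gamma> \<theta> \<kappa>0] unfolding \<kappa>_def by blast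
  define q where "q = (2::real) powr (- (\<kappa> - t))"
  have q: "0 < q" "q < 1" using \<kappa> by (auto simp: q_def powr_less_one)
  show thesis
  proof
    show "0 < C / (1 - q)\<^sup>2 + 1" using C q by (simp add: add_nonneg_pos)
    fix \<mu> \<nu> :: "'a measure"
    assume \<mu>: "\<mu> \<in> unit_ball_measures" and \<nu>: "\<nu> \<in> unit_ball_measures"
    have s\<mu> [measurable_cong]: "sets \<mu> = sets borel" and f\<mu>: "finite_measure \<mu>" and AE\<mu>: "AE x in \<mu>. norm x \<le> 1" using \<mu> by (auto simp: unit_ball_measures_iff)
    have s\<nu> [measurable_cong]: "sets \<nu> = sets borel" and f\<nu>: "finite_measure \<nu>" and AE\<nu>: "AE x in \<nu>. norm x \<le> 1" using \<nu> by (auto simp: unit_ball_measures_iff)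
    interpret \<mu>: finite_measure \<mu> by fact
    interpret \<nu>: finite_measure \<nu> by fact
    have sp: "space \<mu> = UNIV" "space \<nu> = UNIV" using sets_eq_imp_space_eq[OF s\<mu>] sets_eq_imp_space_eq[OF s\<nu>] by auto
    let ?cI = "frostman_const \<alpha> \<mu> * energy \<gamma> \<nu>"
    let ?E = "\<integral>\<^sup>+x. energy t (weighted_dist \<nu> (return borel x)) \<partial>\<mu>"
    \<comment> \<open>The scale estimates need a positive finite Frostman constant. If it is \<open>0\<close>, then \<open>\<mu> = 0\<close>; if it is
      infinite, so is the right-hand side unless the energy vanishes, and then \<open>\<nu> = 0\<close>.\<close>
    consider (zero) "emeasure \<mu> UNIV = 0 \<or> emeasure \<nu> UNIV = 0"
      | (top) "?cI = \<infinity>"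
      | (pos) "0 < frostman_const \<alpha> \<mu>" "frostman_const \<alpha> \<mu> < \<infinity>"
    proof (cases "frostman_const \<alpha> \<mu> = 0")
      case True
      then show ?thesis using emeasure_UNIV_le_frostman_const[OF \<mu>, of \<alpha>] zero by simp
    next
      case False
      show ?thesis
      proof (cases "frostman_const \<alpha> \<mu> = \<infinity>")
        case True
        show ?thesis
        proof (cases "energy \<gamma> \<nu> = 0")
          case True
          then show ?thesis using energy_eq_0_imp_null[OF \<nu> \<gamma>(1)] zero by simp
        next
          case False
          then show ?thesis using \<open>frostman_const \<alpha> \<mu> = \<infinity>\<close> top by (simp add: ennreal_top_mult)
        qed
      next
        case False
        then show ?thesis using \<open>frostman_const \<alpha> \<mu> \<noteq> 0\<close> pos by (simp add: zero_less_iff_neq_zero less_top)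
      qed
    qed
    then show "?E \<le> ennreal (C / (1 - q)\<^sup>2 + 1) * ?cI"
    proof cases
      case zero
      then have "?E = 0"
      proof
        assume "emeasure \<mu> UNIV = 0"
        then have "emeasure \<mu> (space \<mu>) = 0" by (simp add: sp)
        then show ?thesis by (rule nn_integral_space_null)
      next
        assume "emeasure \<nu> UNIV = 0"
        then have "emeasure \<nu> (space \<nu>) = 0" by (simp add: sp)
        then have "(\<integral>\<^sup>+y. f y \<partial>\<nu>) = 0" for f by (rule nn_integral_space_null)
        then show ?thesis by (simp add: energy_weighted_dist_return[OF s\<nu> f\<nu>])
      qed
      then show ?thesis by simp
    next
      case top
      have "0 < C / (1 - q)\<^sup>2 + 1" using C q by (simp add: add_nonneg_pos)
      then have "ennreal (C / (1 - q)\<^sup>2 + 1) * ?cI = \<infinity>" unfolding top by (simp add: ennreal_mult_top del: ennreal_plus)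
      then show ?thesis by (metis infinity_ennreal_def top_greatest)
    next
      case pos
      let ?T = "\<lambda>j. \<integral>\<^sup>+x. \<integral>\<^sup>+y. \<integral>\<^sup>+z. ?k (dist y x) * ?k (dist z x) * indicator {..2 / 2 ^ j} \<bar>dist z x - dist y x\<bar> \<partial>\<nu> \<partial>\<nu> \<partial>\<mu>"
      let ?b = "\<lambda>j::nat. ennreal ((2 / 2 ^ Suc j) powr - t)"
      let ?g = "\<lambda>j x y z. ?b j * (?k (dist y x) * ?k (dist z x) * indicator {..2 / 2 ^ j} \<bar>dist z x - dist y x\<bar>)"
      have "?E \<le> (\<integral>\<^sup>+x. \<integral>\<^sup>+y. \<integral>\<^sup>+z. (\<Sum>j. ?g j x y z) \<partial>\<nu> \<partial>\<nu> \<partial>\<mu>)"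
        unfolding energy_weighted_dist_return[OF s\<nu> f\<nu>]
      proof (rule nn_integral_mono_AE, use AE\<mu> in eventually_elim)
        fix x :: 'a assume x: "norm x \<le> 1"
        show "(\<integral>\<^sup>+y. \<integral>\<^sup>+z. ?k (dist y x) * ?k (dist z x) * riesz_kernel t \<bar>dist z x - dist y x\<bar> \<partial>\<nu> \<partial>\<nu>) \<le> (\<integral>\<^sup>+y. \<integral>\<^sup>+z. (\<Sum>j. ?g j x y z) \<partial>\<nu> \<partial>\<nu>)"
        proof (rule nn_integral_mono_AE, use AE\<nu> in eventually_elim)
          fix y :: 'a assume y: "norm y \<le> 1"
          show "(\<integral>\<^sup>+z. ?k (dist y x) * ?k (dist z x) * riesz_kernel t \<bar>dist z x - dist y x\<bar> \<partial>\<nu>) \<le> (\<integral>\<^sup>+z. (\<Sum>j. ?g j x y z) \<partial>\<nu>)"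
          proof (rule nn_integral_mono_AE, use AE\<nu> in eventually_elim)
            fix z :: 'a assume z: "norm z \<le> 1"
            have "dist y x \<le> norm y + norm x" "dist z x \<le> norm z + norm x" unfolding dist_norm by (rule norm_triangle_ineq4)+
            then have d: "\<bar>dist z x - dist y x\<bar> \<le> 2" using x y z zero_le_dist[of y x] zero_le_dist[of z x] by linarith
            have "riesz_kernel t \<bar>dist z x - dist y x\<bar> \<le> (\<Sum>j. ?b j * indicator {..2 / 2 ^ j} \<bar>dist z x - dist y x\<bar>)"
              by (rule riesz_kernel_le_dyadic_sum) (use t d in auto)
            then have "?k (dist y x) * ?k (dist z x) * riesz_kernel t \<bar>dist z x - dist y x\<bar> \<le> ?k (dist y x) * ?k (dist z x) * (\<Sum>j. ?b j * indicator {..2 / 2 ^ j} \<bar>dist z x - dist y x\<bar>)"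
              by (rule mult_left_mono) simp
            also have "\<dots> = (\<Sum>j. ?g j x y z)"
              unfolding ennreal_suminf_cmult[symmetric] by (simp only: mult_ac)
            finally show "?k (dist y x) * ?k (dist z x) * riesz_kernel t \<bar>dist z x - dist y x\<bar> \<le> (\<Sum>j. ?g j x y z)" .
          qed
        qed
      qed
      also have "\<dots> = (\<Sum>j. ?b j * ?T j)"
        by (simp add: nn_integral_suminf nn_integral_cmult)
      also have "\<dots> \<le> (\<Sum>j. ennreal (C * (real (Suc j) * q ^ j)) * ?cI)"
      proof (rule suminf_le)
        fix j :: nat
        have "?b j * ?T j \<le> ?b j * (ennreal (C * (real (Suc j) * 2 powr (- (real j * \<kappa>)))) * ?cI)"
          by (intro mult_left_mono C(2) \<mu> \<nu> pos) auto
        also have "\<dots> = ennreal ((2 / 2 ^ Suc j) powr - t * (C * (real (Suc j) * 2 powr (- (real j * \<kappa>))))) * ?cI"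
          using C by (simp add: ennreal_mult mult.assoc)
        also have "(2 / 2 ^ Suc j) powr - t * (C * (real (Suc j) * 2 powr (- (real j * \<kappa>)))) = C * (real (Suc j) * q ^ j)"
        proof -
          have "(2::real) / 2 ^ Suc j = 2 powr (- real j)" by (simp add: powr_minus_divide powr_realpow)
          then have "((2::real) / 2 ^ Suc j) powr - t = (2 powr (- real j)) powr - t" by simp
          also have "\<dots> = 2 powr (real j * t)" unfolding powr_powr by simp
          finally have 1: "((2::real) / 2 ^ Suc j) powr - t = 2 powr (real j * t)" .
          have "q ^ j = 2 powr (- (\<kappa> - t) * real j)"
            unfolding q_def by (subst powr_realpow[symmetric]) (auto simp: powr_powr)
          also have "\<dots> = 2 powr (real j * t) * 2 powr (- (real j * \<kappa>))"
            by (simp add: powr_add[symmetric] algebra_simps)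
          finally show ?thesis unfolding 1 by simp
        qed
        finally show "?b j * ?T j \<le> ennreal (C * (real (Suc j) * q ^ j)) * ?cI" .
      qed auto
      also have "\<dots> = ennreal (C * (1 / (1 - q)\<^sup>2)) * ?cI"
      proof -
        have "(\<lambda>j. C * (real (Suc j) * q ^ j)) sums (C * (1 / (1 - q)\<^sup>2))"
          using geometric_deriv_sums[of q] q by (intro sums_mult) (simp_all)
        then have "(\<Sum>j. ennreal (C * (real (Suc j) * q ^ j))) = ennreal (C * (1 / (1 - q)\<^sup>2))"
          by (rule suminf_ennreal_eq[rotated]) (use C q in auto)
        then show ?thesis by (simp only: ennreal_suminf_multc)
      qed
      also have "\<dots> \<le> ennreal (C / (1 - q)\<^sup>2 + 1) * ?cI"
        by (intro mult_right_mono ennreal_leI) auto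
      finally show ?thesis .
    qed
  qed
qed

text \<open>
For \<open>\<alpha> = n\<close> the inequality holds for every \<open>\<beta>\<close>, as the energy on its right-hand side is infinite for every
nonzero measure.
\<close>

lemma sphere_decay_dim: "sphere_decay TYPE('a::euclidean_space) (real DIM('a)) = \<infinity>"
proof -
  have adm: "ereal \<beta> \<le> sphere_decay TYPE('a) (real DIM('a))" if "0 \<le> \<beta>" for \<beta>
    unfolding sphere_decay_def
  proof (rule Sup_upper, intro CollectI exI conjI HOL.refl that ballI allI impI)
    fix M :: "'a measure" and r :: real assume M: "M \<in> unit_ball_measures" and r: "0 < r"
    have s: "sets M = sets borel" and fin: "finite_measure M" using M by (auto simp: unit_ball_measures_iff)
    show "(\<integral>\<^sup>+\<xi>. ennreal ((cmod (fourier M (r *\<^sub>R \<xi>)))\<^sup>2) \<partial>sphere_measure) \<le> ennreal 1 * ennreal (r powr - \<beta>) * energy (real DIM('a)) M"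
    proof (cases "energy (real DIM('a)) M = \<infinity>")
      case True
      then show ?thesis using r by (simp add: ennreal_mult_top)
    next
      case False
      then have "emeasure M UNIV = 0"
        by (intro energy_dim_finite_imp_null s fin) (simp add: less_top)
      then have "emeasure M (space M) = 0" using sets_eq_imp_space_eq[OF s] by simp
      then have "measure M (space M) = 0" by (simp add: measure_def)
      then have "fourier M \<xi> = 0" for \<xi> using cmod_fourier_le[OF fin, of \<xi>] by simp
      then show ?thesis by simp
    qed
  qed (use that in auto)
  show ?thesis
  proof (rule ereal_top)
    fix B :: real
    have "ereal B \<le> ereal (max B 0)" by simp
    also have "\<dots> \<le> sphere_decay TYPE('a) (real DIM('a))" by (rule adm) simp
    finally show "ereal B \<le> sphere_decay TYPE('a) (real DIM('a))" .
  qed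
qed

theorem theorem2p1:
  fixes \<alpha> \<gamma> t :: real
  assumes "CARD('n::finite) \<ge> 2"
    and "0 \<le> \<alpha>" "\<alpha> \<le> real CARD('n)"
    and "0 \<le> \<gamma>" "\<gamma> \<le> real CARD('n)"
    and "0 < t"
    and "ereal t < ereal \<gamma> + sphere_decay TYPE(real ^ 'n) \<alpha> - ereal (real CARD('n)) + 1"
    and "ereal \<gamma> + sphere_decay TYPE(real ^ 'n) \<alpha> - ereal (real CARD('n)) + 1 \<le> 1"
  shows "\<exists>C::real. 0 \<le> C \<and>
    (\<forall>\<mu> \<in> (unit_ball_measures :: (real ^ 'n) measure set). \<forall>\<nu> \<in> unit_ball_measures.
       (\<gamma> \<le> (real CARD('n) - 1) / 2 \<longrightarrow>
          (\<integral>\<^sup>+ x. energy t (dist_push \<nu> (return borel x)) \<partial>\<mu>)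
            \<le> ennreal C * frostman_const \<alpha> \<mu> * energy \<gamma> \<nu>) \<and>
       (\<gamma> > (real CARD('n) - 1) / 2 \<longrightarrow>
          (\<integral>\<^sup>+ x. energy t (weighted_dist \<nu> (return borel x)) \<partial>\<mu>)
            \<le> ennreal C * frostman_const \<alpha> \<mu> * energy \<gamma> \<nu>))"
proof -
  let ?n = "real CARD('n)"
  have dim: "real DIM(real ^ 'n) = ?n" by simp
  obtain S where S: "sphere_decay TYPE(real ^ 'n) \<alpha> = ereal S"
    using assms(7,8) by (cases "sphere_decay TYPE(real ^ 'n) \<alpha>") auto
  have S1: "t < \<gamma> + S - ?n + 1" "\<gamma> + S - ?n + 1 \<le> 1"
    using assms(7,8) unfolding S by (simp_all add: one_ereal_def)
  have "\<alpha> \<noteq> ?n" using sphere_decay_dim[where 'a="real ^ 'n"] S by auto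
  then have \<alpha>: "0 \<le> \<alpha>" "\<alpha> < real DIM(real ^ 'n)" using assms by auto
  have "ereal (t - \<gamma> + ?n - 1) < sphere_decay TYPE(real ^ 'n) \<alpha>" using S1 unfolding S by simp
  moreover define adm where "adm \<beta> C \<longleftrightarrow> (\<forall>M \<in> (unit_ball_measures :: (real ^ 'n) measure set). \<forall>r>0.
          (\<integral>\<^sup>+ \<xi>. ennreal ((cmod (fourier M (r *\<^sub>R \<xi>)))\<^sup>2) \<partial>sphere_measure)
            \<le> ennreal C * ennreal (r powr (- \<beta>)) * energy \<alpha> M)" for \<beta> C :: real
  have decay: "sphere_decay TYPE(real ^ 'n) \<alpha> = Sup {ereal \<beta> |\<beta>. 0 \<le> \<beta> \<and> (\<exists>C. 0 \<le> C \<and> adm \<beta> C)}"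
    unfolding sphere_decay_def adm_def by (rule HOL.refl)
  ultimately obtain \<beta> C0 where \<beta>: "t - \<gamma> + ?n - 1 < \<beta>" "0 \<le> \<beta>" and C0: "0 \<le> C0" and adm: "adm \<beta> C0"
    by (auto simp: less_Sup_iff)
  have "ereal \<beta> \<le> sphere_decay TYPE(real ^ 'n) \<alpha>"
    unfolding decay using \<beta> C0 adm by (intro Sup_upper) blast
  then have "\<beta> \<le> S" unfolding S by simp
  have bound: "spherical_decay_bound TYPE(real ^ 'n) \<alpha> \<beta> C0"
    unfolding spherical_decay_bound_def
  proof (intro ballI allI impI)
    fix M :: "(real ^ 'n) measure" and r :: real assume M: "M \<in> unit_ball_measures" and r: "0 < r"
    have fin: "sets M = sets borel" "finite_measure M" using M by (auto simp: unit_ball_measures_iff)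
    note [measurable] = borel_measurable_fourier[OF fin]
    have "(\<lambda>\<xi>. ennreal ((cmod (fourier M (r *\<^sub>R \<xi>)))\<^sup>2)) \<in> borel_measurable borel" by measurable
    note eq = nn_integral_sphere_measure[OF this]
    show "(\<integral>\<^sup>+\<omega>. ennreal ((cmod (fourier M (r *\<^sub>R \<omega>)))\<^sup>2) \<partial>surface) \<le> ennreal C0 * ennreal (r powr - \<beta>) * energy \<alpha> M"
      unfolding eq[symmetric] by (rule adm[unfolded adm_def, rule_format, OF M r])
  qed
  obtain C1 where C1: "0 \<le> C1" "mollified_decay_bound TYPE(real ^ 'n) \<alpha> \<beta> C1"
    by (rule spherical_decay_bound_mollified[OF \<alpha> C0 bound])
  obtain C where C: "0 < C"
    "\<And>(\<mu> :: (real ^ 'n) measure) \<nu>. \<mu> \<in> unit_ball_measures \<Longrightarrow> \<nu> \<in> unit_ball_measures \<Longrightarrow>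
      (\<integral>\<^sup>+x. energy t (weighted_dist \<nu> (return borel x)) \<partial>\<mu>) \<le> ennreal C * (frostman_const \<alpha> \<mu> * energy \<gamma> \<nu>)"
    by (rule weighted_energy_estimate[OF C1 \<beta>(2), of \<gamma> t]) (use assms \<beta> \<open>\<beta> \<le> S\<close> S1 in auto)
  define K where "K = (2::real) ^ (CARD('n) - 1)"
  have K: "1 \<le> K" by (simp add: K_def)
  show ?thesis
  proof (intro exI[of _ "K * C"] conjI ballI impI)
    show "0 \<le> K * C" using C K by simp
    fix \<mu> \<nu> :: "(real ^ 'n) measure"
    assume \<mu>: "\<mu> \<in> unit_ball_measures" and \<nu>: "\<nu> \<in> unit_ball_measures"
    have s\<nu> [measurable_cong]: "sets \<nu> = sets borel" and f\<nu>: "finite_measure \<nu>" using \<nu> by (auto simp: unit_ball_measures_iff)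
    have s\<mu> [measurable_cong]: "sets \<mu> = sets borel" and AE: "AE x in \<mu>. norm x \<le> 1" using \<mu> by (auto simp: unit_ball_measures_iff)
    interpret \<nu>: finite_measure \<nu> by fact
    let ?E = "\<integral>\<^sup>+x. energy t (weighted_dist \<nu> (return borel x)) \<partial>\<mu>"
    have main: "ennreal K * ?E \<le> ennreal (K * C) * frostman_const \<alpha> \<mu> * energy \<gamma> \<nu>"
      using mult_left_mono[OF C(2)[OF \<mu> \<nu>], of "ennreal K"] K C(1) by (simp add: ennreal_mult mult.assoc)
    have "1 * ?E \<le> ennreal K * ?E"
      using K by (intro mult_right_mono) auto
    with main show "?E \<le> ennreal (K * C) * frostman_const \<alpha> \<mu> * energy \<gamma> \<nu>"
      by simp
    have "(\<integral>\<^sup>+x. energy t (dist_push \<nu> (return borel x)) \<partial>\<mu>) \<le> (\<integral>\<^sup>+x. ennreal K * energy t (weighted_dist \<nu> (return borel x)) \<partial>\<mu>)"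
    proof (rule nn_integral_mono_AE, use AE in eventually_elim)
      fix x :: "real ^ 'n" assume "norm x \<le> 1"
      from energy_dist_push_return_le[OF \<nu> this, of t]
      show "energy t (dist_push \<nu> (return borel x)) \<le> ennreal K * energy t (weighted_dist \<nu> (return borel x))"
        by (simp add: K_def)
    qed
    also have "\<dots> = ennreal K * ?E"
      unfolding energy_weighted_dist_return[OF s\<nu> f\<nu>] by (rule nn_integral_cmult) measurable
    also note main
    finally show "(\<integral>\<^sup>+x. energy t (dist_push \<nu> (return borel x)) \<partial>\<mu>) \<le> ennreal (K * C) * frostman_const \<alpha> \<mu> * energy \<gamma> \<nu>" .
  qed
qed

end
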